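(* Let $M$ be a complete $C^1$ Finsler manifold modeled on a Banach space that admits a $C^1$ Lipschitz bump function, and let $H_1,H_2\colon M\times\mathbb{R}\to\mathbb{R}$ be two continuous functions satisfying condition (A) (defined in the context). Let $u:M\to\mathbb{R}$ be a viscosity subsolution of $u(x)+H_1(x,\|du(x)\|_x)=0$ on $M$ and let $v:M\to\mathbb{R}$ be a viscosity supersolution of $v(x)+H_2(x,\|dv(x)\|_x)=0$ on $M$. If $u$ and $v$ are bounded and for every $x\in M$ either $u$ or $v$ is Lipschitz in a neighborhood of $x$, then $$\sup_M(u-v)\le\sup_{M\times\mathbb{R}}(H_2-H_1).$$
   Context: $C^1$ Finsler manifold (in the sense of Palais): a connected, paracompact $C^1$ Banach manifold $M$ modeled on a Banach space $(X,\|\cdot\|)$, with a continuous map $\|\cdot\|_M:TM\to[0,\infty)$ such that: (P1) for every $x\in M$ the restriction $\|\cdot\|_x$ of $\|\cdot\|_M$ to $T_xM$ is a norm such that for every chart $\varphi:U\to X$ with $x\in U$, the norm $v\in X\mapsto\|d\varphi^{-1}(\varphi(x))(v)\|_x$ is equivalent to $\|\cdot\|$; (P2) for every $x_0\in M$, $\varepsilon>0$ and chart $\varphi:U\to X$ with $x_0\in U$ there is an open neighborhood $W$ of $x_0$ such that for all $x\in W$, $v\in X$, $\frac{1}{1+\varepsilon}\|d\varphi^{-1}(\varphi(x_0))(v)\|_{x_0}\le\|d\varphi^{-1}(\varphi(x))(v)\|_x\le(1+\varepsilon)\|d\varphi^{-1}(\varphi(x_0))(v)\|_{x_0}$. Finsler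 metric: $d(p,q)$ is the infimum of the lengths $\ell(c)=\int_a^b\|c'(t)\|_{c(t)}\,dt$ over piecewise $C^1$ paths $c:[a,b]\to M$ connecting $p$ to $q$. $M$ is complete if $(M,d)$ is complete; Lipschitz is with respect to $d$. $C^1$ Lipschitz bump function on $X$: a $C^1$, Lipschitz function $b:X\to\mathbb{R}$ with bounded, non-empty support. Sub/superdifferential: $D^-f(x)$ (resp. $D^+f(x)$) is the set of $dg(x)\in T_xM^*$ where $g:M\to\mathbb{R}$ is $C^1$ and $f-g$ attains a local minimum (resp. local maximum) at $x$. For $\xi\in T_xM^*$, $\|\xi\|_x$ denotes the dual norm $\sup\{|\xi(v)|:v\in T_xM,\ \|v\|_x=1\}$. For a continuous $H:M\times\mathbb{R}\to\mathbb{R}$, a viscosity subsolution of $u(x)+H(x,\|du(x)\|_x)=0$ is an upper semicontinuous $u$ with $u(x)+H(x,\|\Delta\|_x)\le0$ for every $x\in M$, $\Delta\in D^+u(x)$; a viscosity supersolution is a lower semicontinuous $u$ with $u(x)+H(x,\|\Delta\|_x)\ge0$ for every $x\in M$, $\Delta\in D^-u(x)$. Condition (A) for $H$: there are a constant $C\ge0$ and a continuous function $\omega:\mathbb{R}\times\mathbb{R}\to\mathbb{R}$ with $\omega(0,0)=0$ such that for all $x_1,x_2\in M$ and $t_1,t_2\in\mathbb{R}$, $|H(x_1,t_1)-H(x_2,t_2)|\le\omega(d(x_1,x_2),t_1-t_2)+C\max\{|t_1|,|t_2|\}\,d(x_1,x_2)$. Suprema are taken in the extended reals. *)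

theory Defs
  imports "HOL-Analysis.Analysis"
begin

section \<open>Banach manifolds of class C1\<close>

text \<open>The manifold \<open>M\<close> is a whole type \<open>'m\<close> with its topology; the model space is the type \<open>'x\<close>.
  A chart is a pair of its domain and of a total map, of which only the values on the domain matter.
  Its inverse \<open>\<phi>\<^sup>-\<^sup>1\<close> is \<open>inv_into U \<phi>\<close>.\<close>

type_synonym ('m, 'x) chart = "'m set \<times> ('m \<Rightarrow> 'x)"

definition c1_on :: "'x::real_normed_vector set \<Rightarrow> ('x \<Rightarrow> 'y::real_normed_vector) \<Rightarrow> bool" where
  "c1_on S f \<longleftrightarrow> open S \<and>
     (\<exists>f' :: 'x \<Rightarrow> 'x \<Rightarrow>\<^sub>L 'y.
        (\<forall>x\<in>S. (f has_derivative blinfun_apply (f' x)) (at x)) \<and> continuous_on S f')"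

abbreviation chart_inv :: "('m, 'x) chart \<Rightarrow> 'x \<Rightarrow> 'm" where
  "chart_inv c \<equiv> inv_into (fst c) (snd c)"

definition is_chart :: "('m::topological_space, 'x::real_normed_vector) chart \<Rightarrow> bool" where
  "is_chart c \<longleftrightarrow> open (fst c) \<and> open (snd c ` fst c) \<and>
     homeomorphism (fst c) (snd c ` fst c) (snd c) (chart_inv c)"

definition compatible_charts ::
  "('m::topological_space, 'x::real_normed_vector) chart \<Rightarrow> ('m, 'x) chart \<Rightarrow> bool" where
  "compatible_charts c c' \<longleftrightarrow>
     c1_on (snd c ` (fst c \<inter> fst c')) (snd c' \<circ> chart_inv c) \<and>
     c1_on (snd c' ` (fst c \<inter> fst c')) (snd c \<circ> chart_inv c')"

text \<open>\<open>A\<close> is the maximal atlas, so that the charts of the manifold are exactly the members of \<open>A\<close>.\<close>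

definition c1_atlas :: "('m::topological_space, 'x::real_normed_vector) chart set \<Rightarrow> bool" where
  "c1_atlas A \<longleftrightarrow>
     (\<forall>c\<in>A. is_chart c) \<and> (\<Union>c\<in>A. fst c) = UNIV \<and>
     (\<forall>c\<in>A. \<forall>c'\<in>A. compatible_charts c c') \<and>
     (\<forall>c. is_chart c \<and> (\<forall>c'\<in>A. compatible_charts c c') \<longrightarrow> c \<in> A)"

text \<open>The Hausdorff property is the type class \<open>t2_space\<close>.\<close>

definition paracompact_type :: "'m::t2_space itself \<Rightarrow> bool" where
  "paracompact_type _ \<longleftrightarrow>
     (\<forall>\<U> :: 'm set set. (\<forall>U\<in>\<U>. open U) \<and> \<Union>\<U> = UNIV \<longrightarrow>
        (\<exists>\<V>. (\<forall>V\<in>\<V>. open V) \<and> \<Union>\<V> = UNIV \<and> (\<forall>V\<in>\<V>. \<exists>U\<in>\<U>. V \<subseteq> U) \<and>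
             locally_finite_in euclidean \<V>))"

definition c1_scalar :: "('m::topological_space, 'x::real_normed_vector) chart set \<Rightarrow> ('m \<Rightarrow> real) \<Rightarrow> bool" where
  "c1_scalar A g \<longleftrightarrow> (\<forall>c\<in>A. c1_on (snd c ` fst c) (g \<circ> chart_inv c))"


section \<open>The tangent bundle\<close>

text \<open>A tangent vector at \<open>p\<close> is \<open>p\<close> together with an equivalence class of pairs \<open>(\<phi>, v)\<close>
  of a chart at \<open>p\<close> and a vector of the model space, where \<open>(\<phi>, v)\<close> and \<open>(\<psi>, w)\<close> are equivalent
  iff \<open>w = d(\<psi> \<circ> \<phi>\<^sup>-\<^sup>1)(\<phi>(p)) v\<close>.\<close>

type_synonym ('m, 'x) tvec = "'m \<times> (('m, 'x) chart \<times> 'x) set"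

text \<open>\<open>tangent A c p v\<close> is \<open>d\<phi>\<^sup>-\<^sup>1(\<phi>(p))(v)\<close>, the class of \<open>(\<phi>, v)\<close>, for the chart \<open>c = (U, \<phi>)\<close> at \<open>p\<close>;
  \<open>tcoord c\<close> is \<open>d\<phi>(p)\<close> on the tangent space at \<open>p\<close>.\<close>

definition tangent ::
  "('m, 'x::real_normed_vector) chart set \<Rightarrow> ('m, 'x) chart \<Rightarrow> 'm \<Rightarrow> 'x \<Rightarrow> ('m, 'x) tvec" where
  "tangent A c p v =
     (p, {(c', w). c' \<in> A \<and> p \<in> fst c' \<and>
            w = frechet_derivative (snd c' \<circ> chart_inv c) (at (snd c p)) v})"

definition tcoord :: "('m, 'x) chart \<Rightarrow> ('m, 'x) tvec \<Rightarrow> 'x" where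
  "tcoord c \<xi> = (THE v. (c, v) \<in> snd \<xi>)"

definition tangent_space :: "('m, 'x::real_normed_vector) chart set \<Rightarrow> 'm \<Rightarrow> ('m, 'x) tvec set" where
  "tangent_space A p = {tangent A c p v |c v. c \<in> A \<and> p \<in> fst c}"

definition tangent_bundle :: "('m, 'x::real_normed_vector) chart set \<Rightarrow> ('m, 'x) tvec set" where
  "tangent_bundle A = (\<Union>p. tangent_space A p)"

text \<open>The topology of the tangent bundle: the finest one that makes all the parametrisations
  \<open>U \<times> X \<rightarrow> TM\<close>, \<open>(p, v) \<mapsto> d\<phi>\<^sup>-\<^sup>1(\<phi>(p))(v)\<close>, continuous.\<close>

definition tangent_open ::
  "('m::topological_space, 'x::real_normed_vector) chart set \<Rightarrow> ('m, 'x) tvec set \<Rightarrow> bool" where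
  "tangent_open A W \<longleftrightarrow> W \<subseteq> tangent_bundle A \<and>
     (\<forall>c\<in>A. openin (top_of_set (fst c \<times> UNIV)) {(p, v). p \<in> fst c \<and> tangent A c p v \<in> W})"

definition tangent_topology ::
  "('m::topological_space, 'x::real_normed_vector) chart set \<Rightarrow> ('m, 'x) tvec topology" where
  "tangent_topology A = topology (tangent_open A)"

lemma istopology_tangent_open: "istopology (tangent_open A)"
proof -
  have "tangent_open A (S \<inter> T)" if "tangent_open A S" "tangent_open A T" for S T
  proof -
    have "openin (top_of_set (fst c \<times> UNIV))
            {(p, v). p \<in> fst c \<and> tangent A c p v \<in> S \<inter> T}" if "c \<in> A" for c
    proof -
      have eq: "{(p, v). p \<in> fst c \<and> tangent A c p v \<in> S \<inter> T} =
              {(p, v). p \<in> fst c \<and> tangent A c p v \<in> S} \<inter> {(p, v). p \<in> fst c \<and> tangent A c p v \<in> T}"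
        by auto
      show ?thesis
        unfolding eq using \<open>tangent_open A S\<close> \<open>tangent_open A T\<close> that
        by (intro openin_Int) (auto simp: tangent_open_def)
    qed
    then show ?thesis
      using that by (auto simp: tangent_open_def)
  qed
  moreover have "tangent_open A (\<Union>\<K>)" if "\<forall>K\<in>\<K>. tangent_open A K" for \<K>
  proof -
    have "openin (top_of_set (fst c \<times> UNIV))
            {(p, v). p \<in> fst c \<and> tangent A c p v \<in> \<Union>\<K>}" if "c \<in> A" for c
    proof -
      have eq: "{(p, v). p \<in> fst c \<and> tangent A c p v \<in> \<Union>\<K>} =
              (\<Union>K\<in>\<K>. {(p, v). p \<in> fst c \<and> tangent A c p v \<in> K})"
        by auto
      show ?thesis
        unfolding eq using \<open>\<forall>K\<in>\<K>. tangent_open A K\<close> that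
        by (intro openin_Union) (auto simp: tangent_open_def)
    qed
    then show ?thesis
      using that by (auto simp: tangent_open_def)
  qed
  ultimately show ?thesis
    unfolding istopology_def by blast
qed

lemma openin_tangent_topology: "openin (tangent_topology A) W \<longleftrightarrow> tangent_open A W"
  by (simp add: tangent_topology_def istopology_tangent_open topology_inverse')

text \<open>The linear structure of \<open>T\<^sub>pM\<close> and the differentials below are expressed in one chosen chart
  at \<open>p\<close>; they do not depend on the choice because the transition maps of tangent coordinates are
  linear (chain rule).\<close>

definition chart_at :: "('m, 'x) chart set \<Rightarrow> 'm \<Rightarrow> ('m, 'x) chart" where
  "chart_at A p = (SOME c. c \<in> A \<and> p \<in> fst c)"

definition tangent_zero :: "('m, 'x::real_normed_vector) chart set \<Rightarrow> 'm \<Rightarrow> ('m, 'x) tvec" where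
  "tangent_zero A p = tangent A (chart_at A p) p 0"

definition tangent_add ::
  "('m, 'x::real_normed_vector) chart set \<Rightarrow> 'm \<Rightarrow> ('m, 'x) tvec \<Rightarrow> ('m, 'x) tvec \<Rightarrow> ('m, 'x) tvec" where
  "tangent_add A p \<xi> \<eta> =
     tangent A (chart_at A p) p (tcoord (chart_at A p) \<xi> + tcoord (chart_at A p) \<eta>)"

definition tangent_scale ::
  "('m, 'x::real_normed_vector) chart set \<Rightarrow> 'm \<Rightarrow> real \<Rightarrow> ('m, 'x) tvec \<Rightarrow> ('m, 'x) tvec" where
  "tangent_scale A p r \<xi> = tangent A (chart_at A p) p (r *\<^sub>R tcoord (chart_at A p) \<xi>)"

text \<open>\<open>mdiff A g p\<close> is the differential \<open>dg(p)\<close>, restricted to \<open>T\<^sub>pM\<close> so that it is determined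
  as an element of the cotangent space.\<close>

definition mdiff ::
  "('m, 'x::real_normed_vector) chart set \<Rightarrow> ('m \<Rightarrow> real) \<Rightarrow> 'm \<Rightarrow> ('m, 'x) tvec \<Rightarrow> real" where
  "mdiff A g p = restrict
     (\<lambda>\<xi>. frechet_derivative (g \<circ> chart_inv (chart_at A p)) (at (snd (chart_at A p) p))
            (tcoord (chart_at A p) \<xi>))
     (tangent_space A p)"


section \<open>Finsler manifolds\<close>

definition tangent_norm ::
  "('m, 'x::real_normed_vector) chart set \<Rightarrow> (('m, 'x) tvec \<Rightarrow> real) \<Rightarrow> 'm \<Rightarrow> bool" where
  "tangent_norm A N p \<longleftrightarrow>
     (\<forall>\<xi>\<in>tangent_space A p. 0 \<le> N \<xi> \<and> (N \<xi> = 0 \<longleftrightarrow> \<xi> = tangent_zero A p)) \<and>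
     (\<forall>\<xi>\<in>tangent_space A p. \<forall>r. N (tangent_scale A p r \<xi>) = \<bar>r\<bar> * N \<xi>) \<and>
     (\<forall>\<xi>\<in>tangent_space A p. \<forall>\<eta>\<in>tangent_space A p. N (tangent_add A p \<xi> \<eta>) \<le> N \<xi> + N \<eta>)"

definition finsler_P1 ::
  "('m, 'x::real_normed_vector) chart set \<Rightarrow> (('m, 'x) tvec \<Rightarrow> real) \<Rightarrow> bool" where
  "finsler_P1 A N \<longleftrightarrow>
     (\<forall>p. tangent_norm A N p \<and>
        (\<forall>c\<in>A. p \<in> fst c \<longrightarrow>
           (\<exists>a>0. \<exists>b>0. \<forall>v. a * norm v \<le> N (tangent A c p v) \<and> N (tangent A c p v) \<le> b * norm v)))"

definition finsler_P2 ::
  "('m::topological_space, 'x::real_normed_vector) chart set \<Rightarrow> (('m, 'x) tvec \<Rightarrow> real) \<Rightarrow> bool" where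
  "finsler_P2 A N \<longleftrightarrow>
     (\<forall>p0. \<forall>\<epsilon>>0. \<forall>c\<in>A. p0 \<in> fst c \<longrightarrow>
        (\<exists>W. open W \<and> p0 \<in> W \<and> W \<subseteq> fst c \<and>
           (\<forall>p\<in>W. \<forall>v. 1 / (1 + \<epsilon>) * N (tangent A c p0 v) \<le> N (tangent A c p v) \<and>
                        N (tangent A c p v) \<le> (1 + \<epsilon>) * N (tangent A c p0 v))))"

definition c1_finsler_manifold ::
  "('m::t2_space, 'x::banach) chart set \<Rightarrow> (('m, 'x) tvec \<Rightarrow> real) \<Rightarrow> bool" where
  "c1_finsler_manifold A N \<longleftrightarrow>
     connected (UNIV :: 'm set) \<and> paracompact_type TYPE('m) \<and> c1_atlas A \<and>
     continuous_map (tangent_topology A) (top_of_set {0..}) N \<and>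
     finsler_P1 A N \<and> finsler_P2 A N"

text \<open>A curve is C1 on a closed interval when it is so in all charts, with one-sided derivatives
  at the end points.\<close>

definition c1_curve_on ::
  "('m::topological_space, 'x::real_normed_vector) chart set \<Rightarrow> real set \<Rightarrow> (real \<Rightarrow> 'm) \<Rightarrow> bool" where
  "c1_curve_on A I \<gamma> \<longleftrightarrow> continuous_on I \<gamma> \<and>
     (\<forall>c\<in>A. \<exists>\<delta>.
        (\<forall>t\<in>I \<inter> \<gamma> -` fst c. ((snd c \<circ> \<gamma>) has_vector_derivative \<delta> t) (at t within I)) \<and>
        continuous_on (I \<inter> \<gamma> -` fst c) \<delta>)"

definition piecewise_c1_curve ::
  "('m::topological_space, 'x::real_normed_vector) chart set \<Rightarrow> real \<Rightarrow> real \<Rightarrow> (real \<Rightarrow> 'm) \<Rightarrow> bool" where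
  "piecewise_c1_curve A a b \<gamma> \<longleftrightarrow> a < b \<and>
     (\<exists>n s. s 0 = a \<and> s n = b \<and>
        (\<forall>i<n. s i < s (Suc i) \<and> c1_curve_on A {s i..s (Suc i)} \<gamma>))"

text \<open>At the finitely many break points the velocity is a meaningless tangent vector, which does
  not affect the length.\<close>

definition velocity ::
  "('m, 'x::real_normed_vector) chart set \<Rightarrow> (real \<Rightarrow> 'm) \<Rightarrow> real \<Rightarrow> ('m, 'x) tvec" where
  "velocity A \<gamma> t =
     tangent A (chart_at A (\<gamma> t)) (\<gamma> t) (vector_derivative (snd (chart_at A (\<gamma> t)) \<circ> \<gamma>) (at t))"

definition curve_length ::
  "('m, 'x::real_normed_vector) chart set \<Rightarrow> (('m, 'x) tvec \<Rightarrow> real) \<Rightarrow> real \<Rightarrow> real \<Rightarrow> (real \<Rightarrow> 'm) \<Rightarrow> real" where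
  "curve_length A N a b \<gamma> = integral {a..b} (\<lambda>t. N (velocity A \<gamma> t))"

definition finsler_dist ::
  "('m::topological_space, 'x::real_normed_vector) chart set \<Rightarrow> (('m, 'x) tvec \<Rightarrow> real) \<Rightarrow> 'm \<Rightarrow> 'm \<Rightarrow> real" where
  "finsler_dist A N p q =
     Inf {curve_length A N a b \<gamma> |a b \<gamma>. piecewise_c1_curve A a b \<gamma> \<and> \<gamma> a = p \<and> \<gamma> b = q}"

definition finsler_complete ::
  "('m::topological_space, 'x::real_normed_vector) chart set \<Rightarrow> (('m, 'x) tvec \<Rightarrow> real) \<Rightarrow> bool" where
  "finsler_complete A N \<longleftrightarrow> Metric_space.mcomplete UNIV (finsler_dist A N)"

definition lipschitz_near ::
  "('m::topological_space, 'x::real_normed_vector) chart set \<Rightarrow> (('m, 'x) tvec \<Rightarrow> real) \<Rightarrow> ('m \<Rightarrow> real) \<Rightarrow> 'm \<Rightarrow> bool" where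
  "lipschitz_near A N f x \<longleftrightarrow>
     (\<exists>W L. open W \<and> x \<in> W \<and> (\<forall>p\<in>W. \<forall>q\<in>W. \<bar>f p - f q\<bar> \<le> L * finsler_dist A N p q))"

definition c1_lipschitz_bump :: "('x::real_normed_vector \<Rightarrow> real) \<Rightarrow> bool" where
  "c1_lipschitz_bump b \<longleftrightarrow> c1_on UNIV b \<and> (\<exists>L. L-lipschitz_on UNIV b) \<and>
     bounded (closure {x. b x \<noteq> 0}) \<and> closure {x. b x \<noteq> 0} \<noteq> {}"


section \<open>Viscosity solutions\<close>

definition subdifferential ::
  "('m::topological_space, 'x::real_normed_vector) chart set \<Rightarrow> ('m \<Rightarrow> real) \<Rightarrow> 'm \<Rightarrow> (('m, 'x) tvec \<Rightarrow> real) set" where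
  "subdifferential A f x =
     {mdiff A g x |g. c1_scalar A g \<and> (\<forall>\<^sub>F y in nhds x. f x - g x \<le> f y - g y)}"

definition superdifferential ::
  "('m::topological_space, 'x::real_normed_vector) chart set \<Rightarrow> ('m \<Rightarrow> real) \<Rightarrow> 'm \<Rightarrow> (('m, 'x) tvec \<Rightarrow> real) set" where
  "superdifferential A f x =
     {mdiff A g x |g. c1_scalar A g \<and> (\<forall>\<^sub>F y in nhds x. f y - g y \<le> f x - g x)}"

text \<open>\<open>0\<close> is inserted only for the zero-dimensional case, where there is no unit vector and the
  supremum of the empty set has to be read as \<open>0\<close>.\<close>

definition cotangent_norm ::
  "('m, 'x::real_normed_vector) chart set \<Rightarrow> (('m, 'x) tvec \<Rightarrow> real) \<Rightarrow> 'm \<Rightarrow> (('m, 'x) tvec \<Rightarrow> real) \<Rightarrow> real" where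
  "cotangent_norm A N x \<Delta> = Sup (insert 0 {\<bar>\<Delta> \<xi>\<bar> |\<xi>. \<xi> \<in> tangent_space A x \<and> N \<xi> = 1})"

definition upper_semicont :: "('m::topological_space \<Rightarrow> real) \<Rightarrow> bool" where
  "upper_semicont f \<longleftrightarrow> (\<forall>a. open {x. f x < a})"

definition lower_semicont :: "('m::topological_space \<Rightarrow> real) \<Rightarrow> bool" where
  "lower_semicont f \<longleftrightarrow> (\<forall>a. open {x. a < f x})"

definition viscosity_subsolution ::
  "('m::topological_space, 'x::real_normed_vector) chart set \<Rightarrow> (('m, 'x) tvec \<Rightarrow> real) \<Rightarrow>
     ('m \<times> real \<Rightarrow> real) \<Rightarrow> ('m \<Rightarrow> real) \<Rightarrow> bool" where
  "viscosity_subsolution A N H u \<longleftrightarrow> upper_semicont u \<and>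
     (\<forall>x. \<forall>\<Delta>\<in>superdifferential A u x. u x + H (x, cotangent_norm A N x \<Delta>) \<le> 0)"

definition viscosity_supersolution ::
  "('m::topological_space, 'x::real_normed_vector) chart set \<Rightarrow> (('m, 'x) tvec \<Rightarrow> real) \<Rightarrow>
     ('m \<times> real \<Rightarrow> real) \<Rightarrow> ('m \<Rightarrow> real) \<Rightarrow> bool" where
  "viscosity_supersolution A N H v \<longleftrightarrow> lower_semicont v \<and>
     (\<forall>x. \<forall>\<Delta>\<in>subdifferential A v x. v x + H (x, cotangent_norm A N x \<Delta>) \<ge> 0)"

definition condition_A ::
  "('m::topological_space, 'x::real_normed_vector) chart set \<Rightarrow> (('m, 'x) tvec \<Rightarrow> real) \<Rightarrow>
     ('m \<times> real \<Rightarrow> real) \<Rightarrow> bool" where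
  "condition_A A N H \<longleftrightarrow>
     (\<exists>C\<ge>0. \<exists>\<omega> :: real \<times> real \<Rightarrow> real. continuous_on UNIV \<omega> \<and> \<omega> (0, 0) = 0 \<and>
        (\<forall>x1 x2 t1 t2.
           \<bar>H (x1, t1) - H (x2, t2)\<bar> \<le>
             \<omega> (finsler_dist A N x1 x2, t1 - t2) + C * max \<bar>t1\<bar> \<bar>t2\<bar> * finsler_dist A N x1 x2))"

end

theory Submission
  imports Defs
begin

text \<open>If \<open>u - v\<close> is nearly maximal at a point, Ekeland's principle on the complete space \<open>(M, d)\<close> yields
  a point \<open>x\<^sub>0\<close> where \<open>u - v - \<epsilon> d(x\<^sub>0, \<cdot>)\<close> is maximal. Ekeland's principle needs no bump functions on
  \<open>M\<close>, so no uniformity of bumps over \<open>M\<close> is required; the rest happens in one chart at \<open>x\<^sub>0\<close>. There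
  \<open>d(x\<^sub>0, \<cdot>)\<close> is at most twice the norm of the tangent space at \<open>x\<^sub>0\<close>, and the smooth variational principle of
  Deville, Godefroy and Zizler on \<open>X \<times> X \<times> X\<close>, with penalties for the distances of the three variables,
  separates \<open>- u\<close>, \<open>v\<close> and that norm: it produces nearby points with differentials in \<open>D\<^sup>+u\<close> and
  \<open>D\<^sup>-v\<close> that agree up to \<open>O(\<epsilon>)\<close>. One of \<open>u\<close> and \<open>v\<close> being Lipschitz keeps both differentials
  bounded while the points approach each other, so that condition (A) applies; (P2) compares the dual
  norms at the two points.\<close>

section \<open>Calculus of C1 maps\<close>

text \<open>Neither the metric nor the tangent norm need be differentiable, yet Ekeland's principle
  leaves a multiple of the metric in the inequality. Hence the norm gets a variable of its own: its
  contribution to the sum of derivatives is estimated only through its Lipschitz constant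
  \<open>2 * \<epsilon>\<close>, and this is where the gap \<open>4 * \<epsilon>\<close> between the
  dual norms comes from. The gap does not shrink with the later parameters; \<epsilon> is fixed
  beforehand by the continuity of \<omega> at the origin. Everything chosen after \<open>x0\<close>
  may depend on \<open>x0\<close>. The Lipschitz constant of one summand near \<open>x0\<close>
  bounds its differential, and the almost vanishing sum of derivatives then bounds the other one.
  This bound is known before the points are brought together, so the product of dual norm and
  distance can be made small. The semicontinuous summand carries no modulus of continuity, so its
  variable is tied to the other two by penalties whose derivatives cancel in the sum, however steep
  they are.\<close>

definition c1_deriv ::
  "'x::real_normed_vector set \<Rightarrow> ('x \<Rightarrow> 'y::real_normed_vector) \<Rightarrow> ('x \<Rightarrow> 'x \<Rightarrow>\<^sub>L 'y) \<Rightarrow> bool" where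
  "c1_deriv S f f' \<longleftrightarrow> open S \<and> (\<forall>x\<in>S. (f has_derivative blinfun_apply (f' x)) (at x)) \<and> continuous_on S f'"

text \<open>The derivative is made explicit because the variational principle has to bound its norm,
  which the existential in \<open>c1_on\<close> hides.\<close>

lemma c1_on_c1_deriv: "c1_on S f \<longleftrightarrow> (\<exists>f'. c1_deriv S f f')"
  by (auto simp: c1_on_def c1_deriv_def)

lemma c1_derivI_on: "c1_deriv S f f' \<Longrightarrow> c1_on S f"
  by (auto simp: c1_on_c1_deriv)

lemma c1_deriv_has: "c1_deriv S f f' \<Longrightarrow> x \<in> S \<Longrightarrow> (f has_derivative blinfun_apply (f' x)) (at x)"
  by (auto simp: c1_deriv_def)

lemma c1_on_differentiable:
  assumes "c1_on S f" "x \<in> S"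
  shows "(f has_derivative frechet_derivative f (at x)) (at x)"
  using assms unfolding c1_on_def by (metis differentiableI frechet_derivative_works)

lemma c1_on_continuous_on: "c1_on S f \<Longrightarrow> continuous_on S f"
  unfolding c1_on_def
  by (meson continuous_at_imp_continuous_on has_derivative_continuous)

text \<open>Derivatives on an open set are unique, so the witness in \<open>c1_on\<close> can be
  replaced by a canonical one. Being C1 thereby becomes a pointwise condition, and local pieces can
  be glued.\<close>

lemma c1_on_frechet:
  "c1_on S f \<longleftrightarrow> open S \<and> (\<forall>x\<in>S. f differentiable (at x)) \<and>
     continuous_on S (\<lambda>x. Blinfun (frechet_derivative f (at x)))"
proof
  assume "c1_on S f"
  then obtain f' where f': "open S" "\<And>x. x \<in> S \<Longrightarrow> (f has_derivative blinfun_apply (f' x)) (at x)"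
    "continuous_on S f'" by (auto simp: c1_on_def)
  have "Blinfun (frechet_derivative f (at x)) = f' x" if "x \<in> S" for x
  proof -
    have "frechet_derivative f (at x) = blinfun_apply (f' x)"
      using frechet_derivative_at[OF f'(2)[OF that]] by (rule sym)
    then show ?thesis by (simp only: blinfun_apply_inverse)
  qed
  then have "continuous_on S (\<lambda>x. Blinfun (frechet_derivative f (at x)))"
    using f'(3) continuous_on_cong by fastforce
  then show "open S \<and> (\<forall>x\<in>S. f differentiable (at x)) \<and>
     continuous_on S (\<lambda>x. Blinfun (frechet_derivative f (at x)))"
    using f' by (auto simp: differentiable_def)
next
  assume *: "open S \<and> (\<forall>x\<in>S. f differentiable (at x)) \<and>
     continuous_on S (\<lambda>x. Blinfun (frechet_derivative f (at x)))"
  then have "(f has_derivative blinfun_apply (Blinfun (frechet_derivative f (at x)))) (at x)" if "x \<in> S" for x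
    using that frechet_derivative_works has_derivative_bounded_linear
    by (metis bounded_linear_Blinfun_apply)
  then show "c1_on S f" using *
    unfolding c1_on_def by (intro conjI exI[of _ "\<lambda>x. Blinfun (frechet_derivative f (at x))"]) auto
qed

lemma c1_on_cong:
  assumes "c1_on S f" "\<And>x. x \<in> S \<Longrightarrow> f x = g x"
  shows "c1_on S g"
proof -
  have "open S" using assms by (auto simp: c1_on_def)
  then have "(g has_derivative D) (at x)" if "x \<in> S" "(f has_derivative D) (at x)" for x D
    using has_derivative_transform_within_open[OF that(2) \<open>open S\<close> that(1)] assms(2) by blast
  then show ?thesis using assms(1) unfolding c1_on_def by blast
qed

lemma c1_on_local:
  assumes "\<And>x. x \<in> S \<Longrightarrow> \<exists>T. x \<in> T \<and> T \<subseteq> S \<and> c1_on T f"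
  shows "c1_on S f"
proof -
  have "open S"
    using assms by (subst open_subopen) (meson c1_on_frechet)
  moreover have "f differentiable (at x)" if "x \<in> S" for x
    using assms[OF that] c1_on_frechet by blast
  moreover have "continuous_on S (\<lambda>x. Blinfun (frechet_derivative f (at x)))"
  proof (rule continuous_at_imp_continuous_on, safe)
    fix x assume "x \<in> S"
    then obtain T where "x \<in> T" "c1_on T f" using assms by blast
    then have "open T" "continuous_on T (\<lambda>x. Blinfun (frechet_derivative f (at x)))"
      by (simp_all add: c1_on_frechet)
    then show "isCont (\<lambda>x. Blinfun (frechet_derivative f (at x))) x"
      using continuous_on_interior[of T] interior_open[of T] \<open>x \<in> T\<close> by auto
  qed
  ultimately show ?thesis unfolding c1_on_frechet by blast
qed

lemma c1_on_Un: "c1_on S f \<Longrightarrow> c1_on T f \<Longrightarrow> c1_on (S \<union> T) f"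
  by (rule c1_on_local) (metis Un_iff sup_ge1 sup_ge2)

lemma c1_deriv_compose:
  assumes "c1_deriv S f f'" "c1_deriv T g g'" "f ` S \<subseteq> T"
  shows "c1_deriv S (\<lambda>x. g (f x)) (\<lambda>x. g' (f x) o\<^sub>L f' x)"
  unfolding c1_deriv_def
proof (intro conjI ballI)
  show "open S" using assms by (simp add: c1_deriv_def)
  fix x assume x: "x \<in> S"
  have "(g has_derivative blinfun_apply (g' (f x))) (at (f x))"
    using assms x by (auto simp: c1_deriv_def)
  then show "((\<lambda>x. g (f x)) has_derivative blinfun_apply (g' (f x) o\<^sub>L f' x)) (at x)"
    unfolding blinfun_compose.rep_eq o_def by (rule has_derivative_compose[OF c1_deriv_has[OF assms(1) x]])
next
  have "continuous_on S f" using assms(1) c1_on_continuous_on c1_derivI_on by blast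
  moreover have "continuous_on T g'" "continuous_on S f'" using assms by (auto simp: c1_deriv_def)
  ultimately show "continuous_on S (\<lambda>x. g' (f x) o\<^sub>L f' x)"
    using bounded_bilinear.continuous_on[OF bounded_bilinear_blinfun_compose, of S "\<lambda>x. g' (f x)" f']
      continuous_on_compose2[of T g' S f] assms(3) by blast
qed

lemma c1_on_compose:
  assumes "c1_on S f" "c1_on T g" "f ` S \<subseteq> T"
  shows "c1_on S (\<lambda>x. g (f x))"
proof -
  obtain f' g' where "c1_deriv S f f'" "c1_deriv T g g'" using assms by (auto simp: c1_on_c1_deriv)
  from c1_deriv_compose[OF this assms(3)] show ?thesis by (rule c1_derivI_on)
qed

lemma c1_deriv_const: "open S \<Longrightarrow> c1_deriv S (\<lambda>x. a) (\<lambda>x. 0)"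
  unfolding c1_deriv_def zero_blinfun.rep_eq by simp

lemma c1_deriv_diff:
  "c1_deriv S f f' \<Longrightarrow> c1_deriv S g g' \<Longrightarrow> c1_deriv S (\<lambda>x. f x - g x) (\<lambda>x. f' x - g' x)"
  by (auto simp: c1_deriv_def minus_blinfun.rep_eq intro!: has_derivative_diff continuous_intros)

lemma c1_deriv_mult:
  fixes f g :: "'x::real_normed_vector \<Rightarrow> real"
  assumes "c1_deriv S f f'" "c1_deriv S g g'"
  shows "c1_deriv S (\<lambda>x. f x * g x) (\<lambda>x. f x *\<^sub>R g' x + g x *\<^sub>R f' x)"
proof -
  have "continuous_on S f" "continuous_on S g" using assms c1_on_continuous_on c1_derivI_on by blast+
  moreover have "((\<lambda>x. f x * g x) has_derivative blinfun_apply (f x *\<^sub>R g' x + g x *\<^sub>R f' x)) (at x)"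
    if "x \<in> S" for x
    by (rule has_derivative_eq_rhs[OF has_derivative_mult[OF c1_deriv_has[OF assms(1) that] c1_deriv_has[OF assms(2) that]]])
      (simp add: fun_eq_iff plus_blinfun.rep_eq scaleR_blinfun.rep_eq)
  ultimately show ?thesis using assms
    by (auto simp: c1_deriv_def intro!: continuous_intros)
qed

lemma c1_deriv_cmult:
  fixes f :: "'x::real_normed_vector \<Rightarrow> real"
  assumes "c1_deriv S f f'"
  shows "c1_deriv S (\<lambda>x. a * f x) (\<lambda>x. a *\<^sub>R f' x)"
proof -
  have "c1_deriv S (\<lambda>x. a) (\<lambda>x. 0)" using assms by (intro c1_deriv_const) (simp add: c1_deriv_def)
  from c1_deriv_mult[OF this assms] show ?thesis by simp
qed

lemma c1_deriv_scale_shift: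
  fixes f :: "'x::real_normed_vector \<Rightarrow> 'y::real_normed_vector"
  assumes "c1_deriv UNIV f f'"
  shows "c1_deriv UNIV (\<lambda>x. f (r *\<^sub>R (x - a))) (\<lambda>x. r *\<^sub>R f' (r *\<^sub>R (x - a)))"
proof -
  have "c1_deriv UNIV (\<lambda>x. r *\<^sub>R (x - a)) (\<lambda>x. r *\<^sub>R id_blinfun)"
    by (auto simp: c1_deriv_def scaleR_blinfun.rep_eq intro!: derivative_eq_intros)
  from c1_deriv_compose[OF this assms]
  have "c1_deriv UNIV (\<lambda>x. f (r *\<^sub>R (x - a))) (\<lambda>x. f' (r *\<^sub>R (x - a)) o\<^sub>L (r *\<^sub>R id_blinfun))" by simp
  moreover have "f' (r *\<^sub>R (x - a)) o\<^sub>L (r *\<^sub>R id_blinfun) = r *\<^sub>R f' (r *\<^sub>R (x - a))" for x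
    by (rule blinfun_eqI) (simp add: scaleR_blinfun.rep_eq blinfun.scaleR_right)
  ultimately show ?thesis by simp
qed

text \<open>Summable bounds on the derivatives give uniform convergence in operator norm by the
  Weierstrass test. This yields both the continuity of the summed derivative and the uniformity that
  termwise differentiation requires; the bound \<open>K\<close> makes the values converge.\<close>

lemma c1_deriv_suminf:
  fixes f :: "nat \<Rightarrow> 'x::real_normed_vector \<Rightarrow> 'y::banach"
  assumes f: "\<And>n. c1_deriv UNIV (f n) (f' n)"
    and M: "\<And>n x. norm (f' n x) \<le> M n" "summable M"
    and K: "\<And>n x. norm (f n x) \<le> K n" "summable K"
  shows "c1_deriv UNIV (\<lambda>x. \<Sum>n. f n x) (\<lambda>x. \<Sum>n. f' n x)"
    and "norm (\<Sum>n. f' n x) \<le> suminf M"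
proof -
  have ul: "uniform_limit UNIV (\<lambda>n x. \<Sum>i<n. f' i x) (\<lambda>x. \<Sum>i. f' i x) sequentially"
    using M by (intro Weierstrass_m_test) auto
  have "continuous_on UNIV (\<lambda>x. \<Sum>i. f' i x)"
    using f by (intro uniform_limit_theorem[OF _ ul] always_eventually)
      (auto simp: c1_deriv_def intro!: continuous_intros)
  moreover have "((\<lambda>x. \<Sum>n. f n x) has_derivative blinfun_apply (\<Sum>n. f' n x)) (at x)" for x
  proof -
    \<comment> \<open>\<open>has_derivative_series\<close> yields some limit function with this
      derivative; uniqueness of sums identifies it with the series afterwards.\<close>
    have "\<exists>g. \<forall>x\<in>UNIV. (\<lambda>n. f n x) sums (g x) \<and> (g has_derivative blinfun_apply (\<Sum>n. f' n x)) (at x)"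
    proof (rule has_derivative_series[where f' = "\<lambda>n x. blinfun_apply (f' n x)"])
      fix e :: real assume "e > 0"
      then have "\<forall>\<^sub>F n in sequentially. \<forall>x\<in>UNIV. dist (\<Sum>i<n. f' i x) (\<Sum>i. f' i x) < e"
        using ul by (auto simp: uniform_limit_iff)
      then show "\<forall>\<^sub>F n in sequentially. \<forall>x\<in>UNIV. \<forall>h.
          norm ((\<Sum>i<n. f' i x h) - (\<Sum>n. f' n x) h) \<le> e * norm h"
      proof (eventually_elim, intro ballI allI)
        fix n x h assume "\<forall>x\<in>UNIV. dist (\<Sum>i<n. f' i x) (\<Sum>i. f' i x) < e"
        then have "norm ((\<Sum>i<n. f' i x) - (\<Sum>i. f' i x)) < e" by (simp add: dist_norm)
        moreover have "(\<Sum>i<n. f' i x h) - (\<Sum>n. f' n x) h = ((\<Sum>i<n. f' i x) - (\<Sum>i. f' i x)) h"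
          by (simp add: blinfun.diff_left blinfun.sum_left)
        ultimately show "norm ((\<Sum>i<n. f' i x h) - (\<Sum>n. f' n x) h) \<le> e * norm h"
          by (auto intro!: order_trans[OF norm_blinfun] mult_right_mono)
      qed
    next
      show "(\<lambda>n. f n 0) sums (\<Sum>n. f n 0)"
        using K by (intro summable_sums summable_comparison_test[of "\<lambda>n. f n 0" K]) auto
    qed (use f in \<open>auto simp: c1_deriv_def\<close>)
    then obtain g where g: "\<And>x. (\<lambda>n. f n x) sums (g x)"
      "(g has_derivative blinfun_apply (\<Sum>n. f' n x)) (at x)" by blast
    from g(1) have "(\<lambda>x. \<Sum>n. f n x) = g" by (auto simp: sums_iff)
    with g(2) show ?thesis by simp
  qed
  ultimately show "c1_deriv UNIV (\<lambda>x. \<Sum>n. f n x) (\<lambda>x. \<Sum>n. f' n x)"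
    by (auto simp: c1_deriv_def)
  have s: "summable (\<lambda>n. norm (f' n x))"
    using M by (intro summable_norm_comparison_test[of _ M]) auto
  show "norm (\<Sum>n. f' n x) \<le> suminf M"
    using summable_norm[OF s] suminf_le[OF M(1) s M(2)] by linarith
qed

text \<open>Along the ray from \<open>y\<close> in direction \<open>v\<close>, positive homogeneity
  cancels \<open>t\<close> in the difference quotient, and the bound survives the limit from the
  right. It serves both for the norm of the model space and for a tangent norm read in a
  chart.\<close>

lemma derivative_le_of_increment_le:
  fixes h :: "'x::real_normed_vector \<Rightarrow> real"
  assumes h: "(h has_derivative D) (at y)"
    and hom: "\<And>t v. 0 < t \<Longrightarrow> \<nu> (t *\<^sub>R v) = t * \<nu> v"
    and le: "\<forall>\<^sub>F z in nhds y. h z - h y \<le> K * \<nu> (z - y)"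
  shows "D v \<le> K * \<nu> v"
proof -
  have l: "((\<lambda>t. y + t *\<^sub>R v) has_derivative (\<lambda>t. t *\<^sub>R v)) (at 0)"
    by (auto intro!: derivative_eq_intros)
  have "((\<lambda>t. h (y + t *\<^sub>R v)) has_derivative (\<lambda>t. D (t *\<^sub>R v))) (at 0)"
    using has_derivative_compose[OF l] h by simp
  moreover have "D (t *\<^sub>R v) = D v * t" for t
    using has_derivative_linear[OF h] by (simp add: linear_cmul)
  ultimately have "((\<lambda>t. h (y + t *\<^sub>R v)) has_real_derivative D v) (at 0)"
    by (simp add: has_field_derivative_def mult_commute_abs)
  then have lim: "((\<lambda>t. (h (y + t *\<^sub>R v) - h y) / t) \<longlongrightarrow> D v) (at_right 0)"
    by (auto simp: DERIV_def intro: tendsto_within_subset)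
  have "((\<lambda>t. y + t *\<^sub>R v) \<longlongrightarrow> y + 0 *\<^sub>R v) (at_right 0)" by (intro tendsto_intros)
  then have "\<forall>\<^sub>F t in at_right 0. h (y + t *\<^sub>R v) - h y \<le> K * \<nu> (y + t *\<^sub>R v - y)"
    using le by (intro eventually_compose_filterlim[OF le]) simp
  moreover have "\<forall>\<^sub>F t in at_right (0::real). 0 < t" by (simp add: eventually_at_filter)
  ultimately have "\<forall>\<^sub>F t in at_right 0. (h (y + t *\<^sub>R v) - h y) / t \<le> K * \<nu> v"
    by eventually_elim (simp add: hom field_simps)
  then show ?thesis using tendsto_upperbound[OF lim] by simp
qed

section \<open>Bump functions\<close>

text \<open>With \<open>b a \<noteq> 0\<close> and the support of \<open>b\<close> in the ball of
  radius \<open>R\<close> about \<open>a\<close>, the function is \<open>b (a + R x) / b a\<close>.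
  Its boundedness comes from Lipschitz continuity inside the unit ball and vanishing
  outside.\<close>

lemma normalized_bump:
  fixes b :: "'x::real_normed_vector \<Rightarrow> real"
  assumes "c1_lipschitz_bump b"
  obtains \<beta> :: "'x \<Rightarrow> real" and \<beta>' B L where "c1_deriv UNIV \<beta> \<beta>'" "\<beta> 0 = 1"
    "\<And>x. 1 \<le> norm x \<Longrightarrow> \<beta> x = 0" "1 \<le> B" "0 \<le> L" "\<And>x. \<bar>\<beta> x\<bar> \<le> B" "\<And>x. norm (\<beta>' x) \<le> L"
proof -
  from assms obtain b' l where b: "c1_deriv UNIV b b'" and l: "l-lipschitz_on UNIV b"
    and bd: "bounded (closure {x. b x \<noteq> 0})" and ne: "closure {x. b x \<noteq> 0} \<noteq> {}"
    by (auto simp: c1_lipschitz_bump_def c1_on_c1_deriv)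
  from ne obtain a where a: "b a \<noteq> 0" by auto
  have "bounded {x. b x \<noteq> 0}" using bd bounded_closure_image bounded_subset closure_subset by blast
  then obtain R where R: "0 < R" "\<And>x. b x \<noteq> 0 \<Longrightarrow> norm (x - a) < R"
    using bounded_subset_ballD[of "{x. b x \<noteq> 0}" a] by (auto simp: subset_eq dist_norm norm_minus_commute)
  have l0: "0 \<le> l" using l by (simp add: lipschitz_on_def)
  have bl: "\<bar>b x - b y\<bar> \<le> l * norm (x - y)" for x y
    using lipschitz_onD[OF l, of x y] by (simp add: dist_norm)
  have "norm (b' x) \<le> l" for x
  proof (rule norm_blinfun_bound[OF l0])
    fix v
    have d: "(b has_derivative blinfun_apply (b' x)) (at x)" using b by (auto simp: c1_deriv_def)
    have "b' x w \<le> l * norm w" for w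
    proof (rule derivative_le_of_increment_le[OF d])
      show "\<forall>\<^sub>F z in nhds x. b z - b x \<le> l * norm (z - x)"
        using bl by (intro always_eventually allI) (metis abs_le_D1)
    qed simp
    from this[of v] this[of "-v"] show "norm (b' x v) \<le> l * norm v" by (simp add: blinfun.minus_right)
  qed
  note b'l = this
  \<comment> \<open>The argument \<open>a + R *\<^sub>R x\<close> is written as a scaled shift so
    that \<open>c1_deriv_scale_shift\<close> applies.\<close>
  define \<beta> where "\<beta> = (\<lambda>x. inverse (b a) * b (R *\<^sub>R (x - (- (a /\<^sub>R R)))))"
  define \<beta>' where "\<beta>' = (\<lambda>x. inverse (b a) *\<^sub>R R *\<^sub>R b' (R *\<^sub>R (x - (- (a /\<^sub>R R)))))"
  have arg: "R *\<^sub>R (x - (- (a /\<^sub>R R))) = a + R *\<^sub>R x" for x using R by (simp add: algebra_simps)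
  have "c1_deriv UNIV \<beta> \<beta>'"
    unfolding \<beta>_def \<beta>'_def by (intro c1_deriv_cmult c1_deriv_scale_shift b)
  moreover have "\<beta> 0 = 1" unfolding \<beta>_def arg using a by simp
  moreover have supp: "\<beta> x = 0" if "1 \<le> norm x" for x
    using R(2)[of "a + R *\<^sub>R x"] that R(1) unfolding \<beta>_def arg by auto
  moreover have "norm (\<beta>' x) \<le> \<bar>inverse (b a)\<bar> * (R * l)" for x
    unfolding \<beta>'_def arg norm_scaleR using b'l[of "a + R *\<^sub>R x"] R(1) by (auto intro!: mult_left_mono)
  moreover have "\<bar>\<beta> x\<bar> \<le> 1 + \<bar>inverse (b a)\<bar> * (l * R)" for x
  proof (cases "1 \<le> norm x")
    case True then show ?thesis using supp l0 R(1) by simp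
  next
    case False
    have "\<beta> x - 1 = inverse (b a) * (b (a + R *\<^sub>R x) - b a)"
      unfolding \<beta>_def arg using a by (simp add: algebra_simps)
    then have "\<bar>\<beta> x - 1\<bar> \<le> \<bar>inverse (b a)\<bar> * (l * (R * norm x))"
      using bl[of "a + R *\<^sub>R x" a] R(1) by (auto simp: abs_mult intro!: mult_left_mono)
    also have "\<dots> \<le> \<bar>inverse (b a)\<bar> * (l * R)"
      using False R(1) l0 by (intro mult_left_mono) auto
    finally show ?thesis by linarith
  qed
  ultimately show ?thesis
    using that[of \<beta> \<beta>' "1 + \<bar>inverse (b a)\<bar> * (l * R)" "\<bar>inverse (b a)\<bar> * (R * l)"] l0 R(1) by auto
qed

lemma c1_deriv_sq_pos: "c1_deriv UNIV (\<lambda>t::real. (max 0 t)\<^sup>2) (\<lambda>t. (2 * max 0 t) *\<^sub>R id_blinfun)"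
proof -
  have "((\<lambda>t::real. (max 0 t)\<^sup>2) has_real_derivative 2 * max 0 t) (at t)" for t
  proof -
    consider "t < 0" | "0 < t" | "t = 0" by linarith
    then show ?thesis
    proof cases
      case 1
      have "((\<lambda>t::real. 0) has_real_derivative 0) (at t)" by simp
      then have "((\<lambda>t::real. (max 0 t)\<^sup>2) has_real_derivative 0) (at t)"
        by (rule has_field_derivative_transform_within_open[of _ _ _ "{..<0}"]) (use 1 in auto)
      then show ?thesis using 1 by simp
    next
      case 2
      have "((\<lambda>t::real. t\<^sup>2) has_real_derivative 2 * t) (at t)"
        by (auto intro!: derivative_eq_intros)
      then have "((\<lambda>t::real. (max 0 t)\<^sup>2) has_real_derivative 2 * t) (at t)"
        by (rule has_field_derivative_transform_within_open[of _ _ _ "{0<..}"]) (use 2 in auto)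
      then show ?thesis using 2 by simp
    next
      case 3
      have "((\<lambda>h. \<bar>h\<bar>) \<longlongrightarrow> 0) (at (0::real))" using tendsto_rabs[OF tendsto_ident_at, of "0::real" UNIV] by simp
      moreover have "norm ((max 0 h)\<^sup>2 / h) \<le> \<bar>h\<bar>" for h :: real
        by (cases "0 < h") (auto simp: max_def power2_eq_square)
      ultimately have "((\<lambda>h::real. (max 0 h)\<^sup>2 / h) \<longlongrightarrow> 0) (at 0)"
        using Lim_null_comparison[of "\<lambda>h. (max 0 h)\<^sup>2 / h" "\<lambda>h. \<bar>h\<bar>" "at 0"] by simp
      then show ?thesis using 3 by (simp add: DERIV_def)
    qed
  qed
  then show ?thesis
    by (auto simp: c1_deriv_def has_field_derivative_def scaleR_blinfun.rep_eq mult_commute_abs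
        intro!: continuous_intros)
qed

text \<open>With \<open>s\<close> the C1 function \<open>t \<mapsto> (max 0 t)\<^sup>2\<close>, the composition \<open>s (1 - s (2 - 3 \<beta>))\<close> is \<open>1\<close> where
  \<open>\<beta> \<ge> 2/3\<close> and \<open>0\<close> where \<open>\<beta> \<le> 1/3\<close>.\<close>

lemma plateau_bump:
  fixes \<beta> :: "'x::real_normed_vector \<Rightarrow> real"
  assumes "c1_deriv UNIV \<beta> \<beta>'" "\<beta> 0 = 1" "\<And>x. 1 \<le> norm x \<Longrightarrow> \<beta> x = 0"
  obtains \<theta> :: "'x \<Rightarrow> real" where "c1_on UNIV \<theta>" "\<forall>\<^sub>F x in nhds 0. \<theta> x = 1"
    "\<And>x. 1 \<le> norm x \<Longrightarrow> \<theta> x = 0"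
proof -
  define s where "s = (\<lambda>t::real. (max 0 t)\<^sup>2)"
  define \<theta> where "\<theta> = (\<lambda>x. s (1 - s (2 - 3 * \<beta> x)))"
  have s: "c1_on UNIV s" unfolding s_def using c1_deriv_sq_pos by (rule c1_derivI_on)
  have aff: "c1_on UNIV (\<lambda>x. a - c * f x)" if "c1_on UNIV f" for a c and f :: "'x \<Rightarrow> real"
    using that c1_deriv_diff[OF c1_deriv_const[of UNIV a] c1_deriv_cmult[of UNIV f _ c]]
    unfolding c1_on_c1_deriv by blast
  have "c1_on UNIV (\<lambda>x. 2 - 3 * \<beta> x)"
    by (intro aff) (use assms in \<open>auto simp: c1_on_c1_deriv\<close>)
  then have "c1_on UNIV (\<lambda>x. s (2 - 3 * \<beta> x))"
    by (rule c1_on_compose[OF _ s]) simp_all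
  from aff[OF this, of 1 1] have "c1_on UNIV (\<lambda>x. 1 - s (2 - 3 * \<beta> x))" by simp
  then have "c1_on UNIV \<theta>"
    unfolding \<theta>_def by (rule c1_on_compose[OF _ s]) simp_all
  moreover have "\<forall>\<^sub>F x in nhds 0. \<theta> x = 1"
  proof -
    have "isCont \<beta> 0" using assms(1) by (auto simp: c1_deriv_def intro: has_derivative_continuous)
    then have "(\<beta> \<longlongrightarrow> 1) (nhds 0)"
      using assms(2) tendsto_at_iff_tendsto_nhds[of \<beta> 0] by (simp add: continuous_at)
    then have "\<forall>\<^sub>F x in nhds 0. \<beta> x > 2/3" by (rule order_tendstoD) simp
    then show ?thesis by eventually_elim (simp add: \<theta>_def s_def max_def)
  qed
  moreover have "\<theta> x = 0" if "1 \<le> norm x" for x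
    using assms(3)[OF that] by (simp add: \<theta>_def s_def max_def)
  ultimately show ?thesis using that by blast
qed

section \<open>A smooth variational principle\<close>

lemma approximate_minimizer:
  fixes G :: "'z \<Rightarrow> real"
  assumes "S \<noteq> {}" "\<And>z. z \<in> S \<Longrightarrow> m \<le> G z" "0 < e"
  shows "\<exists>w\<in>S. \<forall>y\<in>S. G w < G y + e"
proof -
  have bdd: "bdd_below (G ` S)" using assms(2) by (intro bdd_belowI[of _ m]) auto
  obtain w where w: "w \<in> S" "G w < Inf (G ` S) + e"
    using cInf_lessD[of "G ` S" "Inf (G ` S) + e"] assms by auto
  have "Inf (G ` S) \<le> G y" if "y \<in> S" for y using bdd that by (simp add: cInf_lower)
  with w(2) have "\<forall>y\<in>S. G w < G y + e" by fastforce
  with w(1) show ?thesis by blast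
qed

text \<open>The Deville-Godefroy-Zizler scheme: at each step a bump is subtracted around an approximate
  minimizer, so high that later approximate minimizers stay in its support, while all the later
  bumps together are too small to undo this.\<close>

lemma bump_variational_principle:
  fixes F :: "'z::complete_space \<Rightarrow> real"
  assumes S: "closed S" "S \<noteq> {}"
    and lsc: "\<And>a. closed {z \<in> S. F z \<le> a}"
    and bdd: "\<And>z. z \<in> S \<Longrightarrow> m \<le> F z"
    and K: "\<And>n w z. \<bar>K n w z\<bar> \<le> B" "\<And>n w. K n w w = 1"
      "\<And>n w z. r n \<le> dist z w \<Longrightarrow> K n w z = 0" "\<And>n w. continuous_on UNIV (K n w)"
    and B: "1 \<le> B"
    and r: "r \<longlonglongrightarrow> 0"
    and \<delta>: "\<And>n. 0 < \<delta> n" "summable \<delta>" "\<And>n. B * (\<Sum>k. \<delta> (k + Suc n)) \<le> \<delta> n / 8"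
  obtains w z where "z \<in> S"
    "\<And>y. y \<in> S \<Longrightarrow> F z - (\<Sum>n. \<delta> n * K n (w n) z) \<le> F y - (\<Sum>n. \<delta> n * K n (w n) y)"
proof -
  \<comment> \<open>A state of the recursion is an approximate minimizer together with the function
    as perturbed so far. The clause for \<open>n = 0\<close> pins the start of the chain, and the
    lower bound is carried along so that a next approximate minimizer exists.\<close>
  define P where "P = (\<lambda>n (wG :: 'z \<times> ('z \<Rightarrow> real)). fst wG \<in> S \<and> (n = 0 \<longrightarrow> snd wG = F) \<and>
    (\<forall>y\<in>S. snd wG (fst wG) < snd wG y + \<delta> n / 4) \<and> (\<exists>m. \<forall>y\<in>S. m \<le> snd wG y))"
  define Q where "Q = (\<lambda>n (wG :: 'z \<times> ('z \<Rightarrow> real)) (wG' :: 'z \<times> ('z \<Rightarrow> real)).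
    snd wG' = (\<lambda>z. snd wG z - \<delta> n * K n (fst wG) z))"
  have ex: "\<exists>w. P n (w, G)" if "\<And>z. z \<in> S \<Longrightarrow> m \<le> G z" "n = 0 \<longrightarrow> G = F" for n m G
  proof -
    have "0 < \<delta> n / 4" using \<delta>(1)[of n] by simp
    with that(1) obtain w where "w \<in> S" "\<And>y. y \<in> S \<Longrightarrow> G w < G y + \<delta> n / 4"
      using approximate_minimizer[OF S(2), of m G] by blast
    then show ?thesis unfolding P_def using that by auto
  qed
  have "\<exists>f. \<forall>n. P n (f n) \<and> Q n (f n) (f (Suc n))"
  proof (rule dependent_nat_choice)
    show "\<exists>x. P 0 x" using ex[of m F 0] bdd by blast
    fix x n assume "P n x"
    then obtain m' where m': "\<And>y. y \<in> S \<Longrightarrow> m' \<le> snd x y" by (auto simp: P_def)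
    have "m' - \<delta> n * B \<le> snd x y - \<delta> n * K n (fst x) y" if "y \<in> S" for y
      using m'[OF that] K(1)[of n "fst x" y] \<delta>(1)[of n] by (intro diff_mono mult_left_mono) auto
    from ex[where n = "Suc n", OF this] show "\<exists>y. P (Suc n) y \<and> Q n x y"
      by (auto simp: Q_def)
  qed
  then obtain f where f: "\<And>n. P n (f n)" "\<And>n. Q n (f n) (f (Suc n))" by blast
  define w where "w = (\<lambda>n. fst (f n))"
  define c where "c = (\<lambda>n z. \<delta> n * K n (w n) z)"
  define G where "G = (\<lambda>n z. snd (f 0) z - (\<Sum>k<n. c k z))"
  have fG: "snd (f n) = G n" for n
  proof (induction n)
    case 0 then show ?case by (simp add: G_def)
  next
    case (Suc n)
    then show ?case using f(2)[of n] by (auto simp: Q_def G_def c_def w_def)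
  qed
  have wS: "w n \<in> S" and wmin: "\<And>y. y \<in> S \<Longrightarrow> G n (w n) < G n y + \<delta> n / 4" for n
    using f(1)[of n] by (auto simp: P_def fG w_def)
  have GS: "G (Suc n) z = G n z - c n z" for n z by (simp add: G_def)
  \<comment> \<open>\<open>T n\<close> bounds everything that the bumps from index \<open>n\<close>
    on can change.\<close>
  define T where "T = (\<lambda>n. B * (\<Sum>k. \<delta> (k + n)))"
  have TS: "T (Suc n) \<le> \<delta> n / 8" for n using \<delta>(3)[of n] by (simp add: T_def)
  have cb: "norm (c n z) \<le> B * \<delta> n" for n z
    using K(1)[of n "w n" z] \<delta>(1)[of n] by (simp add: c_def abs_mult)
  have sB: "summable (\<lambda>n. B * \<delta> n)" using \<delta>(2) by (rule summable_mult)
  have sc: "summable (\<lambda>n. c n z)" for z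
    by (rule summable_comparison_test'[OF sB]) (rule cb)
  have tail: "\<bar>\<Sum>k. c (k + n) z\<bar> \<le> T n" for n z
  proof -
    have "summable (\<lambda>k. \<delta> (k + n))" using \<delta>(2) by (simp add: summable_iff_shift)
    then have s: "summable (\<lambda>k. B * \<delta> (k + n))" and T: "T n = (\<Sum>k. B * \<delta> (k + n))"
      by (simp_all add: summable_mult T_def suminf_mult)
    have s': "summable (\<lambda>k. norm (c (k + n) z))"
      by (rule summable_comparison_test'[OF s]) (use cb in simp)
    have "\<bar>\<Sum>k. c (k + n) z\<bar> \<le> (\<Sum>k. norm (c (k + n) z))"
      using summable_norm[OF s'] by simp
    also have "\<dots> \<le> T n" unfolding T by (rule suminf_le[OF _ s' s]) (rule cb)
    finally show ?thesis .
  qed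
  define \<Psi> where "\<Psi> = (\<lambda>z. \<Sum>n. c n z)"
  define H where "H = (\<lambda>z. snd (f 0) z - \<Psi> z)"
  have HG: "\<bar>H z - G n z\<bar> \<le> T n" for n z
    using tail[of n z] suminf_minus_initial_segment[OF sc[of z], of n]
    by (simp add: H_def G_def \<Psi>_def)
  have GG: "\<bar>G m z - G n z\<bar> \<le> T n" if "n \<le> m" for n m z
  proof -
    have s: "summable (\<lambda>k. B * \<delta> (k + n))" and s1: "summable (\<lambda>k. \<delta> (k + n))"
      using \<delta>(2) by (auto simp: summable_iff_shift intro: summable_mult)
    have "G n z - G m z = (\<Sum>k\<in>{n..<m}. c k z)"
      using that by (simp add: G_def sum_diff_nat_ivl[of 0 n m, simplified atLeast0LessThan])
    also have "\<dots> = (\<Sum>k<m - n. c (k + n) z)"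
      using that by (intro sum.reindex_bij_witness[of _ "\<lambda>k. k + n" "\<lambda>k. k - n"]) auto
    finally have "\<bar>G m z - G n z\<bar> \<le> (\<Sum>k<m - n. \<bar>c (k + n) z\<bar>)"
      by (metis abs_minus_commute sum_abs)
    also have "\<dots> \<le> (\<Sum>k<m - n. B * \<delta> (k + n))" using cb by (intro sum_mono) simp
    also have "\<dots> \<le> (\<Sum>k. B * \<delta> (k + n))"
      using B \<delta>(1) by (intro sum_le_suminf s) (auto intro!: mult_nonneg_nonneg intro: less_imp_le)
    also have "\<dots> = T n" unfolding T_def by (rule suminf_mult[OF s1])
    finally show ?thesis .
  qed
  have \<delta>mono: "\<delta> m \<le> \<delta> n / 8" if "n < m" for n m
  proof -
    have s: "summable (\<lambda>k. \<delta> (k + Suc n))" using \<delta>(2) summable_iff_shift by blast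
    have "\<delta> (m - Suc n + Suc n) \<le> (\<Sum>k. \<delta> (k + Suc n))"
      using sum_le_suminf[OF s, of "{m - Suc n}"] \<delta>(1) less_imp_le by auto
    also have "\<dots> \<le> B * (\<Sum>k. \<delta> (k + Suc n))"
      using mult_right_mono[OF B suminf_nonneg[OF s]] \<delta>(1) by (simp add: less_imp_le)
    also have "\<dots> \<le> \<delta> n / 8" by (rule \<delta>(3))
    finally show ?thesis using that by simp
  qed
  \<comment> \<open>If \<open>w m\<close> were outside the support of bump \<open>n\<close>,
    subtracting that bump would lower the value at \<open>w n\<close> by \<open>\<delta> n\<close>
    and leave the value at \<open>w m\<close> alone. As \<open>w n\<close> was minimal up to
    \<open>\<delta> n / 4\<close>, the point \<open>w m\<close> is then worse by more than three
    quarters of \<open>\<delta> n\<close>. The later bumps recover at most twice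
    \<open>\<delta> n / 8\<close>, which contradicts the minimality of \<open>w m\<close> up to
    \<open>\<delta> m / 4\<close>.\<close>
  have near: "dist (w m) (w n) < r n" if "n < m" for n m
  proof (rule ccontr)
    assume "\<not> ?thesis"
    then have "c n (w m) = 0" using K(3) by (simp add: c_def)
    moreover have "c n (w n) = \<delta> n" by (simp add: c_def K(2))
    moreover have "G m (w m) < G m (w n) + \<delta> m / 4" using wmin wS by blast
    moreover have "G n (w n) < G n (w m) + \<delta> n / 4" using wmin wS by blast
    moreover have "\<bar>G m (w m) - G (Suc n) (w m)\<bar> \<le> T (Suc n)" "\<bar>G m (w n) - G (Suc n) (w n)\<bar> \<le> T (Suc n)"
      using GG[of "Suc n" m] that by auto
    ultimately show False
      using GS[of n "w m"] GS[of n "w n"] TS[of n] \<delta>mono[OF that] \<delta>(1)[of n] by linarith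
  qed
  have "Cauchy w"
  proof (rule metric_CauchyI)
    fix e :: real assume "0 < e"
    then obtain N where N: "r N < e / 2"
      using order_tendstoD(2)[OF r, of "e / 2"] by (auto simp: eventually_sequentially)
    have "dist (w m) (w n) < e" if "m \<ge> Suc N" "n \<ge> Suc N" for m n
      using near[of N m] near[of N n] that N dist_triangle2[of "w m" "w n" "w N"] by simp
    then show "\<exists>M. \<forall>m\<ge>M. \<forall>n\<ge>M. dist (w m) (w n) < e" by blast
  qed
  then obtain z where z: "w \<longlonglongrightarrow> z" using Cauchy_convergent by (auto simp: convergent_def)
  have "z \<in> S" using closed_sequentially[OF S(1) _ z] wS by blast
  have "continuous_on UNIV \<Psi>"
  proof (rule uniform_limit_theorem)
    show "uniform_limit UNIV (\<lambda>n z. \<Sum>k<n. c k z) \<Psi> sequentially"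
      unfolding \<Psi>_def by (rule Weierstrass_m_test[OF _ sB]) (rule cb)
    show "\<forall>\<^sub>F n in sequentially. continuous_on UNIV (\<lambda>z. \<Sum>k<n. c k z)"
      unfolding c_def using K(4) by (intro always_eventually allI continuous_intros) auto
  qed simp
  then have \<Psi>lim: "(\<lambda>n. \<Psi> (w n)) \<longlonglongrightarrow> \<Psi> z"
    by (intro continuous_on_tendsto_compose[OF _ z]) auto
  have \<delta>0: "\<delta> \<longlonglongrightarrow> 0" using \<delta>(2) by (rule summable_LIMSEQ_zero)
  have F0: "snd (f 0) = F" "G 0 = F" using f(1)[of 0] fG[of 0] by (auto simp: P_def)
  \<comment> \<open>Lower semicontinuity enters through closed sublevel sets:
    \<open>F (w (Suc n))\<close> is eventually at most \<open>\<Psi> z + H y + e\<close>, hence so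
    is \<open>F z\<close>. Successor indices occur because the hypothesis on \<delta> controls
    \<open>T\<close> exactly there.\<close>
  have "H z \<le> H y" if "y \<in> S" for y
  proof (rule field_le_epsilon)
    fix e :: real assume "0 < e"
    have "\<forall>\<^sub>F n in sequentially. F (w (Suc n)) \<le> \<Psi> z + H y + e"
    proof -
      have "\<forall>\<^sub>F n in sequentially. \<Psi> (w (Suc n)) < \<Psi> z + e / 2"
        by (rule order_tendstoD(2)[OF LIMSEQ_Suc[OF \<Psi>lim]]) (use \<open>0 < e\<close> in simp)
      moreover have "\<forall>\<^sub>F n in sequentially. \<delta> n < e / 2"
        by (rule order_tendstoD(2)[OF \<delta>0]) (use \<open>0 < e\<close> in simp)
      ultimately show ?thesis
      proof eventually_elim
        case (elim n)
        have "\<delta> (Suc n) \<le> \<delta> n / 8" by (rule \<delta>mono) simp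
        then show ?case
          using elim HG[of "w (Suc n)" "Suc n"] HG[of y "Suc n"] wmin[OF that, of "Suc n"] TS[of n]
            \<delta>(1)[of n] unfolding H_def F0 by linarith
      qed
    qed
    then obtain N where N: "\<And>n. n \<ge> N \<Longrightarrow> F (w (Suc n)) \<le> \<Psi> z + H y + e"
      by (auto simp: eventually_sequentially)
    have lim: "(\<lambda>n. w (Suc (n + N))) \<longlonglongrightarrow> z" using LIMSEQ_ignore_initial_segment[OF LIMSEQ_Suc[OF z]] .
    have "\<And>n. w (Suc (n + N)) \<in> {x \<in> S. F x \<le> \<Psi> z + H y + e}"
      using N wS by simp
    from closed_sequentially[OF lsc this lim] have "z \<in> {x \<in> S. F x \<le> \<Psi> z + H y + e}" .
    then show "H z \<le> H y + e" by (simp add: H_def F0)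
  qed
  then have "F z - (\<Sum>n. \<delta> n * K n (w n) z) \<le> F y - (\<Sum>n. \<delta> n * K n (w n) y)" if "y \<in> S" for y
    using that unfolding H_def F0 \<Psi>_def c_def by blast
  then show ?thesis by (rule that[OF \<open>z \<in> S\<close>])
qed

section \<open>A fuzzy sum rule\<close>

text \<open>Rescaling by \<open>2 ^ n\<close> multiplies the derivative of the bump by
  \<open>2 ^ n\<close>, so the differentiated series is dominated by powers of \<open>2 * q\<close>.
  For \<open>q \<le> 1 / 16\<close> this geometric series sums to at most 2, the factor in the
  bound.\<close>

lemma c1_deriv_bump_series:
  fixes \<beta> :: "'x::real_normed_vector \<Rightarrow> real"
  assumes \<beta>: "c1_deriv UNIV \<beta> \<beta>'" "\<And>x. \<bar>\<beta> x\<bar> \<le> B" "\<And>x. norm (\<beta>' x) \<le> L"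
    and c: "\<And>n. \<bar>c n\<bar> \<le> C * q ^ n" and q: "0 \<le> q" "q \<le> 1 / 16" and C: "0 \<le> C"
  obtains \<psi>' where "c1_deriv UNIV (\<lambda>x. \<Sum>n. c n * \<beta> (2 ^ n *\<^sub>R (x - a n))) \<psi>'"
    "\<And>x. norm (\<psi>' x) \<le> 2 * C * L"
proof -
  have L: "0 \<le> L" and B: "0 \<le> B" using \<beta>(2,3)[of 0] by (auto intro: order_trans[OF norm_ge_zero] order_trans[OF abs_ge_zero])
  have s: "summable (\<lambda>n. q ^ n)" using q by (intro summable_geometric) simp
  have sL: "(\<lambda>n. (C * L) * (2 * q) ^ n) sums ((C * L) * (1 / (1 - 2 * q)))"
    using q by (intro sums_mult geometric_sums) simp
  have nL: "norm (c n *\<^sub>R 2 ^ n *\<^sub>R \<beta>' (2 ^ n *\<^sub>R (x - a n))) \<le> (C * L) * (2 * q) ^ n" for n x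
  proof -
    have "\<bar>c n\<bar> * (2 ^ n * norm (\<beta>' (2 ^ n *\<^sub>R (x - a n)))) \<le> (C * q ^ n) * (2 ^ n * L)"
      using c \<beta>(3) q C by (intro mult_mono mult_left_mono) auto
    also have "(C * q ^ n) * (2 ^ n * L) = (C * L) * (2 * q) ^ n" by (simp add: power_mult_distrib)
    also have "\<bar>c n\<bar> * (2 ^ n * norm (\<beta>' (2 ^ n *\<^sub>R (x - a n)))) =
        norm (c n *\<^sub>R 2 ^ n *\<^sub>R \<beta>' (2 ^ n *\<^sub>R (x - a n)))"
      unfolding norm_scaleR by simp
    finally show ?thesis .
  qed
  have nB: "norm (c n * \<beta> (2 ^ n *\<^sub>R (x - a n))) \<le> (C * B) * q ^ n" for n x
  proof -
    have "\<bar>c n\<bar> * \<bar>\<beta> (2 ^ n *\<^sub>R (x - a n))\<bar> \<le> (C * q ^ n) * B"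
      using c \<beta>(2) q C by (intro mult_mono) auto
    then show ?thesis by (simp add: abs_mult mult_ac)
  qed
  have d: "c1_deriv UNIV (\<lambda>x. c n * \<beta> (2 ^ n *\<^sub>R (x - a n)))
      (\<lambda>x. c n *\<^sub>R 2 ^ n *\<^sub>R \<beta>' (2 ^ n *\<^sub>R (x - a n)))" for n
    by (intro c1_deriv_cmult c1_deriv_scale_shift \<beta>)
  note D = c1_deriv_suminf[OF d nL sums_summable[OF sL] nB summable_mult[OF s]]
  have "1 / (1 - 2 * q) \<le> 2" using q by (simp add: field_simps)
  then have "suminf (\<lambda>n. (C * L) * (2 * q) ^ n) \<le> C * L * 2"
    using sums_unique[OF sL] C L by (metis mult_left_mono mult_nonneg_nonneg)
  with D(2) have "norm (\<Sum>n. c n *\<^sub>R 2 ^ n *\<^sub>R \<beta>' (2 ^ n *\<^sub>R (x - a n))) \<le> 2 * C * L" for x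
    by (intro order_trans[OF D(2)]) simp
  then show ?thesis by (rule that[OF D(1)])
qed

text \<open>Closed sublevel sets express lower semicontinuity on \<open>S\<close>. Along a
  convergent sequence \<open>G\<close> is eventually above \<open>G l - e\<close>, which confines
  \<open>F\<close> to a fixed sublevel set, and then \<open>e\<close> tends to 0.\<close>

lemma closed_sublevel_add:
  fixes F G :: "'z::metric_space \<Rightarrow> real"
  assumes S: "closed S" and F: "\<And>a. closed {z \<in> S. F z \<le> a}" and G: "continuous_on S G"
  shows "closed {z \<in> S. F z + G z \<le> a}"
  unfolding closed_sequential_limits
proof (intro allI impI)
  fix x l assume "(\<forall>n. x n \<in> {z \<in> S. F z + G z \<le> a}) \<and> x \<longlonglongrightarrow> l"
  then have x: "\<And>n. x n \<in> S" "\<And>n. F (x n) + G (x n) \<le> a" and l: "x \<longlonglongrightarrow> l" by auto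
  have lS: "l \<in> S" using closed_sequentially[OF S _ l] x by blast
  have Gl: "(\<lambda>n. G (x n)) \<longlonglongrightarrow> G l"
    using continuous_on_tendsto_compose[OF G l lS] x(1) by simp
  have "F l \<le> (a - G l) + e" if "0 < e" for e
  proof -
    have "\<forall>\<^sub>F n in sequentially. G l - e < G (x n)"
      by (rule order_tendstoD(1)[OF Gl]) (use that in simp)
    then obtain N where N: "\<And>n. n \<ge> N \<Longrightarrow> G l - e < G (x n)" by (auto simp: eventually_sequentially)
    have "x (n + N) \<in> {z \<in> S. F z \<le> (a - G l) + e}" for n
      using N[of "n + N"] x[of "n + N"] by simp
    from closed_sequentially[OF F _ LIMSEQ_ignore_initial_segment[OF l, of N], of "(a - G l) + e"] this
    show ?thesis by blast
  qed
  then have "F l \<le> a - G l" by (rule field_le_epsilon)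
  then show "l \<in> {z \<in> S. F z + G z \<le> a}" using lS by simp
qed

lemma dist_triple_le: "dist (x, y, z) (a, b, c) \<le> norm (x - a) + norm (y - b) + norm (z - c)"
  for x y z a b c :: "'x::real_normed_vector"
proof -
  have "dist (x, y, z) (a, b, c) \<le> dist x a + dist (y, z) (b, c)"
    unfolding dist_Pair_Pair[of x "(y, z)"] by (intro sqrt_sum_squares_le_sum) auto
  also have "dist (y, z) (b, c) \<le> dist y b + dist z c"
    unfolding dist_Pair_Pair by (intro sqrt_sum_squares_le_sum) auto
  finally show ?thesis by (simp add: dist_norm)
qed

text \<open>The bumps on the product are products of bumps on \<open>X\<close>, so that the perturbation is C1 in each
  variable separately, with small derivatives. Joint differentiability is not needed.\<close>

lemma smooth_variational_principle_triple:
  fixes F :: "'x::banach \<times> 'x \<times> 'x \<Rightarrow> real" and b :: "'x \<Rightarrow> real"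
  assumes b: "c1_lipschitz_bump b"
    and S: "closed S" "S \<noteq> {}"
    and lsc: "\<And>a. closed {z \<in> S. F z \<le> a}"
    and bdd: "\<And>z. z \<in> S \<Longrightarrow> m \<le> F z"
    and \<epsilon>: "0 < \<epsilon>"
  obtains \<psi> x y z \<psi>1 \<psi>2 \<psi>3 where "(x, y, z) \<in> S"
    "\<And>p. p \<in> S \<Longrightarrow> F (x, y, z) - \<psi> (x, y, z) \<le> F p - \<psi> p"
    "\<And>p. \<bar>\<psi> p\<bar> \<le> \<epsilon>"
    "c1_deriv UNIV (\<lambda>t. \<psi> (t, y, z)) \<psi>1" "\<And>t. norm (\<psi>1 t) \<le> \<epsilon>"
    "c1_deriv UNIV (\<lambda>t. \<psi> (x, t, z)) \<psi>2" "\<And>t. norm (\<psi>2 t) \<le> \<epsilon>"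
    "c1_deriv UNIV (\<lambda>t. \<psi> (x, y, t)) \<psi>3" "\<And>t. norm (\<psi>3 t) \<le> \<epsilon>"
proof -
  from b obtain \<beta> :: "'x \<Rightarrow> real" and \<beta>' B L where \<beta>: "c1_deriv UNIV \<beta> \<beta>'" "\<beta> 0 = 1"
    "\<And>x. 1 \<le> norm x \<Longrightarrow> \<beta> x = 0" "1 \<le> B" "0 \<le> L" "\<And>x. \<bar>\<beta> x\<bar> \<le> B" "\<And>x. norm (\<beta>' x) \<le> L"
    by (rule normalized_bump) blast
  have contb: "continuous_on UNIV \<beta>" using \<beta>(1) c1_derivI_on c1_on_continuous_on by blast
  define K where "K = (\<lambda>(n::nat) (w :: 'x \<times> 'x \<times> 'x) (z :: 'x \<times> 'x \<times> 'x).
    \<beta> (2 ^ n *\<^sub>R (fst z - fst w)) * (\<beta> (2 ^ n *\<^sub>R (fst (snd z) - fst (snd w))) *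
      \<beta> (2 ^ n *\<^sub>R (snd (snd z) - snd (snd w)))))"
  \<comment> \<open>The product of three bumps is bounded by \<open>B ^ 3\<close>, so
    \<open>B ^ 3 * q = 1 / 16\<close> makes the tail of the coefficients at most an eighth of the
    preceding one. In \<open>d\<close>, the first bound keeps the values of the perturbation below
    \<epsilon> and the second its partial derivatives, in which two factors stay undifferentiated;
    \<open>L + 1\<close> avoids division by 0.\<close>
  define q where "q = 1 / (16 * B ^ 3)"
  define d where "d = min (\<epsilon> / (2 * B ^ 3)) (\<epsilon> / (2 * B\<^sup>2 * (L + 1)))"
  have B3: "1 \<le> B ^ 3" "0 < B ^ 3" "0 < B\<^sup>2" using \<beta>(4) by (auto intro: one_le_power)
  have q: "0 < q" "q \<le> 1 / 16" using B3 by (auto simp: q_def field_simps)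
  have d: "0 < d" using \<epsilon> B3 \<beta>(5) by (simp add: d_def)
  have dB: "d * B ^ 3 \<le> \<epsilon> / 2"
  proof -
    have "d \<le> \<epsilon> / (2 * B ^ 3)" by (simp add: d_def)
    then show ?thesis using B3 by (simp add: field_simps)
  qed
  have dL: "2 * (d * B\<^sup>2) * L \<le> \<epsilon>"
  proof -
    have "d \<le> \<epsilon> / (2 * B\<^sup>2 * (L + 1))" by (simp add: d_def)
    then have "d * (2 * B\<^sup>2 * (L + 1)) \<le> \<epsilon>" using B3 \<beta>(5) by (subst (asm) pos_le_divide_eq) auto
    moreover have "2 * (d * B\<^sup>2) * L \<le> d * (2 * B\<^sup>2 * (L + 1))"
      using d B3 by (simp add: algebra_simps)
    ultimately show ?thesis by linarith
  qed
  have geo: "(\<lambda>n. q ^ n) sums (1 / (1 - q))" using q by (intro geometric_sums) simp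
  have Kb: "\<bar>K n w z\<bar> \<le> B ^ 3" for n w z
    unfolding K_def abs_mult power3_eq_cube mult.assoc
    using \<beta>(4,6) by (intro mult_mono) auto
  have K1: "K n w w = 1" for n w by (simp add: K_def \<beta>(2))
  \<comment> \<open>Points at distance at least 3 times \<open>(1 / 2) ^ n\<close> differ by at
    least \<open>(1 / 2) ^ n\<close> in some component, and that factor of the product
    vanishes.\<close>
  have K0: "K n w z = 0" if "3 * (1 / 2) ^ n \<le> dist z w" for n w z
  proof -
    have "dist z w \<le> norm (fst z - fst w) + norm (fst (snd z) - fst (snd w)) + norm (snd (snd z) - snd (snd w))"
      using dist_triple_le[of "fst z" "fst (snd z)" "snd (snd z)" "fst w" "fst (snd w)" "snd (snd w)"] by simp
    with that have "(1 / 2) ^ n \<le> norm (fst z - fst w) \<or> (1 / 2) ^ n \<le> norm (fst (snd z) - fst (snd w)) \<or>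
      (1 / 2) ^ n \<le> norm (snd (snd z) - snd (snd w))" by linarith
    moreover have "\<beta> (2 ^ n *\<^sub>R v) = 0" if "(1 / 2) ^ n \<le> norm v" for v
      using that by (intro \<beta>(3)) (simp add: power_one_over field_simps)
    ultimately show ?thesis by (auto simp: K_def)
  qed
  have Kc: "continuous_on UNIV (K n w)" for n w
    unfolding K_def
    by (intro continuous_intros continuous_on_compose2[OF contb]) auto
  have r0: "(\<lambda>n. 3 * (1 / 2 :: real) ^ n) \<longlonglongrightarrow> 0"
    using tendsto_mult_right_zero[OF LIMSEQ_realpow_zero[of "1/2::real"]] by simp
  have \<delta>: "B ^ 3 * (\<Sum>k. d * q ^ (k + Suc n)) \<le> d * q ^ n / 8" for n
  proof -
    have "(\<lambda>k. (d * q ^ Suc n) * q ^ k) sums ((d * q ^ Suc n) * (1 / (1 - q)))"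
      by (intro sums_mult geo)
    then have "(\<Sum>k. d * q ^ (k + Suc n)) = (d * q ^ Suc n) * (1 / (1 - q))"
      by (simp add: sums_iff power_add mult_ac)
    then have "B ^ 3 * (\<Sum>k. d * q ^ (k + Suc n)) = (d * q ^ n) * ((B ^ 3 * q) * (1 / (1 - q)))"
      by (simp add: mult_ac)
    also have "B ^ 3 * q = 1 / 16" using B3 by (simp add: q_def)
    also have "(d * q ^ n) * (1 / 16 * (1 / (1 - q))) \<le> (d * q ^ n) * (1 / 8)"
      using q d by (intro mult_left_mono) (auto simp: field_simps)
    finally show ?thesis by simp
  qed
  have s\<delta>: "summable (\<lambda>n. d * q ^ n)" using geo by (intro summable_mult sums_summable)
  obtain w z where wz: "z \<in> S"
    "\<And>y. y \<in> S \<Longrightarrow> F z - (\<Sum>n. (d * q ^ n) * K n (w n) z) \<le> F y - (\<Sum>n. (d * q ^ n) * K n (w n) y)"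
    by (rule bump_variational_principle[OF S lsc bdd Kb K1 K0 Kc B3(1) r0 _ s\<delta> \<delta>])
      (use d q in auto)
  obtain x1 x2 x3 where z: "z = (x1, x2, x3)" by (cases z) auto
  define \<psi> where "\<psi> = (\<lambda>z. \<Sum>n. (d * q ^ n) * K n (w n) z)"
  have "\<bar>\<psi> p\<bar> \<le> \<epsilon>" for p
  proof -
    have n: "norm ((d * q ^ n) * K n (w n) p) \<le> (d * B ^ 3) * q ^ n" for n
    proof -
      have "\<bar>d * q ^ n\<bar> * \<bar>K n (w n) p\<bar> \<le> (d * q ^ n) * B ^ 3"
        using Kb d q by (intro mult_mono) auto
      then show ?thesis by (simp add: abs_mult mult_ac)
    qed
    have g: "(\<lambda>n. (d * B ^ 3) * q ^ n) sums ((d * B ^ 3) * (1 / (1 - q)))" by (intro sums_mult geo)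
    have s: "summable (\<lambda>n. norm ((d * q ^ n) * K n (w n) p))"
      by (rule summable_comparison_test'[OF sums_summable[OF g]]) (use n in simp)
    have "\<bar>\<psi> p\<bar> \<le> (d * B ^ 3) * (1 / (1 - q))"
      using summable_norm[OF s] suminf_le[OF n s sums_summable[OF g]] sums_unique[OF g]
      by (simp add: \<psi>_def)
    also have "\<dots> \<le> (\<epsilon> / 2) * 2"
      using dB q \<epsilon> by (intro mult_mono) (auto simp: field_simps)
    finally show ?thesis by simp
  qed
  note \<psi>b = this
  \<comment> \<open>With two variables frozen, their bumps become part of the coefficients and
    contribute at most \<open>B\<^sup>2\<close>; what remains is a bump series in the third
    variable.\<close>
  have part: "\<exists>\<psi>'. c1_deriv UNIV (\<lambda>t. \<Sum>n. ((d * q ^ n) * (\<beta> (u n) * \<beta> (v n))) * \<beta> (2 ^ n *\<^sub>R (t - a n))) \<psi>'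
      \<and> (\<forall>t. norm (\<psi>' t) \<le> \<epsilon>)" for u v a
  proof -
    have cn: "\<bar>(d * q ^ n) * (\<beta> (u n) * \<beta> (v n))\<bar> \<le> (d * B\<^sup>2) * q ^ n" for n
    proof -
      have "\<bar>d * q ^ n\<bar> * (\<bar>\<beta> (u n)\<bar> * \<bar>\<beta> (v n)\<bar>) \<le> (d * q ^ n) * (B * B)"
        using \<beta>(4,6) d q by (intro mult_mono) (auto simp: abs_mult)
      then show ?thesis by (simp add: abs_mult mult_ac power2_eq_square)
    qed
    obtain \<psi>' where "c1_deriv UNIV (\<lambda>t. \<Sum>n. ((d * q ^ n) * (\<beta> (u n) * \<beta> (v n))) * \<beta> (2 ^ n *\<^sub>R (t - a n))) \<psi>'"
      "\<And>t. norm (\<psi>' t) \<le> 2 * (d * B\<^sup>2) * L"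
      by (rule c1_deriv_bump_series[OF \<beta>(1,6,7) cn, of a]) (use q d B3 in auto)
    with dL show ?thesis by (meson order_trans)
  qed
  have e1: "(\<lambda>t. \<psi> (t, x2, x3)) = (\<lambda>t. \<Sum>n. ((d * q ^ n) * (\<beta> (2 ^ n *\<^sub>R (x2 - fst (snd (w n)))) *
      \<beta> (2 ^ n *\<^sub>R (x3 - snd (snd (w n)))))) * \<beta> (2 ^ n *\<^sub>R (t - fst (w n))))"
    by (simp add: \<psi>_def K_def mult_ac)
  have e2: "(\<lambda>t. \<psi> (x1, t, x3)) = (\<lambda>t. \<Sum>n. ((d * q ^ n) * (\<beta> (2 ^ n *\<^sub>R (x1 - fst (w n))) *
      \<beta> (2 ^ n *\<^sub>R (x3 - snd (snd (w n)))))) * \<beta> (2 ^ n *\<^sub>R (t - fst (snd (w n)))))"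
    by (simp add: \<psi>_def K_def mult_ac)
  have e3: "(\<lambda>t. \<psi> (x1, x2, t)) = (\<lambda>t. \<Sum>n. ((d * q ^ n) * (\<beta> (2 ^ n *\<^sub>R (x1 - fst (w n))) *
      \<beta> (2 ^ n *\<^sub>R (x2 - fst (snd (w n)))))) * \<beta> (2 ^ n *\<^sub>R (t - snd (snd (w n)))))"
    by (simp add: \<psi>_def K_def mult_ac)
  obtain \<psi>1 where \<psi>1: "c1_deriv UNIV (\<lambda>t. \<psi> (t, x2, x3)) \<psi>1" "\<And>t. norm (\<psi>1 t) \<le> \<epsilon>"
    unfolding e1 using part[of "\<lambda>n. 2 ^ n *\<^sub>R (x2 - fst (snd (w n)))" "\<lambda>n. 2 ^ n *\<^sub>R (x3 - snd (snd (w n)))" "\<lambda>n. fst (w n)"] by blast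
  obtain \<psi>2 where \<psi>2: "c1_deriv UNIV (\<lambda>t. \<psi> (x1, t, x3)) \<psi>2" "\<And>t. norm (\<psi>2 t) \<le> \<epsilon>"
    unfolding e2 using part[of "\<lambda>n. 2 ^ n *\<^sub>R (x1 - fst (w n))" "\<lambda>n. 2 ^ n *\<^sub>R (x3 - snd (snd (w n)))" "\<lambda>n. fst (snd (w n))"] by blast
  obtain \<psi>3 where \<psi>3: "c1_deriv UNIV (\<lambda>t. \<psi> (x1, x2, t)) \<psi>3" "\<And>t. norm (\<psi>3 t) \<le> \<epsilon>"
    unfolding e3 using part[of "\<lambda>n. 2 ^ n *\<^sub>R (x1 - fst (w n))" "\<lambda>n. 2 ^ n *\<^sub>R (x2 - fst (snd (w n)))" "\<lambda>n. snd (snd (w n))"] by blast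
  have "(x1, x2, x3) \<in> S" "\<And>p. p \<in> S \<Longrightarrow> F (x1, x2, x3) - \<psi> (x1, x2, x3) \<le> F p - \<psi> p"
    using wz by (auto simp: z \<psi>_def)
  then show ?thesis using that[OF _ _ \<psi>b \<psi>1 \<psi>2 \<psi>3] by blast
qed

lemma Lipschitz_imp_continuous_on:
  fixes F :: "'x::real_normed_vector \<Rightarrow> real"
  assumes "\<And>x y. x \<in> S \<Longrightarrow> y \<in> S \<Longrightarrow> \<bar>F x - F y\<bar> \<le> l * norm (x - y)" "0 \<le> l"
  shows "continuous_on S F"
  using lipschitz_on_continuous_on[of l S F] assms by (auto simp: lipschitz_on_def dist_norm)

text \<open>Each summand gets its own variable, and the variational principle is applied to the sum
  plus penalties. The penalties for \<open>x - y\<close> and \<open>x - z\<close> depend only on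
  differences, so their partial derivatives cancel exactly in \<open>D1 + D2 + D3\<close>, whatever
  the size of \<open>\<kappa> / s2\<close>. What is left are the small derivatives of the
  perturbation and the gradient of the penalty for \<open>x - x0\<close>, which is weak on purpose.
  Lipschitz continuity of \<open>F2\<close> and \<open>F3\<close> makes the separation of the
  variables cost little in value.\<close>

lemma fuzzy_sum:
  fixes F1 F2 F3 :: "'x::banach \<Rightarrow> real" and b :: "'x \<Rightarrow> real"
  assumes b: "c1_lipschitz_bump b" and r: "0 < r"
    and lsc: "\<And>a. closed {x \<in> cball x0 r. F1 x \<le> a}"
    and bdd: "\<And>x. x \<in> cball x0 r \<Longrightarrow> m \<le> F1 x"
    and lip2: "\<And>x y. x \<in> cball x0 r \<Longrightarrow> y \<in> cball x0 r \<Longrightarrow> \<bar>F2 x - F2 y\<bar> \<le> l * norm (x - y)"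
    and lip3: "\<And>x y. x \<in> cball x0 r \<Longrightarrow> y \<in> cball x0 r \<Longrightarrow> \<bar>F3 x - F3 y\<bar> \<le> l * norm (x - y)"
    and min: "\<And>x. x \<in> cball x0 r \<Longrightarrow> F1 x0 + F2 x0 + F3 x0 \<le> F1 x + F2 x + F3 x"
    and l: "0 \<le> l" and \<eta>: "0 < \<eta>"
  obtains x y z h1 h2 h3 D1 D2 D3 where
    "c1_on UNIV h1" "c1_on UNIV h2" "c1_on UNIV h3"
    "(h1 has_derivative D1) (at x)" "(h2 has_derivative D2) (at y)" "(h3 has_derivative D3) (at z)"
    "\<forall>\<^sub>F t in nhds x. F1 x - h1 x \<le> F1 t - h1 t"
    "\<forall>\<^sub>F t in nhds y. F2 y - h2 y \<le> F2 t - h2 t"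
    "\<forall>\<^sub>F t in nhds z. F3 z - h3 z \<le> F3 t - h3 t"
    "dist x x0 < \<eta>" "dist y x0 < \<eta>" "dist z x0 < \<eta>"
    "dist x x0 < r" "dist y x0 < r" "dist z x0 < r"
    "\<And>v. \<bar>D1 v + D2 v + D3 v\<bar> \<le> \<eta> * norm v"
    "F1 x \<le> F1 x0 + \<eta>"
proof -
  from b obtain \<beta> :: "'x \<Rightarrow> real" and \<beta>' B L where \<beta>: "c1_deriv UNIV \<beta> \<beta>'" "\<beta> 0 = 1"
    "\<And>x. 1 \<le> norm x \<Longrightarrow> \<beta> x = 0" "1 \<le> B" "0 \<le> L" "\<And>x. \<bar>\<beta> x\<bar> \<le> B" "\<And>x. norm (\<beta>' x) \<le> L"
    by (rule normalized_bump) blast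
  \<comment> \<open>Nonnegative, 0 at the origin and 1 off the unit ball; in between nothing is
    known about \<beta>, so the penalty only detects arguments of norm at least 1.\<close>
  define Q where "Q = (\<lambda>x. (1 - \<beta> x) * (1 - \<beta> x))"
  define Q' where "Q' = (\<lambda>x. (1 - \<beta> x) *\<^sub>R (0 - \<beta>' x) + (1 - \<beta> x) *\<^sub>R (0 - \<beta>' x))"
  define M where "M = 2 * ((1 + B) * L)"
  have Q: "c1_deriv UNIV Q Q'" unfolding Q_def Q'_def
    by (intro c1_deriv_mult c1_deriv_diff c1_deriv_const \<beta>(1)) auto
  have Qc: "continuous_on UNIV Q" using Q c1_derivI_on c1_on_continuous_on by blast
  have Q0: "Q 0 = 0" and Q1: "\<And>x. 1 \<le> norm x \<Longrightarrow> Q x = 1" and Qp: "\<And>x. 0 \<le> Q x"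
    using \<beta>(2,3) by (auto simp: Q_def)
  have M0: "0 \<le> M" using \<beta>(4,5) by (simp add: M_def)
  have Q'M: "norm (Q' x) \<le> M" for x
  proof -
    have "\<bar>1 - \<beta> x\<bar> * norm (\<beta>' x) \<le> (1 + B) * L"
      using \<beta>(6)[of x] \<beta>(7)[of x] by (intro mult_mono) auto
    then have "norm ((1 - \<beta> x) *\<^sub>R (0 - \<beta>' x)) \<le> (1 + B) * L" by simp
    then show ?thesis unfolding Q'_def M_def using norm_triangle_ineq[of "(1 - \<beta> x) *\<^sub>R (0 - \<beta>' x)"]
      by (smt (verit, best))
  qed
  \<comment> \<open>\<open>s\<close> localizes the points, with \<open>r / 4\<close> keeping all
    three in the interior of the ball. \<mu> is small enough for the gradient of the localizing
    penalty, at most \<open>\<mu> / s * M\<close>, to be below \<open>\<eta> / 4\<close>. Then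
    \<open>s2\<close> and \<epsilon> make the errors from separating the variables and from the
    perturbation smaller than \<mu>, so that the localizing penalty still takes effect. \<kappa>
    exceeds all that can be gained by moving the variables apart.\<close>
  define s where "s = min (min (\<eta> / 4) (r / 4)) (\<eta> / (8 * (l + 1)))"
  define \<mu> where "\<mu> = min \<eta> (\<eta> * s / (4 * (M + 1)))"
  define s2 where "s2 = min s (\<mu> / (8 * (l + 1)))"
  define \<epsilon> where "\<epsilon> = min (\<mu> / 8) (\<eta> / 8)"
  define \<kappa> where "\<kappa> = \<bar>F1 x0 - m\<bar> + 2 * (l * r) + \<mu> + 1"
  have "s \<le> min (\<eta> / 4) (r / 4)" unfolding s_def by (rule min.cobounded1)
  then have s: "0 < s" "s \<le> \<eta> / 4" "s \<le> r / 4" using \<eta> r l by (auto simp: s_def)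
  have ls: "l * s \<le> \<eta> / 8"
  proof -
    have "s \<le> \<eta> / (8 * (l + 1))" by (simp add: s_def)
    then have "s * (8 * (l + 1)) \<le> \<eta>" using l by (subst (asm) pos_le_divide_eq) auto
    then show ?thesis using s(1) by (simp add: algebra_simps)
  qed
  have \<mu>: "0 < \<mu>" "\<mu> \<le> \<eta>" using \<eta> s M0 by (auto simp: \<mu>_def)
  have \<mu>M: "\<mu> / s * M \<le> \<eta> / 4"
  proof -
    have "\<mu> \<le> \<eta> * s / (4 * (M + 1))" by (simp add: \<mu>_def)
    then have "\<mu> * (4 * (M + 1)) \<le> \<eta> * s" using M0 by (subst (asm) pos_le_divide_eq) auto
    then have "\<mu> * M * 4 \<le> \<eta> * s" using \<mu>(1) by (simp add: algebra_simps)
    then show ?thesis using s(1) by (simp add: field_simps)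
  qed
  have s2: "0 < s2" "s2 \<le> s" using s \<mu> l by (auto simp: s2_def)
  have ls2: "l * s2 \<le> \<mu> / 8"
  proof -
    have "s2 \<le> \<mu> / (8 * (l + 1))" by (simp add: s2_def)
    then have "s2 * (8 * (l + 1)) \<le> \<mu>" using l by (subst (asm) pos_le_divide_eq) auto
    then show ?thesis using s2(1) by (simp add: algebra_simps)
  qed
  have \<epsilon>: "0 < \<epsilon>" "\<epsilon> \<le> \<mu> / 8" "\<epsilon> \<le> \<eta> / 8" using \<mu> \<eta> by (auto simp: \<epsilon>_def)
  have \<kappa>: "0 < \<kappa>" using l r \<mu> by (simp add: \<kappa>_def add_nonneg_pos)
  define C where "C = cball x0 r"
  define S where "S = C \<times> C \<times> C"
  define R where "R = (\<lambda>(p :: 'x \<times> 'x \<times> 'x). F2 (fst (snd p)) + F3 (snd (snd p))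
      + \<kappa> * Q (inverse s2 *\<^sub>R (fst p - fst (snd p))) + \<kappa> * Q (inverse s2 *\<^sub>R (fst p - snd (snd p)))
      + \<mu> * Q (inverse s *\<^sub>R (fst p - x0)))"
  define \<Phi> where "\<Phi> = (\<lambda>p. F1 (fst p) + R p)"
  have x0C: "x0 \<in> C" using r by (simp add: C_def)
  have cS: "closed S" unfolding S_def C_def by (intro closed_Times closed_cball)
  have F2c: "continuous_on C F2" and F3c: "continuous_on C F3"
    unfolding C_def using Lipschitz_imp_continuous_on[OF lip2 l] Lipschitz_imp_continuous_on[OF lip3 l]
    by blast+
  have Rc: "continuous_on S R" unfolding R_def S_def
    by (intro continuous_intros continuous_on_compose2[OF Qc] continuous_on_compose2[OF F2c]
        continuous_on_compose2[OF F3c]) auto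
  have F1c: "closed {p \<in> S. F1 (fst p) \<le> a}" for a
  proof -
    have "{p \<in> S. F1 (fst p) \<le> a} = {x \<in> C. F1 x \<le> a} \<times> C \<times> C" by (auto simp: S_def)
    then show ?thesis using lsc[of a] by (simp add: C_def closed_Times)
  qed
  have \<Phi>c: "closed {p \<in> S. \<Phi> p \<le> a}" for a
    unfolding \<Phi>_def by (rule closed_sublevel_add[OF cS F1c Rc])
  have F23: "F2 x0 - l * r \<le> F2 x" "F3 x0 - l * r \<le> F3 x" if "x \<in> C" for x
  proof -
    have "l * norm (x - x0) \<le> l * r"
      using that l by (intro mult_left_mono) (auto simp: C_def dist_norm norm_minus_commute)
    then show "F2 x0 - l * r \<le> F2 x" "F3 x0 - l * r \<le> F3 x"
      using lip2[of x x0] lip3[of x x0] that x0C unfolding C_def by linarith+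
  qed
  have \<Phi>b: "m + F2 x0 + F3 x0 - 2 * (l * r) \<le> \<Phi> p" if "p \<in> S" for p
  proof -
    have "fst p \<in> C" "fst (snd p) \<in> C" "snd (snd p) \<in> C" using that by (auto simp: S_def)
    then have "m \<le> F1 (fst p)" "F2 x0 - l * r \<le> F2 (fst (snd p))" "F3 x0 - l * r \<le> F3 (snd (snd p))"
      using bdd F23 by (auto simp: C_def)
    moreover have "0 \<le> \<kappa> * Q a" "0 \<le> \<mu> * Q a" for a using \<kappa> \<mu> Qp by simp_all
    ultimately show ?thesis unfolding \<Phi>_def R_def
      by (smt (verit, best))
  qed
  have SC: "S \<noteq> {}" using x0C by (auto simp: S_def)
  obtain \<psi> x y z \<psi>1 \<psi>2 \<psi>3 where xyz: "(x, y, z) \<in> S"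
    and mn: "\<And>p. p \<in> S \<Longrightarrow> \<Phi> (x, y, z) - \<psi> (x, y, z) \<le> \<Phi> p - \<psi> p"
    and \<psi>: "\<And>p. \<bar>\<psi> p\<bar> \<le> \<epsilon>"
    and \<psi>1: "c1_deriv UNIV (\<lambda>t. \<psi> (t, y, z)) \<psi>1" "\<And>t. norm (\<psi>1 t) \<le> \<epsilon>"
    and \<psi>2: "c1_deriv UNIV (\<lambda>t. \<psi> (x, t, z)) \<psi>2" "\<And>t. norm (\<psi>2 t) \<le> \<epsilon>"
    and \<psi>3: "c1_deriv UNIV (\<lambda>t. \<psi> (x, y, t)) \<psi>3" "\<And>t. norm (\<psi>3 t) \<le> \<epsilon>"
    by (rule smooth_variational_principle_triple[OF b cS SC \<Phi>c \<Phi>b \<epsilon>(1)]) (assumption | (rule that; assumption))+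
  have C: "x \<in> C" "y \<in> C" "z \<in> C" using xyz by (auto simp: S_def)
  have val: "\<Phi> (x, y, z) \<le> F1 x0 + F2 x0 + F3 x0 + \<mu> / 4"
    using mn[of "(x0, x0, x0)"] x0C \<psi>[of "(x, y, z)"] \<psi>[of "(x0, x0, x0)"] \<epsilon>
    by (simp add: S_def \<Phi>_def R_def Q0)
  have exp: "\<Phi> (x, y, z) = F1 x + F2 y + F3 z + \<kappa> * Q (inverse s2 *\<^sub>R (x - y))
      + \<kappa> * Q (inverse s2 *\<^sub>R (x - z)) + \<mu> * Q (inverse s *\<^sub>R (x - x0))" by (simp add: \<Phi>_def R_def)
  have pos: "0 \<le> \<kappa> * Q a" "0 \<le> \<mu> * Q a" for a using \<kappa> \<mu> Qp by simp_all
  have Qlt: "norm v < e" if "0 < e" "0 < k" "k * Q (inverse e *\<^sub>R v) < k" for e k v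
  proof (rule ccontr)
    assume "\<not> ?thesis"
    then have "1 \<le> norm (inverse e *\<^sub>R v)" using that(1) by (simp add: field_simps)
    from Q1[OF this] that show False by simp
  qed
  \<comment> \<open>All penalties together stay below \<kappa>, so neither of those with weight
    \<kappa> reaches its full height: both differences have norm less than
    \<open>s2\<close>.\<close>
  have "\<Phi> (x, y, z) - F1 x - F2 y - F3 z < \<kappa>"
    using val F23(1)[OF C(2)] F23(2)[OF C(3)] bdd[of x] C(1) \<mu>(1) unfolding \<kappa>_def C_def by linarith
  then have "\<kappa> * Q (inverse s2 *\<^sub>R (x - y)) < \<kappa>" "\<kappa> * Q (inverse s2 *\<^sub>R (x - z)) < \<kappa>"
    using pos(1)[of "inverse s2 *\<^sub>R (x - y)"] pos(1)[of "inverse s2 *\<^sub>R (x - z)"]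
      pos(2)[of "inverse s *\<^sub>R (x - x0)"] unfolding exp by linarith+
  then have xy: "norm (x - y) < s2" and xz: "norm (x - z) < s2"
    by (auto intro: Qlt[OF s2(1) \<kappa>])
  have lxy: "F2 x - F2 y \<le> \<mu> / 8" "F3 x - F3 z \<le> \<mu> / 8"
    using lip2[of x y] lip3[of x z] C xy xz l mult_left_mono[of "norm (x - y)" s2 l]
      mult_left_mono[of "norm (x - z)" s2 l] ls2 unfolding C_def by linarith+
  have "\<mu> * Q (inverse s *\<^sub>R (x - x0)) < \<mu>"
    using val min[of x] C(1) lxy \<mu>(1) pos(1)[of "inverse s2 *\<^sub>R (x - y)"]
      pos(1)[of "inverse s2 *\<^sub>R (x - z)"] unfolding exp C_def by linarith
  then have xx0: "norm (x - x0) < s" by (rule Qlt[OF s(1) \<mu>(1)])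
  have yx0: "norm (y - x0) < 2 * s" "norm (z - x0) < 2 * s"
    using xy xz xx0 s2(2) norm_triangle_ineq[of "y - x" "x - x0"] norm_triangle_ineq[of "z - x" "x - x0"]
      norm_minus_commute[of y x] norm_minus_commute[of z x] by auto
  define h1 where "h1 = (\<lambda>t. \<psi> (t, y, z) - \<kappa> * Q (inverse s2 *\<^sub>R (t - y))
      - \<kappa> * Q (inverse s2 *\<^sub>R (t - z)) - \<mu> * Q (inverse s *\<^sub>R (t - x0)))"
  \<comment> \<open>The negative factor presents \<open>inverse s2 *\<^sub>R (x - t)\<close> as a
    scaled shift of \<open>t\<close>, and its sign is what makes the derivative cancel against that
    of \<open>h1\<close>.\<close>
  define h2 where "h2 = (\<lambda>t. \<psi> (x, t, z) - \<kappa> * Q ((- inverse s2) *\<^sub>R (t - x)))"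
  define h3 where "h3 = (\<lambda>t. \<psi> (x, y, t) - \<kappa> * Q ((- inverse s2) *\<^sub>R (t - x)))"
  define h1' where "h1' = (\<lambda>t. \<psi>1 t - \<kappa> *\<^sub>R inverse s2 *\<^sub>R Q' (inverse s2 *\<^sub>R (t - y))
      - \<kappa> *\<^sub>R inverse s2 *\<^sub>R Q' (inverse s2 *\<^sub>R (t - z)) - \<mu> *\<^sub>R inverse s *\<^sub>R Q' (inverse s *\<^sub>R (t - x0)))"
  define h2' where "h2' = (\<lambda>t. \<psi>2 t - \<kappa> *\<^sub>R (- inverse s2) *\<^sub>R Q' ((- inverse s2) *\<^sub>R (t - x)))"
  define h3' where "h3' = (\<lambda>t. \<psi>3 t - \<kappa> *\<^sub>R (- inverse s2) *\<^sub>R Q' ((- inverse s2) *\<^sub>R (t - x)))"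
  have h: "c1_deriv UNIV h1 h1'" "c1_deriv UNIV h2 h2'" "c1_deriv UNIV h3 h3'"
    unfolding h1_def h1'_def h2_def h2'_def h3_def h3'_def
    by (intro c1_deriv_diff c1_deriv_cmult c1_deriv_scale_shift Q \<psi>1 \<psi>2 \<psi>3)+
  have flip: "(- inverse s2) *\<^sub>R (t - x) = inverse s2 *\<^sub>R (x - t)" for t
    by (simp add: algebra_simps)
  have h23: "h2 t = \<psi> (x, t, z) - \<kappa> * Q (inverse s2 *\<^sub>R (x - t))"
      "h3 t = \<psi> (x, y, t) - \<kappa> * Q (inverse s2 *\<^sub>R (x - t))" for t
    unfolding h2_def h3_def flip by (rule refl)+
  have nb: "\<forall>\<^sub>F t in nhds a. t \<in> C" if "norm (a - x0) < r" for a
    using that eventually_nhds_in_open[of "ball x0 r" a]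
    by (auto simp: C_def dist_norm norm_minus_commute elim!: eventually_mono)
  have lt: "norm (x - x0) < r" "norm (y - x0) < r" "norm (z - x0) < r" using xx0 yx0 s by auto
  have m1: "\<forall>\<^sub>F t in nhds x. F1 x - h1 x \<le> F1 t - h1 t" using nb[OF lt(1)]
  proof eventually_elim
    case (elim t)
    then show ?case using mn[of "(t, y, z)"] C by (simp add: S_def \<Phi>_def R_def h1_def)
  qed
  have m2: "\<forall>\<^sub>F t in nhds y. F2 y - h2 y \<le> F2 t - h2 t" using nb[OF lt(2)]
  proof eventually_elim
    case (elim t)
    then show ?case using mn[of "(x, t, z)"] C by (simp add: S_def \<Phi>_def R_def h23)
  qed
  have m3: "\<forall>\<^sub>F t in nhds z. F3 z - h3 z \<le> F3 t - h3 t" using nb[OF lt(3)]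
  proof eventually_elim
    case (elim t)
    then show ?case using mn[of "(x, y, t)"] C by (simp add: S_def \<Phi>_def R_def h23)
  qed
  have "\<bar>h1' x v + h2' y v + h3' z v\<bar> \<le> \<eta> * norm v" for v
  proof -
    have e: "h1' x + h2' y + h3' z = \<psi>1 x + \<psi>2 y + \<psi>3 z - \<mu> *\<^sub>R inverse s *\<^sub>R Q' (inverse s *\<^sub>R (x - x0))"
      unfolding h1'_def h2'_def h3'_def flip by simp
    have "norm (h1' x + h2' y + h3' z) \<le> norm (\<psi>1 x) + norm (\<psi>2 y) + norm (\<psi>3 z)
        + norm (\<mu> *\<^sub>R inverse s *\<^sub>R Q' (inverse s *\<^sub>R (x - x0)))"
      unfolding e using norm_triangle_ineq4[of "\<psi>1 x + \<psi>2 y + \<psi>3 z" "\<mu> *\<^sub>R inverse s *\<^sub>R Q' (inverse s *\<^sub>R (x - x0))"]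
        norm_triangle_ineq[of "\<psi>1 x + \<psi>2 y" "\<psi>3 z"] norm_triangle_ineq[of "\<psi>1 x" "\<psi>2 y"] by linarith
    also have "norm (\<mu> *\<^sub>R inverse s *\<^sub>R Q' (inverse s *\<^sub>R (x - x0))) \<le> \<mu> / s * M"
      using Q'M[of "inverse s *\<^sub>R (x - x0)"] \<mu>(1) s(1) by (simp add: divide_inverse mult_left_mono)
    finally have "norm (h1' x + h2' y + h3' z) \<le> \<eta>"
      using \<psi>1(2)[of x] \<psi>2(2)[of y] \<psi>3(2)[of z] \<mu>M \<epsilon>(3) \<eta> by linarith
    then have "norm ((h1' x + h2' y + h3' z) v) \<le> \<eta> * norm v"
      by (intro order_trans[OF norm_blinfun] mult_right_mono) auto
    then show ?thesis by (simp add: blinfun.add_left)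
  qed
  moreover have "F1 x \<le> F1 x0 + \<eta>"
  proof -
    have "l * norm (y - x0) \<le> l * (2 * s)" "l * norm (z - x0) \<le> l * (2 * s)"
      using yx0 l by (intro mult_left_mono; simp)+
    then have "F2 x0 - F2 y \<le> \<eta> / 4" "F3 x0 - F3 z \<le> \<eta> / 4"
      using lip2[of y x0] lip3[of z x0] C x0C ls unfolding C_def by (auto simp: abs_le_iff)
    then show ?thesis
      using val pos(1)[of "inverse s2 *\<^sub>R (x - y)"] pos(1)[of "inverse s2 *\<^sub>R (x - z)"]
        pos(2)[of "inverse s *\<^sub>R (x - x0)"] \<mu> unfolding exp by linarith
  qed
  ultimately show ?thesis
    using that[OF c1_derivI_on[OF h(1)] c1_derivI_on[OF h(2)] c1_derivI_on[OF h(3)]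
        c1_deriv_has[OF h(1) UNIV_I] c1_deriv_has[OF h(2) UNIV_I] c1_deriv_has[OF h(3) UNIV_I] m1 m2 m3]
      lt xx0 yx0 s by (simp add: dist_norm)
qed

section \<open>Charts and tangent vectors\<close>

text \<open>Refine the cover by \<open>U\<close> and all open sets whose closure misses
  \<open>x\<close>. The members of the refinement not inside \<open>U\<close> have closures missing
  \<open>x\<close>, and local finiteness makes the closure of their union the union of these
  closures. Its complement is the required neighbourhood.\<close>

lemma paracompact_type_regular:
  fixes x :: "'m::t2_space"
  assumes "paracompact_type TYPE('m)" "open U" "x \<in> U"
  obtains W where "open W" "x \<in> W" "closure W \<subseteq> U"
proof -
  define \<U> where "\<U> = insert U {V. open V \<and> x \<notin> closure V}"
  have "\<exists>V. open V \<and> y \<in> V \<and> x \<notin> closure V" if "y \<noteq> x" for y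
  proof -
    from hausdorff[OF that] obtain V V' where "open V" "open V'" "y \<in> V" "x \<in> V'" "V \<inter> V' = {}" by blast
    then have "V' \<inter> closure V = {}" by (subst open_Int_closure_eq_empty) auto
    then have "x \<notin> closure V" using \<open>x \<in> V'\<close> by auto
    then show ?thesis using \<open>open V\<close> \<open>y \<in> V\<close> by auto
  qed
  then have "y \<in> \<Union>\<U>" for y
    using assms(3) unfolding \<U>_def by (cases "y = x") auto
  then have "(\<forall>V\<in>\<U>. open V) \<and> \<Union>\<U> = UNIV" using assms(2) unfolding \<U>_def by auto
  from assms(1)[unfolded paracompact_type_def, THEN spec, THEN mp, OF this]
  obtain \<V> where \<V>: "\<forall>V\<in>\<V>. open V" "\<Union>\<V> = UNIV" "\<forall>V\<in>\<V>. \<exists>U\<in>\<U>. V \<subseteq> U"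
    "locally_finite_in euclidean \<V>"
    by (elim exE conjE) (rule that)
  define \<W> where "\<W> = {V \<in> \<V>. \<not> V \<subseteq> U}"
  have lf: "locally_finite_in euclidean \<W>"
    using locally_finite_in_subset[OF \<V>(4)] by (auto simp: \<W>_def)
  have cl: "closure (\<Union>\<W>) = (\<Union>V\<in>\<W>. closure V)"
    using closure_of_locally_finite_Union[OF lf] by simp
  have "x \<notin> closure V" if "V \<in> \<W>" for V
  proof -
    have "V \<in> \<V>" using that by (simp add: \<W>_def)
    with \<V>(3) obtain O' where "O' \<in> \<U>" "V \<subseteq> O'" by blast
    then have "x \<notin> closure O'" using that unfolding \<W>_def \<U>_def by blast
    then show ?thesis using closure_mono[OF \<open>V \<subseteq> O'\<close>] by blast
  qed
  then have x: "x \<in> - closure (\<Union>\<W>)" unfolding cl by simp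
  have "- closure (\<Union>\<W>) \<subseteq> - \<Union>\<W>" by (intro Compl_anti_mono closure_subset)
  moreover have "closed (- \<Union>\<W>)" using \<V>(1) by (auto simp: \<W>_def closed_def)
  ultimately have "closure (- closure (\<Union>\<W>)) \<subseteq> - \<Union>\<W>" by (rule closure_minimal)
  also have "- \<Union>\<W> \<subseteq> U" using \<V>(2) by (auto simp: \<W>_def)
  finally show ?thesis using that[of "- closure (\<Union>\<W>)"] x by auto
qed

locale c1_manifold =
  fixes A :: "('m::t2_space, 'x::banach) chart set"
  assumes atlas: "c1_atlas A"
begin

lemma chart:
  assumes "c \<in> A"
  shows "open (fst c)" "open (snd c ` fst c)" "continuous_on (fst c) (snd c)"
    "continuous_on (snd c ` fst c) (chart_inv c)" "\<And>p. p \<in> fst c \<Longrightarrow> chart_inv c (snd c p) = p"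
    "\<And>x. x \<in> snd c ` fst c \<Longrightarrow> snd c (chart_inv c x) = x"
    "\<And>x. x \<in> snd c ` fst c \<Longrightarrow> chart_inv c x \<in> fst c"
proof -
  have "is_chart c" using atlas assms unfolding c1_atlas_def by blast
  then have *: "open (fst c)" "open (snd c ` fst c)"
    "homeomorphism (fst c) (snd c ` fst c) (snd c) (chart_inv c)" by (auto simp: is_chart_def)
  then show "open (fst c)" "open (snd c ` fst c)" by auto
  show "continuous_on (fst c) (snd c)" "continuous_on (snd c ` fst c) (chart_inv c)"
    "\<And>p. p \<in> fst c \<Longrightarrow> chart_inv c (snd c p) = p"
    "\<And>x. x \<in> snd c ` fst c \<Longrightarrow> snd c (chart_inv c x) = x"
    "\<And>x. x \<in> snd c ` fst c \<Longrightarrow> chart_inv c x \<in> fst c"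
    using *(3) by (auto simp: homeomorphism_def)
qed

lemma open_chart_image:
  assumes "c \<in> A" "open W"
  shows "open (snd c ` (fst c \<inter> W))"
proof -
  have "snd c ` (fst c \<inter> W) = snd c ` fst c \<inter> chart_inv c -` W"
  proof (intro set_eqI iffI)
    fix x assume "x \<in> snd c ` fst c \<inter> chart_inv c -` W"
    then have "chart_inv c x \<in> fst c \<inter> W" "x = snd c (chart_inv c x)"
      using chart(6,7)[OF assms(1)] by auto
    then show "x \<in> snd c ` (fst c \<inter> W)" by blast
  qed (use chart(5)[OF assms(1)] in auto)
  moreover have "open (snd c ` fst c \<inter> chart_inv c -` W)"
    by (rule continuous_open_preimage[OF chart(4)[OF assms(1)] chart(2)[OF assms(1)] assms(2)])
  ultimately show ?thesis by argo
qed

lemma open_chart_preimage: "c \<in> A \<Longrightarrow> open W \<Longrightarrow> open (fst c \<inter> snd c -` W)"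
  using continuous_open_preimage[OF chart(3) chart(1)] .

lemma chart_at: "chart_at A p \<in> A" "p \<in> fst (chart_at A p)"
proof -
  have "p \<in> (\<Union>c\<in>A. fst c)" using atlas unfolding c1_atlas_def by (metis UNIV_I)
  then have "\<exists>c. c \<in> A \<and> p \<in> fst c" by blast
  from someI_ex[OF this] show "chart_at A p \<in> A" "p \<in> fst (chart_at A p)"
    by (auto simp: chart_at_def)
qed

lemma c1_on_transition:
  assumes "c \<in> A" "c' \<in> A"
  shows "c1_on (snd c ` (fst c \<inter> fst c')) (snd c' \<circ> chart_inv c)"
  using atlas assms unfolding c1_atlas_def compatible_charts_def by blast

abbreviation transition :: "('m, 'x) chart \<Rightarrow> ('m, 'x) chart \<Rightarrow> 'm \<Rightarrow> 'x \<Rightarrow> 'x" where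
  "transition c c' p \<equiv> frechet_derivative (snd c' \<circ> chart_inv c) (at (snd c p))"

lemma has_derivative_transition:
  assumes "c \<in> A" "c' \<in> A" "p \<in> fst c" "p \<in> fst c'"
  shows "((snd c' \<circ> chart_inv c) has_derivative transition c c' p) (at (snd c p))"
  using c1_on_differentiable[OF c1_on_transition[OF assms(1,2)]] assms by auto

lemma has_derivative_change_chart:
  assumes "c \<in> A" "c' \<in> A" "p \<in> fst c" "p \<in> fst c'"
    and f: "((f \<circ> chart_inv c') has_derivative D) (at (snd c' p))"
  shows "((f \<circ> chart_inv c) has_derivative (\<lambda>v. D (transition c c' p v))) (at (snd c p))"
proof -
  have "(snd c' \<circ> chart_inv c) (snd c p) = snd c' p" using chart(5)[OF assms(1,3)] by simp
  then have "((\<lambda>x. (f \<circ> chart_inv c') ((snd c' \<circ> chart_inv c) x)) has_derivative (\<lambda>v. D (transition c c' p v)))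
      (at (snd c p))"
    using has_derivative_compose[OF has_derivative_transition[OF assms(1-4)], of "f \<circ> chart_inv c'" D] f by simp
  then show ?thesis
  proof (rule has_derivative_transform_within_open)
    show "open (snd c ` (fst c \<inter> fst c'))" using open_chart_image assms(1,2) chart(1) by blast
    show "snd c p \<in> snd c ` (fst c \<inter> fst c')" using assms by blast
    fix x assume "x \<in> snd c ` (fst c \<inter> fst c')"
    then show "(f \<circ> chart_inv c') ((snd c' \<circ> chart_inv c) x) = (f \<circ> chart_inv c) x"
      using chart(5)[OF assms(1)] chart(5)[OF assms(2)] by auto
  qed
qed

lemma transition_trans:
  assumes "c \<in> A" "c' \<in> A" "c'' \<in> A" "p \<in> fst c" "p \<in> fst c'" "p \<in> fst c''"
  shows "transition c c'' p v = transition c' c'' p (transition c c' p v)"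
  using has_derivative_unique[OF has_derivative_transition[OF assms(1,3,4,6)]
      has_derivative_change_chart[OF assms(1,2,4,5) has_derivative_transition[OF assms(2,3,5,6)]]]
  by (rule fun_cong)

lemma transition_self:
  assumes "c \<in> A" "p \<in> fst c"
  shows "transition c c p v = v"
proof -
  have "((\<lambda>x. x) has_derivative (\<lambda>v. v)) (at (snd c p))" by simp
  then have "((snd c \<circ> chart_inv c) has_derivative (\<lambda>v. v)) (at (snd c p))"
    by (rule has_derivative_transform_within_open[OF _ chart(2)[OF assms(1)]])
      (use assms chart(6)[OF assms(1)] in auto)
  from has_derivative_unique[OF has_derivative_transition[OF assms(1,1,2,2)] this]
  show ?thesis by simp
qed

lemma linear_transition:
  assumes "c \<in> A" "c' \<in> A" "p \<in> fst c" "p \<in> fst c'"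
  shows "linear (transition c c' p)"
  using has_derivative_linear[OF has_derivative_transition[OF assms]] .

lemma tangent_change_chart:
  assumes "c \<in> A" "c' \<in> A" "p \<in> fst c" "p \<in> fst c'"
  shows "tangent A c p v = tangent A c' p (transition c c' p v)"
  unfolding tangent_def using transition_trans[OF assms(1,2) _ assms(3,4)] by auto

lemma tcoord_tangent:
  assumes "c \<in> A" "c' \<in> A" "p \<in> fst c" "p \<in> fst c'"
  shows "tcoord c' (tangent A c p v) = transition c c' p v"
  unfolding tcoord_def tangent_def using assms by auto

lemma tangent_in_tangent_space: "c \<in> A \<Longrightarrow> p \<in> fst c \<Longrightarrow> tangent A c p v \<in> tangent_space A p"
  unfolding tangent_space_def by blast

lemma tangent_space_eq:
  assumes "c \<in> A" "p \<in> fst c"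
  shows "tangent_space A p = range (tangent A c p)"
proof -
  have "tangent A c' p v \<in> range (tangent A c p)" if "c' \<in> A" "p \<in> fst c'" for c' v
    using tangent_change_chart[OF that(1) assms(1) that(2) assms(2)] by auto
  then show ?thesis using tangent_in_tangent_space[OF assms] unfolding tangent_space_def by blast
qed

text \<open>The chart chosen in \<open>mdiff\<close> drops out: the transitions from
  \<open>c\<close> to it and back compose to the identity.\<close>

lemma mdiff_tangent:
  assumes "c \<in> A" "p \<in> fst c" "((g \<circ> chart_inv c) has_derivative D) (at (snd c p))"
  shows "mdiff A g p (tangent A c p v) = D v"
proof -
  let ?c = "chart_at A p"
  have "((g \<circ> chart_inv ?c) has_derivative (\<lambda>v. D (transition ?c c p v))) (at (snd ?c p))"
    by (rule has_derivative_change_chart[OF chart_at(1) assms(1) chart_at(2) assms(2,3)])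
  then have "frechet_derivative (g \<circ> chart_inv ?c) (at (snd ?c p)) = (\<lambda>v. D (transition ?c c p v))"
    using frechet_derivative_at by metis
  then show ?thesis
    using transition_trans[OF assms(1) chart_at(1) assms(1,2) chart_at(2) assms(2), of v]
    by (simp add: mdiff_def tangent_space_eq[OF assms(1,2)] tcoord_tangent[OF assms(1) chart_at(1) assms(2) chart_at(2)]
        transition_self[OF assms(1,2)])
qed

end

section \<open>Tangent norms and dual norms in a chart\<close>

locale finsler_manifold = c1_manifold A for A :: "('m::t2_space, 'x::banach) chart set" +
  fixes N :: "('m, 'x) tvec \<Rightarrow> real"
  assumes finsler: "c1_finsler_manifold A N"
begin

abbreviation nrm :: "('m, 'x) chart \<Rightarrow> 'm \<Rightarrow> 'x \<Rightarrow> real" where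
  "nrm c p v \<equiv> N (tangent A c p v)"

text \<open>The operations on a tangent space are defined in one chosen chart; linearity of the
  transition map carries the norm axioms to an arbitrary chart.\<close>

lemma nrm:
  assumes "c \<in> A" "p \<in> fst c"
  shows nrm_nonneg: "0 \<le> nrm c p v" and nrm_scaleR: "nrm c p (r *\<^sub>R v) = \<bar>r\<bar> * nrm c p v"
    and nrm_triangle: "nrm c p (v + w) \<le> nrm c p v + nrm c p w"
proof -
  let ?c = "chart_at A p"
  have tn: "tangent_norm A N p" using finsler by (auto simp: c1_finsler_manifold_def finsler_P1_def)
  have ts: "tangent A c p v \<in> tangent_space A p" for v using tangent_space_eq[OF assms] by auto
  note ca = assms(1) chart_at(1) assms(2) chart_at(2)
  note lin = linear_transition[OF ca]
  show "0 \<le> nrm c p v" using tn ts by (auto simp: tangent_norm_def)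
  have "tangent_scale A p r (tangent A c p v) = tangent A c p (r *\<^sub>R v)"
    by (simp only: tangent_scale_def tcoord_tangent[OF ca] tangent_change_chart[OF ca, of "r *\<^sub>R v"]
        linear_cmul[OF lin])
  then show "nrm c p (r *\<^sub>R v) = \<bar>r\<bar> * nrm c p v"
    using tn ts[of v] unfolding tangent_norm_def by metis
  have "tangent_add A p (tangent A c p v) (tangent A c p w) = tangent A c p (v + w)"
    by (simp only: tangent_add_def tcoord_tangent[OF ca] tangent_change_chart[OF ca, of "v + w"]
        linear_add[OF lin])
  then show "nrm c p (v + w) \<le> nrm c p v + nrm c p w"
    using tn ts[of v] ts[of w] unfolding tangent_norm_def by metis
qed

lemma nrm_equivalent:
  assumes "c \<in> A" "p \<in> fst c"
  obtains a b where "0 < a" "0 < b" "\<And>v. a * norm v \<le> nrm c p v" "\<And>v. nrm c p v \<le> b * norm v"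
proof -
  have "\<exists>a>0. \<exists>b>0. \<forall>v. a * norm v \<le> nrm c p v \<and> nrm c p v \<le> b * norm v"
    using finsler assms unfolding c1_finsler_manifold_def finsler_P1_def by blast
  then show ?thesis using that by blast
qed

lemma nrm_near:
  assumes "c \<in> A" "p0 \<in> fst c" "0 < e"
  obtains W where "open W" "p0 \<in> W" "W \<subseteq> fst c"
    "\<And>p v. p \<in> W \<Longrightarrow> nrm c p0 v \<le> (1 + e) * nrm c p v" "\<And>p v. p \<in> W \<Longrightarrow> nrm c p v \<le> (1 + e) * nrm c p0 v"
proof -
  have "\<exists>W. open W \<and> p0 \<in> W \<and> W \<subseteq> fst c \<and> (\<forall>p\<in>W. \<forall>v. 1 / (1 + e) * nrm c p0 v \<le> nrm c p v \<and>
                        nrm c p v \<le> (1 + e) * nrm c p0 v)"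
    using finsler assms unfolding c1_finsler_manifold_def finsler_P2_def by blast
  then obtain W where W: "open W" "p0 \<in> W" "W \<subseteq> fst c"
    "\<And>p v. p \<in> W \<Longrightarrow> 1 / (1 + e) * nrm c p0 v \<le> nrm c p v \<and> nrm c p v \<le> (1 + e) * nrm c p0 v" by blast
  have "nrm c p0 v \<le> (1 + e) * nrm c p v" if "p \<in> W" for p v
    using W(4)[OF that, of v] assms(3) by (simp add: field_simps)
  with W show ?thesis by (intro that[of W]) auto
qed

text \<open>Openness in the tangent topology is tested on the parametrisations, so continuity of
  \<open>N\<close> passes to each of them. The bundle is shown to be open in order to know that its
  vectors lie in the topspace. The continuity makes the speed of a C1 curve integrable.\<close>

lemma continuous_on_nrm:
  assumes "c \<in> A"
  shows "continuous_on (fst c \<times> UNIV) (\<lambda>(p, v). nrm c p v)"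
proof -
  have cm: "continuous_map (tangent_topology A) euclideanreal N"
    using finsler by (auto simp: c1_finsler_manifold_def continuous_map_in_subtopology)
  have in_bundle: "tangent A c p v \<in> tangent_bundle A" if "p \<in> fst c" for p v
    using tangent_in_tangent_space[OF assms that] by (auto simp: tangent_bundle_def)
  have "openin (tangent_topology A) (tangent_bundle A)"
    unfolding openin_tangent_topology tangent_open_def
  proof (intro conjI ballI order_refl)
    fix c' assume "c' \<in> A"
    have "{(p, v). p \<in> fst c' \<and> tangent A c' p v \<in> tangent_bundle A} = fst c' \<times> UNIV"
      using tangent_in_tangent_space[OF \<open>c' \<in> A\<close>] unfolding tangent_bundle_def by blast
    then show "openin (top_of_set (fst c' \<times> UNIV)) {(p, v). p \<in> fst c' \<and> tangent A c' p v \<in> tangent_bundle A}"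
      by simp
  qed
  then have ts: "tangent_bundle A \<subseteq> topspace (tangent_topology A)" by (rule openin_subset)
  show ?thesis unfolding continuous_on_open_invariant
  proof (intro allI impI)
    fix B :: "real set" assume "open B"
    then have "openin (tangent_topology A) {\<xi> \<in> topspace (tangent_topology A). N \<xi> \<in> B}"
      using cm by (simp add: continuous_map_def)
    then have "openin (top_of_set (fst c \<times> UNIV)) {(p, v). p \<in> fst c \<and>
        tangent A c p v \<in> {\<xi> \<in> topspace (tangent_topology A). N \<xi> \<in> B}}"
      using assms unfolding openin_tangent_topology tangent_open_def by blast
    then obtain T where "open T" and T: "{(p, v). p \<in> fst c \<and>
        tangent A c p v \<in> {\<xi> \<in> topspace (tangent_topology A). N \<xi> \<in> B}} = (fst c \<times> UNIV) \<inter> T"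
      by (auto simp: openin_open)
    have "(p, v) \<in> T \<longleftrightarrow> nrm c p v \<in> B" if "p \<in> fst c" for p v
      using arg_cong[OF T, of "\<lambda>S. (p, v) \<in> S"] in_bundle[OF that, of v] ts that by auto
    then have "T \<inter> fst c \<times> UNIV = (\<lambda>(p, v). nrm c p v) -` B \<inter> fst c \<times> UNIV" by auto
    then show "\<exists>T. open T \<and> T \<inter> fst c \<times> UNIV = (\<lambda>(p, v). nrm c p v) -` B \<inter> fst c \<times> UNIV"
      using \<open>open T\<close> by blast
  qed
qed

lemma cotangent_norm_le:
  assumes "c \<in> A" "p \<in> fst c" "((g \<circ> chart_inv c) has_derivative D) (at (snd c p))"
    and "0 \<le> k" "\<And>v. \<bar>D v\<bar> \<le> k * nrm c p v"
  shows "cotangent_norm A N p (mdiff A g p) \<le> k"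
  unfolding cotangent_norm_def
proof (rule cSup_least)
  fix t assume "t \<in> insert 0 {\<bar>mdiff A g p \<xi>\<bar> |\<xi>. \<xi> \<in> tangent_space A p \<and> N \<xi> = 1}"
  then show "t \<le> k"
    using assms(4,5) mdiff_tangent[OF assms(1-3)] unfolding tangent_space_eq[OF assms(1,2)]
    by (auto) (metis mult.right_neutral)
qed simp

text \<open>By (P1) a bound for \<open>D\<close> in the model norm becomes one in the tangent norm
  at \<open>p\<close>, so the supremum is taken over a bounded set. Vectors of nonzero norm are
  scaled to unit vectors, while on vectors of norm 0 the same bound gives
  \<open>D v = 0\<close>.\<close>

lemma le_cotangent_norm:
  assumes "c \<in> A" "p \<in> fst c" "((g \<circ> chart_inv c) has_derivative D) (at (snd c p))"
  shows "\<bar>D v\<bar> \<le> cotangent_norm A N p (mdiff A g p) * nrm c p v" "0 \<le> cotangent_norm A N p (mdiff A g p)"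
proof -
  let ?S = "insert 0 {\<bar>mdiff A g p \<xi>\<bar> |\<xi>. \<xi> \<in> tangent_space A p \<and> N \<xi> = 1}"
  obtain a b where ab: "0 < a" "\<And>v. a * norm v \<le> nrm c p v" using nrm_equivalent[OF assms(1,2)] by metis
  obtain k where k: "\<And>v. \<bar>D v\<bar> \<le> norm v * k"
    using bounded_linear.bounded[OF has_derivative_bounded_linear[OF assms(3)]] by auto
  have k0: "0 \<le> \<bar>k\<bar> / a" using ab by simp
  have Dk: "\<bar>D v\<bar> \<le> (\<bar>k\<bar> / a) * nrm c p v" for v
  proof -
    have "\<bar>D v\<bar> \<le> norm v * \<bar>k\<bar>" using k[of v] by (meson abs_ge_self mult_left_mono norm_ge_zero order_trans)
    also have "\<dots> = (\<bar>k\<bar> / a) * (a * norm v)" using ab(1) by simp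
    also have "\<dots> \<le> (\<bar>k\<bar> / a) * nrm c p v" using ab(2) k0 by (intro mult_left_mono)
    finally show ?thesis .
  qed
  have bdd: "bdd_above ?S"
  proof (rule bdd_aboveI)
    fix t assume "t \<in> ?S"
    then show "t \<le> \<bar>k\<bar> / a" using Dk k0 mdiff_tangent[OF assms] unfolding tangent_space_eq[OF assms(1,2)]
      by (auto) (metis mult.right_neutral)
  qed
  show "0 \<le> cotangent_norm A N p (mdiff A g p)"
    unfolding cotangent_norm_def by (rule cSup_upper[OF _ bdd]) simp
  show "\<bar>D v\<bar> \<le> cotangent_norm A N p (mdiff A g p) * nrm c p v"
  proof (cases "nrm c p v = 0")
    case True
    then show ?thesis using Dk[of v] by simp
  next
    case False
    then have pos: "0 < nrm c p v" using nrm_nonneg[OF assms(1,2), of v] by simp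
    define w where "w = inverse (nrm c p v) *\<^sub>R v"
    have "nrm c p w = 1" using pos unfolding w_def nrm_scaleR[OF assms(1,2)] by simp
    then have "\<bar>D w\<bar> \<in> ?S" using mdiff_tangent[OF assms, of w]
      unfolding tangent_space_eq[OF assms(1,2)] by (metis (mono_tags, lifting) insertCI mem_Collect_eq rangeI)
    then have "\<bar>D w\<bar> \<le> cotangent_norm A N p (mdiff A g p)"
      unfolding cotangent_norm_def by (rule cSup_upper[OF _ bdd])
    moreover have "D w = D v / nrm c p v"
      using linear_cmul[OF has_derivative_linear[OF assms(3)]] by (simp add: w_def divide_inverse mult.commute)
    ultimately show ?thesis using pos by (simp add: abs_divide field_simps)
  qed
qed

text \<open>A closed ball of the chart image may have limit points in \<open>M\<close> outside the
  chart domain. Keeping its preimage inside a set \<open>V\<close> whose closure lies in the domain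
  excludes them. Extension by 0 and the argument on curves leaving a ball both depend on this
  closedness.\<close>

lemma closed_chart_cball:
  assumes "c \<in> A" "p \<in> fst c" "open W" "p \<in> W"
  obtains r where "0 < r" "cball (snd c p) r \<subseteq> snd c ` (fst c \<inter> W)"
    "\<And>s. s \<le> r \<Longrightarrow> closed {q \<in> fst c. snd c q \<in> cball (snd c p) s}"
proof -
  have par: "paracompact_type TYPE('m)" using finsler by (simp add: c1_finsler_manifold_def)
  obtain V where V: "open V" "p \<in> V" "closure V \<subseteq> fst c"
    using paracompact_type_regular[OF par chart(1)[OF assms(1)] assms(2)] by blast
  have "open (snd c ` (fst c \<inter> (V \<inter> W)))" using V(1) assms by (intro open_chart_image) auto
  moreover have "snd c p \<in> snd c ` (fst c \<inter> (V \<inter> W))" using V(2) assms by auto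
  ultimately obtain r where r: "0 < r" "cball (snd c p) r \<subseteq> snd c ` (fst c \<inter> (V \<inter> W))"
    using open_contains_cball by blast
  have "closed {q \<in> fst c. snd c q \<in> cball (snd c p) s}" (is "closed ?K") if "s \<le> r" for s
  proof -
    have "?K \<subseteq> V"
    proof
      fix q assume q: "q \<in> ?K"
      then have "snd c q \<in> cball (snd c p) r" using that by auto
      then obtain q' where "q' \<in> fst c" "q' \<in> V" "snd c q = snd c q'" using r(2) by blast
      then show "q \<in> V" using q chart(5)[OF assms(1)] by (metis (no_types, lifting) mem_Collect_eq)
    qed
    then have "- ?K = (- closure V) \<union> (fst c \<inter> snd c -` (- cball (snd c p) s))"
      using V(3) closure_subset[of V] by auto
    moreover have "open (fst c \<inter> snd c -` (- cball (snd c p) s))"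
      by (rule open_chart_preimage[OF assms(1)]) auto
    ultimately show "closed ?K" unfolding closed_def by auto
  qed
  then show ?thesis using that[OF r(1)] r(2) by blast
qed

text \<open>Test functions must be C1 on all of \<open>M\<close>, so \<open>h\<close> is multiplied
  by a plateau bump supported in a chart ball and continued by 0. The preimage of the ball is closed
  in \<open>M\<close>; hence the chart domain and the complement of that preimage form an open cover
  on whose members the product is C1.\<close>

lemma extend_c1:
  fixes h :: "'x \<Rightarrow> real" and b :: "'x \<Rightarrow> real"
  assumes "c \<in> A" "p \<in> fst c" and h: "c1_on UNIV h" and b: "c1_lipschitz_bump b"
  obtains g where "c1_scalar A g" "\<forall>\<^sub>F x in nhds (snd c p). g (chart_inv c x) = h x"
proof -
  obtain r where r: "0 < r" "\<And>s. s \<le> r \<Longrightarrow> closed {q \<in> fst c. snd c q \<in> cball (snd c p) s}"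
    by (rule closed_chart_cball[OF assms(1,2) open_UNIV UNIV_I]) blast
  let ?K = "{q \<in> fst c. snd c q \<in> cball (snd c p) r}"
  obtain \<theta> :: "'x \<Rightarrow> real" where \<theta>: "c1_on UNIV \<theta>" "\<forall>\<^sub>F x in nhds 0. \<theta> x = 1"
    "\<And>x. 1 \<le> norm x \<Longrightarrow> \<theta> x = 0"
  proof -
    obtain \<beta> :: "'x \<Rightarrow> real" and \<beta>' where "c1_deriv UNIV \<beta> \<beta>'" "\<beta> 0 = 1" "\<And>x. 1 \<le> norm x \<Longrightarrow> \<beta> x = 0"
      by (rule normalized_bump[OF b]) blast
    then show ?thesis by (rule plateau_bump) (assumption | (rule that; assumption))+
  qed
  define H where "H = (\<lambda>x. h x * \<theta> (inverse r *\<^sub>R (x - snd c p)))"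
  have H: "c1_on UNIV H"
    using h \<theta>(1) c1_deriv_mult[OF _ c1_deriv_scale_shift, of h _ \<theta>] unfolding H_def c1_on_c1_deriv by blast
  define g where "g = (\<lambda>q. if q \<in> fst c then H (snd c q) else 0)"
  have g0: "g q = 0" if "q \<notin> ?K" for q
  proof (cases "q \<in> fst c")
    case True
    then have "r < norm (snd c q - snd c p)" using that by (simp add: dist_norm norm_minus_commute)
    moreover have "norm (inverse r *\<^sub>R (snd c q - snd c p)) = norm (snd c q - snd c p) / r"
      using r(1) by (simp add: divide_inverse_commute)
    ultimately have "1 \<le> norm (inverse r *\<^sub>R (snd c q - snd c p))" using r(1) by simp
    then show ?thesis using \<theta>(3) by (simp add: g_def H_def)
  qed (simp add: g_def)
  have "c1_scalar A g" unfolding c1_scalar_def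
  proof
    fix c' assume c': "c' \<in> A"
    have "c1_on (snd c' ` (fst c' \<inter> fst c)) (\<lambda>x. H ((snd c \<circ> chart_inv c') x))"
      by (rule c1_on_compose[OF c1_on_transition[OF c' assms(1)] H]) simp
    then have 1: "c1_on (snd c' ` (fst c' \<inter> fst c)) (g \<circ> chart_inv c')"
      by (rule c1_on_cong) (use chart(5)[OF c'] in \<open>auto simp: g_def\<close>)
    have "open (snd c' ` (fst c' \<inter> - ?K))" using open_chart_image[OF c'] r(2)[OF order_refl] by blast
    then have "c1_on (snd c' ` (fst c' \<inter> - ?K)) (\<lambda>x. 0::real)" by (rule c1_derivI_on[OF c1_deriv_const])
    then have 2: "c1_on (snd c' ` (fst c' \<inter> - ?K)) (g \<circ> chart_inv c')"
    proof (rule c1_on_cong)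
      fix x assume "x \<in> snd c' ` (fst c' \<inter> - ?K)"
      then obtain q where "q \<in> fst c'" "q \<notin> ?K" "x = snd c' q" by blast
      then show "0 = (g \<circ> chart_inv c') x" using g0 chart(5)[OF c'] by simp
    qed
    have "snd c' ` (fst c' \<inter> fst c) \<union> snd c' ` (fst c' \<inter> - ?K) = snd c' ` fst c'" by auto
    with c1_on_Un[OF 1 2] show "c1_on (snd c' ` fst c') (g \<circ> chart_inv c')" by simp
  qed
  moreover have "\<forall>\<^sub>F x in nhds (snd c p). g (chart_inv c x) = h x"
  proof -
    have "((\<lambda>x. inverse r *\<^sub>R (x - snd c p)) \<longlongrightarrow> inverse r *\<^sub>R (snd c p - snd c p)) (nhds (snd c p))"
      by (intro tendsto_intros filterlim_ident)
    then have "\<forall>\<^sub>F x in nhds (snd c p). \<theta> (inverse r *\<^sub>R (x - snd c p)) = 1"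
      by (intro eventually_compose_filterlim[OF \<theta>(2)]) simp
    moreover have "\<forall>\<^sub>F x in nhds (snd c p). x \<in> snd c ` fst c"
      using chart(2)[OF assms(1)] assms(2) by (intro eventually_nhds_in_open) auto
    ultimately show ?thesis
      by eventually_elim (use chart(6,7)[OF assms(1)] in \<open>simp add: g_def H_def\<close>)
  qed
  ultimately show ?thesis by (rule that)
qed

end

section \<open>Curves and the Finsler metric\<close>

context c1_manifold
begin

lemma has_vector_derivative_change_chart:
  assumes "c \<in> A" "c' \<in> A" "\<gamma> t \<in> fst c" "\<gamma> t \<in> fst c'" "t \<in> I"
    and "continuous (at t within I) \<gamma>"
    and "((snd c \<circ> \<gamma>) has_vector_derivative d) (at t within I)"
  shows "((snd c' \<circ> \<gamma>) has_vector_derivative transition c c' (\<gamma> t) d) (at t within I)"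
proof -
  have "((\<lambda>s. (snd c' \<circ> chart_inv c) ((snd c \<circ> \<gamma>) s)) has_derivative
      (\<lambda>h. transition c c' (\<gamma> t) (h *\<^sub>R d))) (at t within I)"
    by (rule has_derivative_compose[OF assms(7)[unfolded has_vector_derivative_def]])
      (unfold comp_apply[of "snd c" \<gamma>], rule has_derivative_transition[OF assms(1-4)])
  then have "((snd c' \<circ> \<gamma>) has_derivative (\<lambda>h. transition c c' (\<gamma> t) (h *\<^sub>R d))) (at t within I)"
  proof (rule has_derivative_transform_eventually)
    have "(\<gamma> \<longlongrightarrow> \<gamma> t) (at t within I)" using assms(6) by (simp add: continuous_within)
    then have "\<forall>\<^sub>F s in at t within I. \<gamma> s \<in> fst c"
      using topological_tendstoD chart(1)[OF assms(1)] assms(3) by blast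
    then show "\<forall>\<^sub>F s in at t within I. (snd c' \<circ> chart_inv c) ((snd c \<circ> \<gamma>) s) = (snd c' \<circ> \<gamma>) s"
      by eventually_elim (simp add: chart(5)[OF assms(1)])
  qed (use assms chart(5)[OF assms(1,3)] in auto)
  then show ?thesis
    unfolding has_vector_derivative_def linear_cmul[OF linear_transition[OF assms(1-4)]] .
qed

lemma velocity_eq:
  assumes "c \<in> A" "\<gamma> t \<in> fst c" "isCont \<gamma> t" "((snd c \<circ> \<gamma>) has_vector_derivative d) (at t)"
  shows "velocity A \<gamma> t = tangent A c (\<gamma> t) d"
  using vector_derivative_at[OF has_vector_derivative_change_chart[OF assms(1) chart_at(1) assms(2) chart_at(2) UNIV_I assms(3,4)]]
    tangent_change_chart[OF assms(1) chart_at(1) assms(2) chart_at(2), of d]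
  by (simp add: velocity_def)

lemma velocity_cong:
  assumes "open T" "t \<in> T" "\<And>s. s \<in> T \<Longrightarrow> \<gamma> s = \<gamma>' s"
  shows "velocity A \<gamma> t = velocity A \<gamma>' t"
proof -
  have "vector_derivative (f \<circ> \<gamma>) (at t) = vector_derivative (f \<circ> \<gamma>') (at t)" for f :: "'m \<Rightarrow> 'x"
    using eventually_nhds_in_open[OF assms(1,2)] assms(3)
    by (intro vector_derivative_cong_eq) (auto elim!: eventually_mono)
  then show ?thesis using assms(2,3) by (simp add: velocity_def)
qed

section \<open>Reparametrisation and concatenation of curves\<close>

lemma c1_curve_on_cong:
  assumes "c1_curve_on A I \<gamma>" "\<And>t. t \<in> I \<Longrightarrow> \<gamma> t = \<gamma>' t"
  shows "c1_curve_on A I \<gamma>'"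
  unfolding c1_curve_on_def
proof (intro conjI ballI)
  show "continuous_on I \<gamma>'" using assms continuous_on_cong[of I I \<gamma> \<gamma>'] by (auto simp: c1_curve_on_def)
  fix c assume "c \<in> A"
  then obtain \<delta> where \<delta>: "\<And>t. t \<in> I \<inter> \<gamma> -` fst c \<Longrightarrow> ((snd c \<circ> \<gamma>) has_vector_derivative \<delta> t) (at t within I)"
    "continuous_on (I \<inter> \<gamma> -` fst c) \<delta>" using assms(1) unfolding c1_curve_on_def by blast
  have eq: "I \<inter> \<gamma>' -` fst c = I \<inter> \<gamma> -` fst c" using assms(2) by auto
  have "((snd c \<circ> \<gamma>') has_vector_derivative \<delta> t) (at t within I)" if "t \<in> I \<inter> \<gamma>' -` fst c" for t
    using has_vector_derivative_transform[of t I "snd c \<circ> \<gamma>'" "snd c \<circ> \<gamma>" "\<delta> t"] \<delta>(1)[of t] that eq assms(2)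
    by auto
  then show "\<exists>\<delta>. (\<forall>t\<in>I \<inter> \<gamma>' -` fst c. ((snd c \<circ> \<gamma>') has_vector_derivative \<delta> t) (at t within I)) \<and>
      continuous_on (I \<inter> \<gamma>' -` fst c) \<delta>" using \<delta>(2) unfolding eq by blast
qed

text \<open>Covers translation with \<open>r = 1\<close> and reversal with \<open>r = - 1\<close> at
  once, which explains the unsimplified arguments \<open>1 * t + h\<close> and
  \<open>- 1 * t + 0\<close> below.\<close>

lemma c1_curve_on_affine:
  assumes "c1_curve_on A I \<gamma>" "\<And>t. t \<in> J \<Longrightarrow> r * t + h \<in> I"
  shows "c1_curve_on A J (\<lambda>t. \<gamma> (r * t + h))"
  unfolding c1_curve_on_def
proof (intro conjI ballI)
  have \<tau>: "continuous_on J (\<lambda>t. r * t + h)" by (intro continuous_intros)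
  show "continuous_on J (\<lambda>t. \<gamma> (r * t + h))"
    using assms continuous_on_compose2[OF _ \<tau>, of I \<gamma>] by (auto simp: c1_curve_on_def)
  fix c assume "c \<in> A"
  then obtain \<delta> where \<delta>: "\<And>t. t \<in> I \<inter> \<gamma> -` fst c \<Longrightarrow> ((snd c \<circ> \<gamma>) has_vector_derivative \<delta> t) (at t within I)"
    "continuous_on (I \<inter> \<gamma> -` fst c) \<delta>" using assms(1) unfolding c1_curve_on_def by blast
  let ?J = "J \<inter> (\<lambda>t. \<gamma> (r * t + h)) -` fst c"
  have "((snd c \<circ> (\<lambda>t. \<gamma> (r * t + h))) has_vector_derivative r *\<^sub>R \<delta> (r * t + h)) (at t within J)" if "t \<in> ?J" for t
  proof -
    have "((\<lambda>t. r * t + h) has_vector_derivative r) (at t within J)"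
      by (auto intro!: derivative_eq_intros)
    moreover have "((snd c \<circ> \<gamma>) has_vector_derivative \<delta> (r * t + h)) (at (r * t + h) within (\<lambda>t. r * t + h) ` J)"
      using \<delta>(1)[of "r * t + h"] that assms(2) by (auto intro: has_vector_derivative_within_subset)
    ultimately have "((snd c \<circ> \<gamma>) \<circ> (\<lambda>t. r * t + h) has_vector_derivative r *\<^sub>R \<delta> (r * t + h)) (at t within J)"
      by (rule vector_diff_chain_within)
    then show ?thesis by (simp add: o_def)
  qed
  moreover have "continuous_on ?J (\<lambda>t. r *\<^sub>R \<delta> (r * t + h))"
    by (intro continuous_intros continuous_on_compose2[OF \<delta>(2)]) (use assms(2) in auto)
  ultimately show "\<exists>\<delta>. (\<forall>t\<in>?J. ((snd c \<circ> (\<lambda>t. \<gamma> (r * t + h))) has_vector_derivative \<delta> t) (at t within J)) \<and>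
      continuous_on ?J \<delta>" by (intro exI[of _ "\<lambda>t. r *\<^sub>R \<delta> (r * t + h)"]) blast
qed

lemma piecewise_c1_curveE:
  assumes "piecewise_c1_curve A a b \<gamma>"
  obtains n s where "s 0 = a" "s n = b" "\<And>i. i < n \<Longrightarrow> s i < s (Suc i)"
    "\<And>i. i < n \<Longrightarrow> c1_curve_on A {s i..s (Suc i)} \<gamma>" "\<And>m. m \<le> n \<Longrightarrow> a \<le> s m"
proof -
  obtain n s where s: "s 0 = a" "s n = b" "\<And>i. i < n \<Longrightarrow> s i < s (Suc i)"
    "\<And>i. i < n \<Longrightarrow> c1_curve_on A {s i..s (Suc i)} \<gamma>"
    using assms unfolding piecewise_c1_curve_def by blast
  have "a \<le> s m" if "m \<le> n" for m
    using that
  proof (induction m)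
    case (Suc m)
    then show ?case using s(3)[of m] by simp
  qed (simp add: s)
  with s show ?thesis by (rule that)
qed

lemma piecewise_c1_curve_continuous_on:
  assumes "piecewise_c1_curve A a b \<gamma>"
  shows "continuous_on {a..b} \<gamma>"
proof -
  obtain n s where s: "s 0 = a" "s n = b" "\<And>i. i < n \<Longrightarrow> s i < s (Suc i)"
    "\<And>i. i < n \<Longrightarrow> c1_curve_on A {s i..s (Suc i)} \<gamma>" "\<And>m. m \<le> n \<Longrightarrow> a \<le> s m"
    by (rule piecewise_c1_curveE[OF assms]) (rule that; assumption)
  have "continuous_on {a..s m} \<gamma>" if "m \<le> n" for m
    using that
  proof (induction m)
    case 0 then show ?case by (simp add: s)
  next
    case (Suc m)
    have "{a..s (Suc m)} = {a..s m} \<union> {s m..s (Suc m)}"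
      using s(3)[of m] s(5)[of m] Suc.prems by auto
    then show ?case
      using Suc s(4)[of m] by (auto intro!: continuous_on_closed_Un simp: c1_curve_on_def)
  qed
  then show ?thesis using s(2) by blast
qed

text \<open>Inside a piece the filter \<open>at t within\<close> the piece is \<open>at t\<close>,
  so the derivative is two-sided there. The finite set of break points is invisible to
  integrals.\<close>

lemma piecewise_c1_curve_differentiable:
  assumes "piecewise_c1_curve A a b \<gamma>"
  obtains S where "finite S" "\<And>t. t \<in> {a..b} - S \<Longrightarrow> isCont \<gamma> t"
    "\<And>t c. t \<in> {a..b} - S \<Longrightarrow> c \<in> A \<Longrightarrow> \<gamma> t \<in> fst c \<Longrightarrow> \<exists>d. ((snd c \<circ> \<gamma>) has_vector_derivative d) (at t)"
proof -
  obtain n s where s: "s 0 = a" "s n = b" "\<And>i. i < n \<Longrightarrow> s i < s (Suc i)"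
    "\<And>i. i < n \<Longrightarrow> c1_curve_on A {s i..s (Suc i)} \<gamma>" "\<And>m. m \<le> n \<Longrightarrow> a \<le> s m"
    by (rule piecewise_c1_curveE[OF assms]) (rule that; assumption)
  have "t \<in> s ` {..m} \<or> (\<exists>i<m. s i < t \<and> t < s (Suc i))" if "m \<le> n" "t \<in> {a..s m}" for m t
    using that
  proof (induction m)
    case 0 then show ?case by (simp add: s)
  next
    case (Suc m)
    show ?case
    proof (cases "t \<le> s m")
      case True
      then have "t \<in> s ` {..m} \<or> (\<exists>i<m. s i < t \<and> t < s (Suc i))" using Suc by simp
      then show ?thesis by (auto simp: less_Suc_eq atMost_Suc)
    next
      case False
      then show ?thesis using Suc.prems by (cases "t = s (Suc m)") (auto intro!: exI[of _ m])
    qed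
  qed
  then have piece: "\<exists>i<n. s i < t \<and> t < s (Suc i)" if "t \<in> {a..b} - s ` {..n}" for t
    using that s(2) by blast
  show ?thesis
  proof (rule that[of "s ` {..n}"])
    fix t assume "t \<in> {a..b} - s ` {..n}"
    then obtain i where i: "i < n" "s i < t" "t < s (Suc i)" using piece by blast
    then have at: "at t within {s i..s (Suc i)} = at t" by (intro at_within_Icc_at)
    then show "isCont \<gamma> t" using s(4)[OF i(1)] i
      by (metis (no_types, opaque_lifting) atLeastAtMost_iff c1_curve_on_def continuous_on_eq_continuous_within less_imp_le)
    fix c assume "c \<in> A" "\<gamma> t \<in> fst c"
    then obtain \<delta> where "\<And>t. t \<in> {s i..s (Suc i)} \<inter> \<gamma> -` fst c \<Longrightarrow>
        ((snd c \<circ> \<gamma>) has_vector_derivative \<delta> t) (at t within {s i..s (Suc i)})"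
      using s(4)[OF i(1)] unfolding c1_curve_on_def by blast
    from this[of t] show "\<exists>d. ((snd c \<circ> \<gamma>) has_vector_derivative d) (at t)"
      using i at \<open>\<gamma> t \<in> fst c\<close> by auto
  qed simp
qed

lemma piecewise_c1_curve_join:
  assumes "piecewise_c1_curve A a b \<gamma>" "piecewise_c1_curve A b c \<gamma>"
  shows "piecewise_c1_curve A a c \<gamma>"
proof -
  obtain n s where s: "s 0 = a" "s n = b" "\<And>i. i < n \<Longrightarrow> s i < s (Suc i)"
    "\<And>i. i < n \<Longrightarrow> c1_curve_on A {s i..s (Suc i)} \<gamma>"
    using assms(1) unfolding piecewise_c1_curve_def by blast
  obtain n' s' where s': "s' 0 = b" "s' n' = c" "\<And>i. i < n' \<Longrightarrow> s' i < s' (Suc i)"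
    "\<And>i. i < n' \<Longrightarrow> c1_curve_on A {s' i..s' (Suc i)} \<gamma>"
    using assms(2) unfolding piecewise_c1_curve_def by blast
  define \<sigma> where "\<sigma> = (\<lambda>i. if i \<le> n then s i else s' (i - n))"
  have piece: "\<sigma> i < \<sigma> (Suc i) \<and> c1_curve_on A {\<sigma> i..\<sigma> (Suc i)} \<gamma>" if "i < n + n'" for i
  proof (cases "i < n")
    case True then show ?thesis using s by (simp add: \<sigma>_def)
  next
    case False
    then have "\<sigma> i = s' (i - n)" "\<sigma> (Suc i) = s' (Suc (i - n))"
      using s(2) s'(1) by (auto simp: \<sigma>_def Suc_diff_le)
    then show ?thesis using False that s'(3,4)[of "i - n"] by simp
  qed
  have "\<sigma> 0 = a" "\<sigma> (n + n') = c" using s s' by (auto simp: \<sigma>_def)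
  with piece show ?thesis using assms unfolding piecewise_c1_curve_def
    by (auto intro!: exI[of _ "n + n'"] exI[of _ \<sigma>])
qed

lemma piecewise_c1_curve_cong:
  assumes "piecewise_c1_curve A a b \<gamma>" "\<And>t. t \<in> {a..b} \<Longrightarrow> \<gamma> t = \<gamma>' t"
  shows "piecewise_c1_curve A a b \<gamma>'"
proof -
  obtain n s where s: "s 0 = a" "s n = b" "\<And>i. i < n \<Longrightarrow> s i < s (Suc i)"
    "\<And>i. i < n \<Longrightarrow> c1_curve_on A {s i..s (Suc i)} \<gamma>" "\<And>m. m \<le> n \<Longrightarrow> a \<le> s m"
    by (rule piecewise_c1_curveE[OF assms(1)]) (rule that; assumption)
  have ub: "s m \<le> b" if "m \<le> n" for m
    using that
  proof (induction rule: inc_induct)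
    case (step m)
    then show ?case using s(3)[of m] by simp
  qed (simp add: s)
  have "c1_curve_on A {s i..s (Suc i)} \<gamma>'" if "i < n" for i
    using that s(5)[of i] ub[of "Suc i"] by (intro c1_curve_on_cong[OF s(4)] assms(2)) auto
  then show ?thesis using assms(1) s(1-3) unfolding piecewise_c1_curve_def by blast
qed

lemma piecewise_c1_curve_shift:
  assumes "piecewise_c1_curve A a b \<gamma>"
  shows "piecewise_c1_curve A (a - h) (b - h) (\<lambda>t. \<gamma> (1 * t + h))"
proof -
  obtain n s where s: "a < b" "s 0 = a" "s n = b" "\<And>i. i < n \<Longrightarrow> s i < s (Suc i)"
    "\<And>i. i < n \<Longrightarrow> c1_curve_on A {s i..s (Suc i)} \<gamma>"
    using assms unfolding piecewise_c1_curve_def by blast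
  have "c1_curve_on A {s i - h..s (Suc i) - h} (\<lambda>t. \<gamma> (1 * t + h))" if "i < n" for i
    by (rule c1_curve_on_affine[OF s(5)[OF that]]) auto
  then show ?thesis unfolding piecewise_c1_curve_def using s
    by (intro conjI exI[of _ n] exI[of _ "\<lambda>i. s i - h"]) auto
qed

lemma piecewise_c1_curve_reverse:
  assumes "piecewise_c1_curve A a b \<gamma>"
  shows "piecewise_c1_curve A (- b) (- a) (\<lambda>t. \<gamma> (- 1 * t + 0))"
proof -
  obtain n s where s: "a < b" "s 0 = a" "s n = b" "\<And>i. i < n \<Longrightarrow> s i < s (Suc i)"
    "\<And>i. i < n \<Longrightarrow> c1_curve_on A {s i..s (Suc i)} \<gamma>"
    using assms unfolding piecewise_c1_curve_def by blast
  have "- s (n - i) < - s (n - Suc i) \<and> c1_curve_on A {- s (n - i)..- s (n - Suc i)} (\<lambda>t. \<gamma> (- 1 * t + 0))"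
    if "i < n" for i
  proof -
    have e: "n - i = Suc (n - Suc i)" and l: "n - Suc i < n" using that by auto
    show ?thesis unfolding e using s(4)[OF l] by (intro conjI c1_curve_on_affine[OF s(5)[OF l]]) auto
  qed
  then show ?thesis unfolding piecewise_c1_curve_def using s(1-3)
    by (intro conjI exI[of _ n] exI[of _ "\<lambda>i. - s (n - i)"]) auto
qed

end

context finsler_manifold
begin

section \<open>Lengths of curves\<close>

lemma speed_nonneg: "0 \<le> N (velocity A \<gamma> t)"
  unfolding velocity_def by (rule nrm_nonneg[OF chart_at])

text \<open>The chart in \<open>velocity\<close> changes erratically with \<open>t\<close>. Near a
  given time the speed is therefore rewritten in one fixed chart, where it is the continuous norm of
  a continuous coordinate derivative. Derivatives within the interval are used for this and differ
  from those in \<open>velocity\<close> at the end points only.\<close>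

lemma speed_integrable_on_piece:
  assumes "c1_curve_on A {a..b} \<gamma>" "a < b"
  shows "(\<lambda>t. N (velocity A \<gamma> t)) integrable_on {a..b}"
proof -
  let ?I = "{a..b}"
  define f where "f = (\<lambda>t. nrm (chart_at A (\<gamma> t)) (\<gamma> t)
      (vector_derivative (snd (chart_at A (\<gamma> t)) \<circ> \<gamma>) (at t within ?I)))"
  have \<gamma>: "continuous_on ?I \<gamma>" using assms(1) by (simp add: c1_curve_on_def)
  have "continuous (at t0 within ?I) f" if t0: "t0 \<in> ?I" for t0
  proof -
    define c where "c = chart_at A (\<gamma> t0)"
    have c: "c \<in> A" "\<gamma> t0 \<in> fst c" using chart_at by (auto simp: c_def)
    let ?J = "?I \<inter> \<gamma> -` fst c"
    obtain \<delta> where \<delta>: "\<And>t. t \<in> ?J \<Longrightarrow> ((snd c \<circ> \<gamma>) has_vector_derivative \<delta> t) (at t within ?I)"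
      "continuous_on ?J \<delta>" using assms(1) c(1) unfolding c1_curve_on_def by blast
    have f: "f t = nrm c (\<gamma> t) (\<delta> t)" if "t \<in> ?J" for t
    proof -
      let ?c = "chart_at A (\<gamma> t)"
      have t: "\<gamma> t \<in> fst c" "t \<in> ?I" using that by auto
      have "continuous (at t within ?I) \<gamma>" using \<gamma> t(2) by (simp add: continuous_on_eq_continuous_within)
      from has_vector_derivative_change_chart[OF c(1) chart_at(1) t(1) chart_at(2) t(2) this \<delta>(1)[OF that]]
      have "vector_derivative (snd ?c \<circ> \<gamma>) (at t within ?I) = transition c ?c (\<gamma> t) (\<delta> t)"
        using vector_derivative_within_cbox[of a b t] assms(2) t(2) by simp
      then show ?thesis
        unfolding f_def tangent_change_chart[OF c(1) chart_at(1) t(1) chart_at(2)] by simp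
    qed
    have "continuous_on ?J (\<lambda>t. (\<lambda>(p, v). nrm c p v) (\<gamma> t, \<delta> t))"
      by (intro continuous_on_compose2[OF continuous_on_nrm[OF c(1)]] continuous_on_Pair \<delta>(2)
          continuous_on_subset[OF \<gamma>]) auto
    then have "continuous_on ?J f" by (rule continuous_on_eq) (use f in auto)
    moreover obtain T where T: "open T" "?J = ?I \<inter> T"
      using continuous_openin_preimage_gen[OF \<gamma> chart(1)[OF c(1)]] unfolding openin_open by blast
    moreover have "at t0 within ?J = at t0 within ?I"
    proof (rule at_within_nhd[OF _ T(1)])
      show "t0 \<in> T" using T(2) t0 c(2) by blast
      show "?J \<inter> T - {t0} = ?I \<inter> T - {t0}" unfolding T(2) by blast
    qed
    moreover have "t0 \<in> ?J" using t0 c(2) by blast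
    ultimately show ?thesis unfolding continuous_on_eq_continuous_within by metis
  qed
  then have int: "f integrable_on ?I"
    by (intro integrable_continuous_interval) (simp add: continuous_on_eq_continuous_within)
  have eq: "N (velocity A \<gamma> t) = f t" if "t \<in> ?I - {a, b}" for t
  proof -
    have "at t within ?I = at t" using that by (intro at_within_Icc_at) auto
    then show ?thesis unfolding velocity_def f_def by simp
  qed
  show ?thesis by (rule integrable_spike_finite[of "{a, b}", OF _ eq int]) simp_all
qed

lemma speed_integrable:
  assumes "piecewise_c1_curve A a b \<gamma>"
  shows "(\<lambda>t. N (velocity A \<gamma> t)) integrable_on {a..b}"
proof -
  obtain n s where s: "s 0 = a" "s n = b" "\<And>i. i < n \<Longrightarrow> s i < s (Suc i)"
    "\<And>i. i < n \<Longrightarrow> c1_curve_on A {s i..s (Suc i)} \<gamma>" "\<And>m. m \<le> n \<Longrightarrow> a \<le> s m"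
    by (rule piecewise_c1_curveE[OF assms]) (rule that; assumption)
  have "(\<lambda>t. N (velocity A \<gamma> t)) integrable_on {a..s m}" if "m \<le> n" for m
    using that
  proof (induction m)
    case 0
    show ?case unfolding s(1) by (rule integrable_on_refl[of _ a, unfolded cbox_interval])
  next
    case (Suc m)
    then have m: "m < n" "a \<le> s m" "s m \<le> s (Suc m)" using s(3)[of m] s(5)[of m] by auto
    show ?case
      by (rule Henstock_Kurzweil_Integration.integrable_combine[OF m(2,3)])
        (use Suc m(1) speed_integrable_on_piece[OF s(4)[OF m(1)] s(3)[OF m(1)]] in auto)
  qed
  then show ?thesis using s(2) by blast
qed

lemma curve_length_nonneg: "0 \<le> curve_length A N a b \<gamma>"
  \<comment> \<open>A speed that is not integrable has integral 0 by convention.\<close>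
  unfolding curve_length_def by (cases "(\<lambda>t. N (velocity A \<gamma> t)) integrable_on {a..b}")
    (auto intro: integral_nonneg simp: speed_nonneg not_integrable_integral)

lemma curve_length_cong:
  assumes "\<And>t. t \<in> {a..b} \<Longrightarrow> \<gamma> t = \<gamma>' t"
  shows "curve_length A N a b \<gamma> = curve_length A N a b \<gamma>'"
  unfolding curve_length_def
proof (rule integral_spike[of "{a, b}"])
  fix t assume "t \<in> {a..b} - {a, b}"
  then have "velocity A \<gamma> t = velocity A \<gamma>' t"
    using assms by (intro velocity_cong[of "{a<..<b}"]) auto
  then show "N (velocity A \<gamma>' t) = N (velocity A \<gamma> t)" by simp
qed simp

lemma speed_affine:
  assumes "\<bar>r\<bar> = 1" "c \<in> A" "\<gamma> (r * t + h) \<in> fst c" "isCont \<gamma> (r * t + h)"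
    "((snd c \<circ> \<gamma>) has_vector_derivative d) (at (r * t + h))"
  shows "N (velocity A (\<lambda>t. \<gamma> (r * t + h)) t) = N (velocity A \<gamma> (r * t + h))"
proof -
  have \<tau>: "((\<lambda>t. r * t + h) has_vector_derivative r) (at t)"
    by (auto intro!: derivative_eq_intros)
  have "((snd c \<circ> \<gamma>) \<circ> (\<lambda>t. r * t + h) has_vector_derivative r *\<^sub>R d) (at t)"
    by (rule vector_diff_chain_at[OF \<tau> assms(5)])
  then have d: "(snd c \<circ> (\<lambda>t. \<gamma> (r * t + h)) has_vector_derivative r *\<^sub>R d) (at t)" by (simp add: o_def)
  have "isCont (\<lambda>t. r * t + h) t" by simp
  then have "isCont (\<lambda>t. \<gamma> (r * t + h)) t" using assms(4) by (rule isCont_o2)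
  from velocity_eq[OF assms(2) _ this d] velocity_eq[OF assms(2-5)] show ?thesis
    using assms(1,3) nrm_scaleR[OF assms(2,3)] by simp
qed

lemma curve_length_shift:
  assumes "piecewise_c1_curve A a b \<gamma>"
  shows "curve_length A N (a - h) (b - h) (\<lambda>t. \<gamma> (1 * t + h)) = curve_length A N a b \<gamma>"
proof -
  obtain S where S: "finite S" "\<And>t. t \<in> {a..b} - S \<Longrightarrow> isCont \<gamma> t"
    "\<And>t c. t \<in> {a..b} - S \<Longrightarrow> c \<in> A \<Longrightarrow> \<gamma> t \<in> fst c \<Longrightarrow> \<exists>d. ((snd c \<circ> \<gamma>) has_vector_derivative d) (at t)"
    by (rule piecewise_c1_curve_differentiable[OF assms]) (rule that; assumption)
  have "((\<lambda>t. N (velocity A \<gamma> t)) has_integral curve_length A N a b \<gamma>) (cbox a b)"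
    using speed_integrable[OF assms] by (simp add: curve_length_def integrable_integral)
  from has_integral_affinity'[OF this, of 1 h]
  have "((\<lambda>t. N (velocity A \<gamma> (t + h))) has_integral curve_length A N a b \<gamma>) {a - h..b - h}" by simp
  then have "((\<lambda>t. N (velocity A (\<lambda>t. \<gamma> (1 * t + h)) t)) has_integral curve_length A N a b \<gamma>) {a - h..b - h}"
  proof (rule has_integral_spike_finite[rotated 2])
    show "finite ((\<lambda>t. t - h) ` S)" using S(1) by simp
    fix t assume t: "t \<in> {a - h..b - h} - (\<lambda>t. t - h) ` S"
    have "1 * t + h \<notin> S" using t by (auto simp: image_iff)
    with t have t: "1 * t + h \<in> {a..b} - S" by auto
    obtain d where "((snd (chart_at A (\<gamma> (1 * t + h))) \<circ> \<gamma>) has_vector_derivative d) (at (1 * t + h))"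
      using S(3)[OF t chart_at] by blast
    from speed_affine[OF _ chart_at S(2)[OF t] this]
    show "N (velocity A (\<lambda>t. \<gamma> (1 * t + h)) t) = N (velocity A \<gamma> (t + h))" by simp
  qed
  then show ?thesis unfolding curve_length_def by (rule integral_unique)
qed

lemma curve_length_reverse:
  assumes "piecewise_c1_curve A a b \<gamma>"
  shows "curve_length A N (- b) (- a) (\<lambda>t. \<gamma> (- 1 * t + 0)) = curve_length A N a b \<gamma>"
proof -
  obtain S where S: "finite S" "\<And>t. t \<in> {a..b} - S \<Longrightarrow> isCont \<gamma> t"
    "\<And>t c. t \<in> {a..b} - S \<Longrightarrow> c \<in> A \<Longrightarrow> \<gamma> t \<in> fst c \<Longrightarrow> \<exists>d. ((snd c \<circ> \<gamma>) has_vector_derivative d) (at t)"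
    by (rule piecewise_c1_curve_differentiable[OF assms]) (rule that; assumption)
  have "((\<lambda>t. N (velocity A \<gamma> t)) has_integral curve_length A N a b \<gamma>) {a..b}"
    using speed_integrable[OF assms] by (simp add: curve_length_def integrable_integral)
  then have "((\<lambda>t. N (velocity A \<gamma> (- t))) has_integral curve_length A N a b \<gamma>) {- b..- a}"
    by (simp only: has_integral_reflect_real[where f = "\<lambda>t. N (velocity A \<gamma> t)"])
  then have "((\<lambda>t. N (velocity A (\<lambda>t. \<gamma> (- 1 * t + 0)) t)) has_integral curve_length A N a b \<gamma>) {- b..- a}"
  proof (rule has_integral_spike_finite[rotated 2])
    show "finite (uminus ` S)" using S(1) by simp
    fix t assume t: "t \<in> {- b..- a} - uminus ` S"
    then have t: "- 1 * t + 0 \<in> {a..b} - S" by (auto simp: image_iff)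
    obtain d where "((snd (chart_at A (\<gamma> (- 1 * t + 0))) \<circ> \<gamma>) has_vector_derivative d) (at (- 1 * t + 0))"
      using S(3)[OF t chart_at] by blast
    from speed_affine[OF _ chart_at S(2)[OF t] this]
    show "N (velocity A (\<lambda>t. \<gamma> (- 1 * t + 0)) t) = N (velocity A \<gamma> (- t))" by simp
  qed
  then show ?thesis unfolding curve_length_def by (rule integral_unique)
qed

text \<open>The lengths whose infimum is the Finsler distance, as a relation: symmetry and
  concatenation can then be shown for single curves and pass to the infimum.\<close>

definition connects :: "'m \<Rightarrow> 'm \<Rightarrow> real \<Rightarrow> bool" where
  "connects p q l \<longleftrightarrow> (\<exists>a b \<gamma>. piecewise_c1_curve A a b \<gamma> \<and> \<gamma> a = p \<and> \<gamma> b = q \<and> curve_length A N a b \<gamma> = l)"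

lemma finsler_dist_connects: "finsler_dist A N p q = Inf {l. connects p q l}"
  unfolding finsler_dist_def connects_def by (rule arg_cong[of _ _ Inf]) auto

lemma connects_nonneg: "connects p q l \<Longrightarrow> 0 \<le> l"
  using curve_length_nonneg by (auto simp: connects_def)

lemma connects_sym: "connects p q l \<Longrightarrow> connects q p l"
proof -
  assume "connects p q l"
  then obtain a b \<gamma> where *: "piecewise_c1_curve A a b \<gamma>" "\<gamma> a = p" "\<gamma> b = q" "curve_length A N a b \<gamma> = l"
    by (auto simp: connects_def)
  show "connects q p l" unfolding connects_def
    by (intro exI conjI, rule piecewise_c1_curve_reverse[OF *(1)])
      (use * curve_length_reverse[OF *(1)] in auto)
qed

lemma connects_trans:
  assumes "connects p q l" "connects q r l'"
  shows "connects p r (l + l')"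
proof -
  obtain a b \<gamma> where 1: "piecewise_c1_curve A a b \<gamma>" "\<gamma> a = p" "\<gamma> b = q" "curve_length A N a b \<gamma> = l"
    using assms(1) by (auto simp: connects_def)
  obtain a' b' \<gamma>' where 2: "piecewise_c1_curve A a' b' \<gamma>'" "\<gamma>' a' = q" "\<gamma>' b' = r" "curve_length A N a' b' \<gamma>' = l'"
    using assms(2) by (auto simp: connects_def)
  define h where "h = a' - b"
  define \<eta> where "\<eta> = (\<lambda>t. if t \<le> b then \<gamma> t else \<gamma>' (1 * t + h))"
  have ab: "a < b" "a' < b'" using 1(1) 2(1) by (auto simp: piecewise_c1_curve_def)
  have e1: "\<gamma> t = \<eta> t" if "t \<in> {a..b}" for t using that by (simp add: \<eta>_def)
  have e2: "\<gamma>' (1 * t + h) = \<eta> t" if "t \<in> {b..b' - h}" for t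
    using that 1(3) 2(2) by (cases "t = b") (auto simp: \<eta>_def h_def)
  have p1: "piecewise_c1_curve A a b \<eta>" by (rule piecewise_c1_curve_cong[OF 1(1) e1])
  have b: "b = a' - h" by (simp add: h_def)
  have p2: "piecewise_c1_curve A b (b' - h) \<eta>"
    using piecewise_c1_curve_cong[OF piecewise_c1_curve_shift[OF 2(1), of h]] e2 unfolding b by blast
  have p: "piecewise_c1_curve A a (b' - h) \<eta>" by (rule piecewise_c1_curve_join[OF p1 p2])
  have "curve_length A N a (b' - h) \<eta> = curve_length A N a b \<eta> + curve_length A N b (b' - h) \<eta>"
    unfolding curve_length_def using Henstock_Kurzweil_Integration.integral_combine[OF _ _ speed_integrable[OF p], of b] ab
    by (simp add: h_def)
  also have "curve_length A N a b \<eta> = l" using curve_length_cong[OF e1] 1(4) by simp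
  also have "curve_length A N b (b' - h) \<eta> = l'"
    using curve_length_cong[of b "b' - h", OF e2] curve_length_shift[OF 2(1), of h] 2(4) unfolding b by simp
  finally have "curve_length A N a (b' - h) \<eta> = l + l'" .
  moreover have "\<eta> a = p" "\<eta> (b' - h) = r" using 1 2 ab by (auto simp: \<eta>_def h_def)
  ultimately show ?thesis using p unfolding connects_def by blast
qed

text \<open>The curve is the preimage of the straight segment. Its velocity has the constant
  coordinate vector \<open>snd c q - snd c p\<close>, so a bound for the norm of this vector along
  the segment bounds the length over the unit interval.\<close>

lemma connects_segment:
  assumes "c \<in> A" "p \<in> fst c" "q \<in> fst c" "closed_segment (snd c p) (snd c q) \<subseteq> snd c ` fst c"
    and B: "\<And>x. x \<in> closed_segment (snd c p) (snd c q) \<Longrightarrow> nrm c (chart_inv c x) (snd c q - snd c p) \<le> B"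
  obtains l where "connects p q l" "l \<le> B"
proof -
  define w where "w = snd c q - snd c p"
  define \<sigma> where "\<sigma> = (\<lambda>t::real. snd c p + t *\<^sub>R w)"
  define \<gamma> where "\<gamma> = (\<lambda>t. chart_inv c (\<sigma> t))"
  have seg: "\<sigma> t \<in> closed_segment (snd c p) (snd c q)" if "t \<in> {0..1}" for t
  proof -
    have "\<sigma> t = (1 - t) *\<^sub>R snd c p + t *\<^sub>R snd c q" by (simp add: \<sigma>_def w_def algebra_simps)
    then show ?thesis using that unfolding closed_segment_def by auto
  qed
  have in_c: "\<sigma> t \<in> snd c ` fst c" "\<gamma> t \<in> fst c" "snd c (\<gamma> t) = \<sigma> t" if "t \<in> {0..1}" for t
    using seg[OF that] assms(4) chart(6,7)[OF assms(1)] by (auto simp: \<gamma>_def)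
  have \<sigma>d: "(\<sigma> has_vector_derivative w) (at t within I)" for t I
    unfolding \<sigma>_def by (auto intro!: derivative_eq_intros)
  have \<gamma>c: "continuous_on {0..1} \<gamma>" unfolding \<gamma>_def
    by (rule continuous_on_compose2[OF chart(4)[OF assms(1)]])
      (use in_c in \<open>auto simp: \<sigma>_def intro!: continuous_intros\<close>)
  have d1: "((snd c \<circ> \<gamma>) has_vector_derivative w) (at t within {0..1})" if "t \<in> {0..1}" for t
    by (rule has_vector_derivative_transform[OF that _ \<sigma>d]) (simp add: in_c(3))
  have "c1_curve_on A {0..1} \<gamma>" unfolding c1_curve_on_def
  proof (intro conjI ballI \<gamma>c)
    fix c' assume c': "c' \<in> A"
    let ?J = "{0..1} \<inter> \<gamma> -` fst c'"
    let ?S = "snd c ` (fst c \<inter> fst c')"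
    obtain D where D: "\<And>x. x \<in> ?S \<Longrightarrow> ((snd c' \<circ> chart_inv c) has_derivative blinfun_apply (D x)) (at x)"
      "continuous_on ?S D" using c1_on_transition[OF assms(1) c'] unfolding c1_on_def by blast
    have S: "\<sigma> t \<in> ?S" if "t \<in> ?J" for t
    proof -
      have "\<gamma> t \<in> fst c \<inter> fst c'" "\<sigma> t = snd c (\<gamma> t)" using that in_c[of t] by auto
      then show ?thesis by blast
    qed
    have "((snd c' \<circ> \<gamma>) has_vector_derivative D (\<sigma> t) w) (at t within {0..1})" if "t \<in> ?J" for t
      using has_derivative_compose[OF \<sigma>d[unfolded has_vector_derivative_def] D(1)[OF S[OF that]], of "{0..1}"]
      by (simp add: has_vector_derivative_def \<gamma>_def o_def blinfun.scaleR_right)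
    moreover have "continuous_on ?J (\<lambda>t. D (\<sigma> t) w)"
      by (intro continuous_intros continuous_on_compose2[OF D(2)]) (use S in \<open>auto simp: \<sigma>_def intro!: continuous_intros\<close>)
    ultimately show "\<exists>\<delta>. (\<forall>t\<in>?J. ((snd c' \<circ> \<gamma>) has_vector_derivative \<delta> t) (at t within {0..1})) \<and>
        continuous_on ?J \<delta>" by (intro exI[of _ "\<lambda>t. D (\<sigma> t) w"]) blast
  qed
  then have pw: "piecewise_c1_curve A 0 1 \<gamma>" unfolding piecewise_c1_curve_def
    by (auto intro!: exI[of _ "Suc 0"] exI[of _ real])
  have "curve_length A N 0 1 \<gamma> \<le> integral {0..1} (\<lambda>t::real. B)" unfolding curve_length_def
  proof -
    have le: "N (velocity A \<gamma> t) \<le> B" if "t \<in> {0..1} - {0, 1}" for t :: real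
    proof -
    have t: "0 < t" "t < 1" using that by auto
    have at: "at t within {0..1} = at t" using t by (intro at_within_Icc_at)
    have "isCont \<gamma> t" using \<gamma>c t at by (metis atLeastAtMost_iff continuous_on_eq_continuous_within less_imp_le)
    moreover have "((snd c \<circ> \<gamma>) has_vector_derivative w) (at t)" using d1[of t] t unfolding at by simp
    moreover have "\<gamma> t \<in> fst c" using in_c t by simp
    ultimately have "velocity A \<gamma> t = tangent A c (\<gamma> t) w" using velocity_eq[OF assms(1)] by blast
    then show "N (velocity A \<gamma> t) \<le> B" using B[OF seg[of t]] t by (simp add: \<gamma>_def w_def)
    qed
    \<comment> \<open>At the end points the velocity is a meaningless tangent vector; truncating the
      speed at \<open>B\<close> changes it at most there and makes the comparison valid
      everywhere.\<close>
    have "integral {0..1} (\<lambda>t. N (velocity A \<gamma> t)) = integral {0..1} (\<lambda>t. min (N (velocity A \<gamma> t)) B)"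
      by (rule integral_spike[of "{0, 1}"]) (use le in auto)
    also have "\<dots> \<le> integral {0..1} (\<lambda>t::real. B)"
      by (rule integral_le, rule integrable_spike_finite[of "{0, 1}", OF _ _ speed_integrable[OF pw]]) (use le in auto)
    finally show "integral {0..1} (\<lambda>t. N (velocity A \<gamma> t)) \<le> integral {0..1} (\<lambda>t::real. B)" .
  qed
  then have "curve_length A N 0 1 \<gamma> \<le> B" by simp
  moreover have "\<gamma> 0 = p" "\<gamma> 1 = q" using chart(5)[OF assms(1)] assms(2,3) by (auto simp: \<gamma>_def \<sigma>_def w_def)
  ultimately show ?thesis using that[of "curve_length A N 0 1 \<gamma>"] pw unfolding connects_def by blast
qed

lemma nrm_bounds_near:
  assumes "c \<in> A" "p \<in> fst c" "open W" "p \<in> W" "0 < e"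
  obtains r where "0 < r" "cball (snd c p) r \<subseteq> snd c ` (fst c \<inter> W)"
    "\<And>s. s \<le> r \<Longrightarrow> closed {q \<in> fst c. snd c q \<in> cball (snd c p) s}"
    "\<And>x v. x \<in> cball (snd c p) r \<Longrightarrow> nrm c p v \<le> (1 + e) * nrm c (chart_inv c x) v"
    "\<And>x v. x \<in> cball (snd c p) r \<Longrightarrow> nrm c (chart_inv c x) v \<le> (1 + e) * nrm c p v"
proof -
  obtain V where V: "open V" "p \<in> V" "V \<subseteq> fst c"
    "\<And>q v. q \<in> V \<Longrightarrow> nrm c p v \<le> (1 + e) * nrm c q v" "\<And>q v. q \<in> V \<Longrightarrow> nrm c q v \<le> (1 + e) * nrm c p v"
    by (rule nrm_near[OF assms(1,2,5)]) (rule that; assumption)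
  have VW: "open (V \<inter> W)" "p \<in> V \<inter> W" using V assms by auto
  obtain r where r: "0 < r" "cball (snd c p) r \<subseteq> snd c ` (fst c \<inter> (V \<inter> W))"
    "\<And>s. s \<le> r \<Longrightarrow> closed {q \<in> fst c. snd c q \<in> cball (snd c p) s}"
    by (rule closed_chart_cball[OF assms(1,2) VW]) (rule that; assumption)
  have "chart_inv c x \<in> V" if "x \<in> cball (snd c p) r" for x
    using r(2) that chart(5)[OF assms(1)] by fastforce
  then show ?thesis using that[OF r(1) _ r(3)] r(2) V(4,5) by blast
qed

lemma connects_near:
  assumes "c \<in> A" "cball z r \<subseteq> snd c ` fst c" "p \<in> fst c" "snd c p \<in> cball z r" "q \<in> fst c" "snd c q \<in> cball z r"
    and "\<And>x v. x \<in> cball z r \<Longrightarrow> nrm c (chart_inv c x) v \<le> \<nu> v"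
  obtains l where "connects p q l" "l \<le> \<nu> (snd c q - snd c p)"
proof -
  have "closed_segment (snd c p) (snd c q) \<subseteq> cball z r"
    using assms(4,6) by (intro closed_segment_subset) auto
  then show ?thesis
    using connects_segment[OF assms(1,3,5), of "\<nu> (snd c q - snd c p)"] assms(2,7) that by blast
qed

text \<open>Chart segments join a point to all nearby ones, so the points reachable from
  \<open>p\<close> and those not reachable both form open sets, and \<open>M\<close> is connected.
  The infimum defining the distance is thereby never over the empty set.\<close>

lemma ex_connects: "\<exists>l. connects p q l"
proof -
  let ?R = "\<lambda>p. {q. \<exists>l. connects p q l}"
  have nb: "\<exists>V. open V \<and> q \<in> V \<and> V \<subseteq> ?R q" for q
  proof -
    let ?c = "chart_at A q"
    obtain r where r: "0 < r" "cball (snd ?c q) r \<subseteq> snd ?c ` (fst ?c \<inter> UNIV)"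
      "\<And>x v. x \<in> cball (snd ?c q) r \<Longrightarrow> nrm ?c (chart_inv ?c x) v \<le> (1 + 1) * nrm ?c q v"
      by (rule nrm_bounds_near[OF chart_at open_UNIV UNIV_I zero_less_one]) (rule that; assumption)
    have "\<exists>l. connects q y l" if "y \<in> fst ?c" "snd ?c y \<in> ball (snd ?c q) r" for y
      by (rule connects_near[OF chart_at(1) _ chart_at(2) _ that(1) _ r(3)]) (use r(1,2) that(2) in auto)
    then show ?thesis
      using open_chart_preimage[OF chart_at(1) open_ball, of "q" "snd ?c q" r] chart_at(2) r(1)
      by (intro exI[of _ "fst ?c \<inter> snd ?c -` ball (snd ?c q) r"]) auto
  qed
  have o1: "open (?R p)" for p
    unfolding open_subopen[of "?R p"]
  proof
    fix q assume q: "q \<in> ?R p"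
    obtain V where "open V" "q \<in> V" "V \<subseteq> ?R q" using nb by blast
    then show "\<exists>T. open T \<and> q \<in> T \<and> T \<subseteq> ?R p" using q connects_trans by (intro exI[of _ V]) blast
  qed
  have o2: "open (- ?R p)" for p
    unfolding open_subopen[of "- ?R p"]
  proof
    fix q assume q: "q \<in> - ?R p"
    obtain V where "open V" "q \<in> V" "V \<subseteq> ?R q" using nb by blast
    then show "\<exists>T. open T \<and> q \<in> T \<and> T \<subseteq> - ?R p"
    proof (intro exI[of _ V] conjI subsetI ComplI)
      fix y assume "y \<in> V" "y \<in> ?R p"
      then obtain l l' where "connects p y l" "connects q y l'" using \<open>V \<subseteq> ?R q\<close> by blast
      then have "q \<in> ?R p" using connects_trans connects_sym by blast
      then show False using q by blast
    qed (simp_all add: \<open>open V\<close> \<open>q \<in> V\<close>)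
  qed
  have "connected (UNIV :: 'm set)" using finsler by (simp add: c1_finsler_manifold_def)
  then have clopen: "open T \<and> closed T \<longrightarrow> T = {} \<or> T = UNIV" for T :: "'m set"
    unfolding connected_clopen by simp
  have "?R p = {} \<or> ?R p = UNIV"
    by (rule clopen[THEN mp]) (intro conjI o1 o2[folded closed_def])
  moreover have "p \<in> ?R p" using nb by blast
  ultimately have "?R p = UNIV" by blast
  then show ?thesis by blast
qed

section \<open>Metric axioms and topology of the Finsler distance\<close>

lemma finsler_dist_le: "connects p q l \<Longrightarrow> finsler_dist A N p q \<le> l"
  unfolding finsler_dist_connects using connects_nonneg by (intro cInf_lower bdd_belowI[of _ 0]) auto

lemma le_finsler_dist: "(\<And>l. connects p q l \<Longrightarrow> k \<le> l) \<Longrightarrow> k \<le> finsler_dist A N p q"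
  unfolding finsler_dist_connects using ex_connects by (intro cInf_greatest) auto

lemma finsler_dist_nonneg: "0 \<le> finsler_dist A N p q"
  using connects_nonneg by (rule le_finsler_dist)

lemma finsler_dist_commute: "finsler_dist A N p q = finsler_dist A N q p"
proof -
  have "connects p q = connects q p" using connects_sym by blast
  then show ?thesis unfolding finsler_dist_connects by simp
qed

lemma finsler_dist_triangle: "finsler_dist A N p r \<le> finsler_dist A N p q + finsler_dist A N q r"
proof -
  have "finsler_dist A N p r - l \<le> finsler_dist A N q r" if "connects p q l" for l
    using finsler_dist_le[OF connects_trans[OF that]] by (intro le_finsler_dist) (simp add: algebra_simps)
  then have "finsler_dist A N p r - finsler_dist A N q r \<le> finsler_dist A N p q"
    by (intro le_finsler_dist) (simp add: algebra_simps)
  then show ?thesis by simp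
qed

lemma finsler_dist_le_nrm:
  assumes "c \<in> A" "cball z r \<subseteq> snd c ` fst c" "p \<in> fst c" "snd c p \<in> cball z r" "q \<in> fst c" "snd c q \<in> cball z r"
    and "\<And>x v. x \<in> cball z r \<Longrightarrow> nrm c (chart_inv c x) v \<le> \<nu> v"
  shows "finsler_dist A N p q \<le> \<nu> (snd c q - snd c p)"
  using connects_near[OF assms] finsler_dist_le order_trans by metis

text \<open>The curve is stopped at the first time \<open>T\<close> outside the open chart ball.
  Closedness of the closed chart ball in \<open>M\<close> keeps the point at time \<open>T\<close>
  inside the chart, at coordinate distance at least \<open>r\<close> from the start. The fundamental
  theorem of calculus bounds this displacement by the integral of the coordinate derivative, whose
  norm is at most the speed divided by \<alpha>.\<close>

lemma length_ge_of_exit: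
  assumes c: "c \<in> A" "p \<in> fst c" and r: "0 < r" "closed {q \<in> fst c. snd c q \<in> cball (snd c p) r}"
    and \<alpha>: "0 < \<alpha>" "\<And>q v. q \<in> fst c \<Longrightarrow> snd c q \<in> cball (snd c p) r \<Longrightarrow> \<alpha> * norm v \<le> nrm c q v"
    and q: "\<not> (q \<in> fst c \<and> snd c q \<in> ball (snd c p) r)" and pq: "connects p q l"
  shows "\<alpha> * r \<le> l"
proof -
  obtain a b \<gamma> where \<gamma>: "piecewise_c1_curve A a b \<gamma>" "\<gamma> a = p" "\<gamma> b = q" "curve_length A N a b \<gamma> = l"
    using pq by (auto simp: connects_def)
  have ab: "a < b" using \<gamma>(1) by (simp add: piecewise_c1_curve_def)
  note cont = piecewise_c1_curve_continuous_on[OF \<gamma>(1)]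
  let ?K = "{q \<in> fst c. snd c q \<in> cball (snd c p) r}"
  let ?O = "fst c \<inter> snd c -` ball (snd c p) r"
  have "open ?O" by (rule open_chart_preimage[OF c(1) open_ball])
  then have "closed (- ?O)" by (rule closed_Compl)
  then have "closed ({a..b} \<inter> \<gamma> -` (- ?O))"
    by (rule continuous_closed_preimage[OF cont closed_atLeastAtMost])
  then have "compact ({a..b} \<inter> \<gamma> -` (- ?O))"
    by (metis bounded_closed_interval bounded_subset compact_eq_bounded_closed inf_le1)
  moreover have "b \<in> {a..b} \<inter> \<gamma> -` (- ?O)" using q \<gamma>(3) ab by auto
  ultimately obtain T where T: "T \<in> {a..b} \<inter> \<gamma> -` (- ?O)" "\<And>t. t \<in> {a..b} \<inter> \<gamma> -` (- ?O) \<Longrightarrow> T \<le> t"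
    using compact_attains_inf[of "{a..b} \<inter> \<gamma> -` (- ?O)"] by blast
  have aO: "\<gamma> a \<in> ?O" using \<gamma>(2) c(2) r(1) by simp
  then have aT: "a < T" using T(1) by (cases "a = T") auto
  have before: "\<gamma> t \<in> ?O" if "t \<in> {a..<T}" for t using T that by force
  have K: "\<gamma> t \<in> ?K" if "t \<in> {a..T}" for t
  proof -
    have "closed ({a..T} \<inter> \<gamma> -` ?K)"
      using T(1) by (intro continuous_closed_preimage r(2) continuous_on_subset[OF cont]) auto
    moreover have "{a..<T} \<subseteq> {a..T} \<inter> \<gamma> -` ?K" using before by (auto intro: less_imp_le)
    ultimately have "closure {a..<T} \<subseteq> {a..T} \<inter> \<gamma> -` ?K" by (rule closure_minimal[rotated])
    then show ?thesis using that aT by auto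
  qed
  have "\<gamma> T \<in> ?K" using K aT by simp
  then have far: "r \<le> norm (snd c (\<gamma> T) - snd c (\<gamma> a))"
    using T(1) \<gamma>(2) by (auto simp: dist_norm norm_minus_commute)
  obtain S where S: "finite S" "\<And>t. t \<in> {a..b} - S \<Longrightarrow> isCont \<gamma> t"
    "\<And>t c. t \<in> {a..b} - S \<Longrightarrow> c \<in> A \<Longrightarrow> \<gamma> t \<in> fst c \<Longrightarrow> \<exists>d. ((snd c \<circ> \<gamma>) has_vector_derivative d) (at t)"
    by (rule piecewise_c1_curve_differentiable[OF \<gamma>(1)]) (rule that; assumption)
  \<comment> \<open>The value 0 on the exceptional set makes the bound by the speed hold at every
    time.\<close>
  define D where "D = (\<lambda>t. if t \<in> S then 0 else vector_derivative (snd c \<circ> \<gamma>) (at t))"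
  have D: "((snd c \<circ> \<gamma>) has_vector_derivative D t) (at t)" if "t \<in> {a..T} - S" for t
  proof -
    have "\<gamma> t \<in> fst c" "t \<in> {a..b} - S" using K[of t] that T(1) by auto
    then obtain d where "((snd c \<circ> \<gamma>) has_vector_derivative d) (at t)" using S(3) c(1) by blast
    then show ?thesis using that by (simp add: D_def vector_derivative_at)
  qed
  have contc: "continuous_on {a..T} (snd c \<circ> \<gamma>)"
  proof (rule continuous_on_compose)
    show "continuous_on {a..T} \<gamma>" using T(1) by (intro continuous_on_subset[OF cont]) auto
    show "continuous_on (\<gamma> ` {a..T}) (snd c)"
      using K by (intro continuous_on_subset[OF chart(3)[OF c(1)]]) blast
  qed
  have FTC: "(D has_integral (snd c \<circ> \<gamma>) T - (snd c \<circ> \<gamma>) a) {a..T}"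
    by (rule fundamental_theorem_of_calculus_interior_strong[OF S(1) less_imp_le[OF aT] D contc]) auto
  have int: "(\<lambda>t. N (velocity A \<gamma> t)) integrable_on {a..T}"
    using T(1) by (intro integrable_subinterval_real[OF speed_integrable[OF \<gamma>(1)]]) auto
  have bound: "norm (D t) \<le> N (velocity A \<gamma> t) / \<alpha>" if t: "t \<in> {a..T}" for t
  proof (cases "t \<in> S")
    case True
    then show ?thesis using speed_nonneg \<alpha>(1) by (simp add: D_def)
  next
    case False
    have "velocity A \<gamma> t = tangent A c (\<gamma> t) (D t)"
      using K[OF t] False t T(1) by (intro velocity_eq[OF c(1)] D S(2)) auto
    then have "\<alpha> * norm (D t) \<le> N (velocity A \<gamma> t)" using \<alpha>(2) K[OF t] by simp
    then show ?thesis using \<alpha>(1) by (simp add: field_simps)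
  qed
  have "norm (integral {a..T} D) \<le> integral {a..T} (\<lambda>t. N (velocity A \<gamma> t) / \<alpha>)"
    using FTC int by (intro integral_norm_bound_integral bound) (auto intro: integrable_on_divide simp: has_integral_integrable)
  also have "integral {a..T} D = snd c (\<gamma> T) - snd c (\<gamma> a)" using integral_unique[OF FTC] by simp
  finally have "r \<le> integral {a..T} (\<lambda>t. N (velocity A \<gamma> t)) / \<alpha>" using far by simp
  then have "\<alpha> * r \<le> integral {a..T} (\<lambda>t. N (velocity A \<gamma> t))" using \<alpha>(1) by (simp add: field_simps)
  also have "\<dots> \<le> integral {a..b} (\<lambda>t. N (velocity A \<gamma> t))"
    using T(1) int speed_integrable[OF \<gamma>(1)] speed_nonneg by (intro integral_subset_le) auto
  finally show ?thesis using \<gamma>(4) by (simp add: curve_length_def)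
qed

text \<open>A curve leaving a small chart ball has length at least \<open>a / 2 * r\<close>, with
  \<open>a\<close> from (P1) and the half from (P2). This separates points and lets semicontinuity
  in the manifold topology be used along sequences converging in the metric.\<close>

lemma finsler_ball_subset:
  assumes "open W" "p \<in> W"
  obtains e where "0 < e" "\<And>q. finsler_dist A N p q < e \<Longrightarrow> q \<in> W"
proof -
  let ?c = "chart_at A p"
  obtain r where r: "0 < r" "cball (snd ?c p) r \<subseteq> snd ?c ` (fst ?c \<inter> W)"
    "\<And>s. s \<le> r \<Longrightarrow> closed {q \<in> fst ?c. snd ?c q \<in> cball (snd ?c p) s}"
    "\<And>x v. x \<in> cball (snd ?c p) r \<Longrightarrow> nrm ?c p v \<le> (1 + 1) * nrm ?c (chart_inv ?c x) v"
    by (rule nrm_bounds_near[OF chart_at assms zero_less_one]) (rule that; assumption)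
  obtain a b where a: "0 < a" "0 < b" "\<And>v. a * norm v \<le> nrm ?c p v" "\<And>v. nrm ?c p v \<le> b * norm v"
    by (rule nrm_equivalent[OF chart_at]) (rule that; assumption)
  have low: "a / 2 * norm v \<le> nrm ?c q v" if "q \<in> fst ?c" "snd ?c q \<in> cball (snd ?c p) r" for q v
    using a(3)[of v] r(4)[OF that(2), of v] chart(5)[OF chart_at(1) that(1)] by simp
  have "q \<in> W" if "finsler_dist A N p q < a / 2 * r" for q
  proof (rule ccontr)
    assume "q \<notin> W"
    have "\<not> (q \<in> fst ?c \<and> snd ?c q \<in> ball (snd ?c p) r)"
    proof
      assume q: "q \<in> fst ?c \<and> snd ?c q \<in> ball (snd ?c p) r"
      then have "snd ?c q \<in> cball (snd ?c p) r" by auto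
      then obtain q' where "q' \<in> fst ?c" "q' \<in> W" "snd ?c q = snd ?c q'" using r(2) by blast
      then show False using q \<open>q \<notin> W\<close> chart(5)[OF chart_at(1)] by metis
    qed
    with a(1) have "a / 2 * r \<le> l" if "connects p q l" for l
      using length_ge_of_exit[OF chart_at r(1) r(3)[OF order_refl] _ low _ that] by simp
    then have "a / 2 * r \<le> finsler_dist A N p q" by (rule le_finsler_dist)
    then show False using that by simp
  qed
  then show ?thesis using that[of "a / 2 * r"] a(1) r(1) by auto
qed

sublocale finsler: Metric_space UNIV "finsler_dist A N"
proof
  fix p q r
  show "0 \<le> finsler_dist A N p q" by (rule finsler_dist_nonneg)
  show "finsler_dist A N p q = finsler_dist A N q p" by (rule finsler_dist_commute)
  show "finsler_dist A N p r \<le> finsler_dist A N p q + finsler_dist A N q r" by (rule finsler_dist_triangle)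
  show "(finsler_dist A N p q = 0) = (p = q)"
  proof
    assume d: "finsler_dist A N p q = 0"
    show "p = q"
    proof (rule ccontr)
      assume "p \<noteq> q"
      then obtain W where "open W" "p \<in> W" "q \<notin> W" using hausdorff by blast
      then show False using finsler_ball_subset d by metis
    qed
  next
    assume "p = q"
    let ?c = "chart_at A p"
    obtain r where r: "0 < r" "cball (snd ?c p) r \<subseteq> snd ?c ` (fst ?c \<inter> UNIV)"
      "\<And>x v. x \<in> cball (snd ?c p) r \<Longrightarrow> nrm ?c (chart_inv ?c x) v \<le> (1 + 1) * nrm ?c p v"
      by (rule nrm_bounds_near[OF chart_at open_UNIV UNIV_I zero_less_one]) (rule that; assumption)
    have "finsler_dist A N p p \<le> (1 + 1) * nrm ?c p (snd ?c p - snd ?c p)"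
      using finsler_dist_le_nrm[OF chart_at(1) _ chart_at(2) _ chart_at(2) _ r(3)] r(1,2) by auto
    also have "\<dots> = 0" using nrm_scaleR[OF chart_at, of p 0 0] by simp
    finally show "finsler_dist A N p q = 0" using finsler_dist_nonneg[of p p] \<open>p = q\<close> by simp
  qed
qed

end

section \<open>The variational argument on the manifold\<close>

text \<open>\<open>S y\<close> consists of the points with value at least \<open>f y\<close> plus
  \<epsilon> times their distance from \<open>y\<close>; these sets are nested by the triangle
  inequality. Choosing \<open>\<sigma> (Suc n)\<close> within \<open>(1/2) ^ n\<close> of the
  supremum over \<open>S (\<sigma> n)\<close> makes their diameters tend to 0, and the limit lies in
  all of them. A point violating the conclusion would lie in all of them too and thus equal the
  limit. Semicontinuity is assumed along sequences because it will come from the manifold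
  topology.\<close>

lemma (in Metric_space) ekeland:
  fixes f :: "'a \<Rightarrow> real"
  assumes complete: mcomplete and x: "x \<in> M"
    and bdd: "\<And>y. y \<in> M \<Longrightarrow> f y \<le> k"
    and usc: "\<And>\<sigma> l a. limitin mtopology \<sigma> l sequentially \<Longrightarrow> f l < a \<Longrightarrow> \<forall>\<^sub>F n in sequentially. f (\<sigma> n) < a"
    and \<epsilon>: "0 < \<epsilon>"
  obtains x0 where "x0 \<in> M" "f x \<le> f x0" "\<And>y. y \<in> M \<Longrightarrow> f y \<le> f x0 + \<epsilon> * d x0 y"
proof -
  define S where "S = (\<lambda>x. {y \<in> M. f x + \<epsilon> * d x y \<le> f y})"
  have self: "y \<in> S y" if "y \<in> M" for y using that by (simp add: S_def)
  have sub: "S z \<subseteq> S y" if "y \<in> M" "z \<in> S y" for y z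
  proof
    fix t assume t: "t \<in> S z"
    have "\<epsilon> * d y t \<le> \<epsilon> * (d y z + d z t)"
      using triangle[of y z t] that t \<epsilon> by (intro mult_left_mono) (auto simp: S_def)
    then show "t \<in> S y" using that t by (auto simp: S_def algebra_simps)
  qed
  have step: "\<exists>y. y \<in> S z \<and> (\<forall>t\<in>S z. f t \<le> f y + e)" if e: "0 < e" and z: "z \<in> M" for e z
  proof -
    have "bdd_above (f ` S z)" using bdd by (intro bdd_aboveI[of _ k]) (auto simp: S_def)
    moreover obtain y where "y \<in> S z" "Sup (f ` S z) - e < f y"
      using less_cSupD[of "f ` S z" "Sup (f ` S z) - e"] self[OF z] e by auto
    ultimately show ?thesis using cSup_upper[of _ "f ` S z"] by (intro exI[of _ y]) fastforce
  qed
  have "\<exists>\<sigma>. \<forall>n. (\<sigma> n \<in> M \<and> (n = 0 \<longrightarrow> \<sigma> n = x)) \<and>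
      (\<sigma> (Suc n) \<in> S (\<sigma> n) \<and> (\<forall>t\<in>S (\<sigma> n). f t \<le> f (\<sigma> (Suc n)) + (1/2) ^ n))"
  proof (rule dependent_nat_choice)
    fix z :: 'a and n :: nat assume "z \<in> M \<and> (n = 0 \<longrightarrow> z = x)"
    then show "\<exists>y. (y \<in> M \<and> (Suc n = 0 \<longrightarrow> y = x)) \<and> y \<in> S z \<and> (\<forall>t\<in>S z. f t \<le> f y + (1/2) ^ n)"
      using step[of "(1/2) ^ n" z] by (auto simp: S_def)
  qed (use x in auto)
  then obtain \<sigma> where \<sigma>: "\<And>n. \<sigma> n \<in> M" "\<sigma> 0 = x" "\<And>n. \<sigma> (Suc n) \<in> S (\<sigma> n)"
    "\<And>n t. t \<in> S (\<sigma> n) \<Longrightarrow> f t \<le> f (\<sigma> (Suc n)) + (1/2) ^ n" by blast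
  have mem: "\<sigma> m \<in> S (\<sigma> n)" if "n \<le> m" for n m
    using that
  proof (induction rule: dec_induct)
    case base show ?case using self \<sigma>(1) by blast
  next
    case (step m) then show ?case using sub[OF \<sigma>(1) step(3)] \<sigma>(3) by blast
  qed
  have small: "\<epsilon> * d (\<sigma> (Suc n)) t \<le> (1/2) ^ n" if "t \<in> S (\<sigma> (Suc n))" for n t
  proof -
    have "t \<in> S (\<sigma> n)" using sub[OF \<sigma>(1) \<sigma>(3)] that by blast
    with \<sigma>(4)[OF this] that show ?thesis by (simp add: S_def)
  qed
  have half: "\<exists>n. (1/2) ^ n < e" if "0 < e" for e :: real
    using real_arch_pow_inv[OF that, of "1/2"] by simp
  have "MCauchy \<sigma>" unfolding MCauchy_def
  proof (intro conjI allI impI)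
    show "range \<sigma> \<subseteq> M" using \<sigma>(1) by blast
    fix e :: real assume "0 < e"
    then obtain n where n: "(1/2) ^ n < \<epsilon> * e / 2" using half[of "\<epsilon> * e / 2"] \<epsilon> by auto
    have "d (\<sigma> m) (\<sigma> m') < e" if "Suc n \<le> m" "Suc n \<le> m'" for m m'
    proof -
      have "\<epsilon> * d (\<sigma> m) (\<sigma> m') \<le> \<epsilon> * (d (\<sigma> (Suc n)) (\<sigma> m) + d (\<sigma> (Suc n)) (\<sigma> m'))"
        using triangle[of "\<sigma> m" "\<sigma> (Suc n)" "\<sigma> m'"] commute[of "\<sigma> m" "\<sigma> (Suc n)"] \<sigma>(1) \<epsilon>
        by (intro mult_left_mono) auto
      also have "\<dots> < \<epsilon> * e"
        using small[OF mem[OF that(1)]] small[OF mem[OF that(2)]] n by (simp add: distrib_left)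
      finally show ?thesis using \<epsilon> by simp
    qed
    then show "\<exists>N. \<forall>n n'. N \<le> n \<longrightarrow> N \<le> n' \<longrightarrow> d (\<sigma> n) (\<sigma> n') < e" by blast
  qed
  then obtain x0 where lim: "limitin mtopology \<sigma> x0 sequentially" using complete by (auto simp: mcomplete_def)
  then have x0: "x0 \<in> M" and lim0: "\<And>e. 0 < e \<Longrightarrow> \<exists>N. \<forall>n\<ge>N. d (\<sigma> n) x0 < e"
    unfolding limit_metric_sequentially by blast+
  have x0S: "x0 \<in> S (\<sigma> n)" for n
  proof -
    have "f (\<sigma> n) + \<epsilon> * d (\<sigma> n) x0 \<le> f x0"
    proof (rule ccontr)
      assume "\<not> ?thesis"
      then obtain e where e: "0 < e" "f x0 < f (\<sigma> n) + \<epsilon> * d (\<sigma> n) x0 - e"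
        by (metis add_strict_increasing diff_gt_0_iff_gt dense less_diff_eq not_le add.commute)
      from usc[OF lim e(2)] obtain N1 where N1: "\<And>m. m \<ge> N1 \<Longrightarrow> f (\<sigma> m) < f (\<sigma> n) + \<epsilon> * d (\<sigma> n) x0 - e"
        by (auto simp: eventually_sequentially)
      obtain N2 where N2: "\<And>m. m \<ge> N2 \<Longrightarrow> d (\<sigma> m) x0 < e / \<epsilon>" using lim0[of "e / \<epsilon>"] e(1) \<epsilon> by auto
      obtain m where m: "n \<le> m" "N1 \<le> m" "N2 \<le> m" by (meson max.cobounded1 max.cobounded2 order_trans)
      have "f (\<sigma> n) + \<epsilon> * d (\<sigma> n) (\<sigma> m) \<le> f (\<sigma> m)" using mem[OF m(1)] by (simp add: S_def)
      moreover have "\<epsilon> * d (\<sigma> n) x0 \<le> \<epsilon> * (d (\<sigma> n) (\<sigma> m) + d (\<sigma> m) x0)"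
        using triangle[of "\<sigma> n" "\<sigma> m" x0] \<sigma>(1) x0 \<epsilon> by (intro mult_left_mono) auto
      moreover have "\<epsilon> * d (\<sigma> m) x0 < e" using N2[OF m(3)] \<epsilon> by (simp add: field_simps)
      ultimately show False using N1[OF m(2)] by (simp add: distrib_left)
    qed
    then show ?thesis using x0 by (simp add: S_def)
  qed
  have "f y \<le> f x0 + \<epsilon> * d x0 y" if "y \<in> M" for y
  proof (rule ccontr)
    assume neg: "\<not> ?thesis"
    then have "y \<in> S x0" using that by (simp add: S_def)
    then have yS: "y \<in> S (\<sigma> n)" for n using sub[OF \<sigma>(1) x0S] by blast
    have "d x0 y \<le> 0"
    proof (rule field_le_epsilon)
      fix e :: real assume "0 < e"
      then obtain n where n: "(1/2) ^ n < \<epsilon> * e / 2" using half[of "\<epsilon> * e / 2"] \<epsilon> by auto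
      have "\<epsilon> * d x0 y \<le> \<epsilon> * (d (\<sigma> (Suc n)) x0 + d (\<sigma> (Suc n)) y)"
        using triangle[of x0 "\<sigma> (Suc n)" y] commute[of x0 "\<sigma> (Suc n)"] \<sigma>(1) x0 that \<epsilon>
        by (intro mult_left_mono) auto
      also have "\<dots> < \<epsilon> * e"
        using small[OF x0S[of "Suc n"]] small[OF yS[of "Suc n"]] n by (simp add: distrib_left)
      finally show "d x0 y \<le> 0 + e" using \<epsilon> by simp
    qed
    then have "y = x0" using x0 that nonneg[of x0 y] zero[of x0 y] by simp
    then show False using neg x0 by simp
  qed
  moreover have "f x \<le> f x0"
  proof -
    have "0 \<le> \<epsilon> * d (\<sigma> 0) x0" using \<epsilon> by simp
    moreover have "f (\<sigma> 0) + \<epsilon> * d (\<sigma> 0) x0 \<le> f x0" using x0S[of 0] by (simp add: S_def)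
    ultimately show ?thesis unfolding \<sigma>(2) by linarith
  qed
  ultimately show ?thesis using x0 that by blast
qed

context finsler_manifold
begin

section \<open>From the model space to the manifold\<close>

lemma finsler_limitin_eventually:
  assumes "limitin finsler.mtopology \<sigma> l sequentially" "open W" "l \<in> W"
  shows "\<forall>\<^sub>F n in sequentially. \<sigma> n \<in> W"
proof -
  obtain e where e: "0 < e" "\<And>q. finsler_dist A N l q < e \<Longrightarrow> q \<in> W"
    by (rule finsler_ball_subset[OF assms(2,3)]) (rule that; assumption)
  obtain n0 where "\<And>n. n \<ge> n0 \<Longrightarrow> finsler_dist A N (\<sigma> n) l < e"
    using assms(1) e(1) unfolding finsler.limit_metric_sequentially by blast
  then show ?thesis using e(2) finsler_dist_commute unfolding eventually_sequentially by metis
qed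

lemma eventually_chart:
  assumes "c \<in> A" "p \<in> fst c" "\<forall>\<^sub>F x in nhds (snd c p). P x"
  shows "\<forall>\<^sub>F q in nhds p. q \<in> fst c \<and> P (snd c q)"
proof -
  obtain V where V: "open V" "snd c p \<in> V" "\<And>x. x \<in> V \<Longrightarrow> P x" using assms(3) by (auto simp: eventually_nhds)
  then show ?thesis using open_chart_preimage[OF assms(1) V(1)] assms(2)
    by (auto simp: eventually_nhds intro!: exI[of _ "fst c \<inter> snd c -` V"])
qed

text \<open>Derivative and local minimality depend only on the germ of \<open>h\<close> at
  \<open>x\<close>, so they survive when \<open>h\<close> is cut off and extended to the
  manifold.\<close>

lemma lift_test_function:
  fixes h :: "'x \<Rightarrow> real" and b :: "'x \<Rightarrow> real"
  assumes "c \<in> A" and x: "x \<in> snd c ` fst c" and h: "c1_on UNIV h" "(h has_derivative D) (at x)"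
    and b: "c1_lipschitz_bump b"
    and min: "\<forall>\<^sub>F t in nhds x. F (chart_inv c x) - h x \<le> F (chart_inv c t) - h t"
  obtains g where "c1_scalar A g" "((g \<circ> chart_inv c) has_derivative D) (at (snd c (chart_inv c x)))"
    "\<forall>\<^sub>F q in nhds (chart_inv c x). F (chart_inv c x) - g (chart_inv c x) \<le> F q - g q"
proof -
  let ?p = "chart_inv c x"
  have p: "?p \<in> fst c" "snd c ?p = x" using chart(6,7)[OF assms(1) x] by auto
  obtain g where g: "c1_scalar A g" "\<forall>\<^sub>F t in nhds x. g (chart_inv c t) = h t"
    by (rule extend_c1[OF assms(1) p(1) h(1) b, unfolded p(2)]) (rule that; assumption)
  have gp: "g ?p = h x" using g(2) by (rule eventually_nhds_x_imp_x)
  obtain V where V: "open V" "x \<in> V" "\<And>t. t \<in> V \<Longrightarrow> g (chart_inv c t) = h t"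
    using g(2) by (auto simp: eventually_nhds)
  have "((g \<circ> chart_inv c) has_derivative D) (at x)"
    by (rule has_derivative_transform_within_open[OF h(2) V(1,2)]) (simp add: V(3))
  moreover have "\<forall>\<^sub>F q in nhds ?p. F ?p - g ?p \<le> F q - g q"
  proof -
    have "\<forall>\<^sub>F q in nhds ?p. q \<in> fst c \<and> g (chart_inv c (snd c q)) = h (snd c q) \<and>
        F ?p - h x \<le> F (chart_inv c (snd c q)) - h (snd c q)"
      using eventually_chart[OF assms(1) p(1), unfolded p(2), OF eventually_conj[OF g(2) min]] .
    then show ?thesis
    proof eventually_elim
      case (elim q)
      then have "chart_inv c (snd c q) = q" using chart(5)[OF assms(1)] by blast
      with elim show ?case by (simp add: gp)
    qed
  qed
  ultimately show ?thesis using that[OF g(1)] p(2) by simp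
qed

text \<open>In a chart at \<open>x0\<close> the metric term is majorized by
  \<open>2 * \<epsilon> * n0 (x - z0)\<close> with equality at the centre, so \<open>x0\<close>
  becomes an exact minimum of three summands and \<open>fuzzy_sum\<close> applies. Up to a small
  error \<open>D1 + D2\<close> is then minus the derivative \<open>D3\<close> of a test function for
  the norm term, and \<open>D3\<close> is at most \<open>2 * \<epsilon>\<close> in the norm
  \<open>n0\<close>. Dual norms at the two points are compared with that of \<open>n0\<close> at the
  cost of a factor \<open>1 + e\<close> each.\<close>

lemma fuzzy_sum_of_approximate_minimum:
  fixes F G :: "'m \<Rightarrow> real" and b :: "'x \<Rightarrow> real"
  assumes b: "c1_lipschitz_bump b" and F: "lower_semicont F" "\<And>y. k \<le> F y"
    and G: "lipschitz_near A N G x0"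
    and min: "\<And>y. F x0 + G x0 \<le> F y + G y + \<epsilon> * finsler_dist A N x0 y"
    and \<epsilon>: "0 < \<epsilon>" and \<eta>: "0 < \<eta>"
  obtains p q g1 g2 where "c1_scalar A g1" "c1_scalar A g2"
    "\<forall>\<^sub>F y in nhds p. F p - g1 p \<le> F y - g1 y" "\<forall>\<^sub>F y in nhds q. G q - g2 q \<le> G y - g2 y"
    "F p + G q \<le> F x0 + G x0 + \<eta>" "finsler_dist A N p q \<le> \<eta>"
    "\<bar>cotangent_norm A N p (mdiff A g1 p) - cotangent_norm A N q (mdiff A g2 q)\<bar> \<le> 4 * \<epsilon> + \<eta>"
    "max (cotangent_norm A N p (mdiff A g1 p)) (cotangent_norm A N q (mdiff A g2 q)) * finsler_dist A N p q \<le> \<eta>"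
proof -
  define c where "c = chart_at A x0"
  have c: "c \<in> A" "x0 \<in> fst c" using chart_at by (auto simp: c_def)
  define z0 where "z0 = snd c x0"
  define n0 where "n0 = nrm c x0"
  have n0e: "n0 v = nrm c x0 v" for v by (simp add: n0_def)
  obtain W L where W: "open W" "x0 \<in> W" "\<And>p q. p \<in> W \<Longrightarrow> q \<in> W \<Longrightarrow> \<bar>G p - G q\<bar> \<le> L * finsler_dist A N p q"
    using G unfolding lipschitz_near_def by blast
  define l where "l = \<bar>L\<bar>"
  have l: "0 \<le> l" by (simp add: l_def)
  have Gl: "\<bar>G p - G q\<bar> \<le> l * finsler_dist A N p q" if "p \<in> W" "q \<in> W" for p q
    using W(3)[OF that] finsler_dist_nonneg[of p q] mult_right_mono[of L l] unfolding l_def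
    by (meson abs_ge_self order_trans)
  obtain \<alpha> \<beta> where \<alpha>\<beta>: "0 < \<alpha>" "0 < \<beta>" "\<And>v. \<alpha> * norm v \<le> n0 v" "\<And>v. n0 v \<le> \<beta> * norm v"
    by (rule nrm_equivalent[OF c, folded n0e]) (rule that; assumption)
  have n0: "\<And>v. 0 \<le> n0 v" "\<And>r v. n0 (r *\<^sub>R v) = \<bar>r\<bar> * n0 v" "\<And>v w. n0 (v + w) \<le> n0 v + n0 w"
    unfolding n0_def using nrm[OF c] by blast+
  have n0m: "n0 (- v) = n0 v" for v using n0(2)[of "-1" v] by simp
  have n0d: "\<bar>n0 v - n0 w\<bar> \<le> n0 (v - w)" for v w
    using n0(3)[of "v - w" w] n0(3)[of "w - v" v] n0m[of "v - w"] by simp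
  \<comment> \<open>\<open>K\<close> will bound both dual norms: \<open>T2 \<le> 4 * l\<close> by
    Lipschitz continuity, and
    \<open>T1 \<le> T2 + 3 * e * T2 + 4 * \<epsilon> + 2 * \<kappa>\<close> with \<open>e\<close>
    and \<kappa> at most 1. Then \<open>e\<close> makes \<open>3 * e * K\<close> at most
    \<open>\<eta> / 2\<close>, and the radius of the chart ball is chosen for this
    \<open>e\<close>.\<close>
  define K where "K = 16 * l + 4 * \<epsilon> + 2"
  have K: "0 < K" using l \<epsilon> by (simp add: K_def)
  define e where "e = min 1 (\<eta> / (6 * K))"
  have e: "0 < e" "e \<le> 1" using \<eta> K by (auto simp: e_def)
  have eK: "3 * e * K \<le> \<eta> / 2"
  proof -
    have "e \<le> \<eta> / (6 * K)" by (simp add: e_def)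
    then have "e * (6 * K) \<le> \<eta>" using K by (subst (asm) pos_le_divide_eq) auto
    then show ?thesis by simp
  qed
  obtain r where r: "0 < r" "cball z0 r \<subseteq> snd c ` (fst c \<inter> W)"
    "\<And>s. s \<le> r \<Longrightarrow> closed {q \<in> fst c. snd c q \<in> cball z0 s}"
    "\<And>x v. x \<in> cball z0 r \<Longrightarrow> n0 v \<le> (1 + e) * nrm c (chart_inv c x) v"
    "\<And>x v. x \<in> cball z0 r \<Longrightarrow> nrm c (chart_inv c x) v \<le> (1 + e) * n0 v"
    by (rule nrm_bounds_near[OF c W(1,2) e(1), folded n0e z0_def]) (rule that; assumption)
  have B: "chart_inv c x \<in> fst c" "chart_inv c x \<in> W" "snd c (chart_inv c x) = x" "x \<in> snd c ` fst c"
    if "x \<in> cball z0 r" for x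
  proof -
    obtain q where "q \<in> fst c" "q \<in> W" "x = snd c q" using r(2) \<open>x \<in> cball z0 r\<close> by blast
    then show "chart_inv c x \<in> fst c" "chart_inv c x \<in> W" "snd c (chart_inv c x) = x" "x \<in> snd c ` fst c"
      using chart(5)[OF c(1)] by auto
  qed
  have z0: "z0 \<in> cball z0 r" "chart_inv c z0 = x0" using r(1) chart(5)[OF c] by (auto simp: z0_def)
  have sub: "cball z0 r \<subseteq> snd c ` fst c" using r(2) by blast
  have r5: "nrm c (chart_inv c x) v \<le> 2 * n0 v" if "x \<in> cball z0 r" for x v
    using r(5)[OF that, of v] mult_right_mono[of "1 + e" 2 "n0 v"] e(2) n0(1)[of v] by simp
  have dist: "finsler_dist A N (chart_inv c x) (chart_inv c y) \<le> 2 * n0 (y - x)"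
    if "x \<in> cball z0 r" "y \<in> cball z0 r" for x y
    using finsler_dist_le_nrm[OF c(1) sub B(1)[OF that(1)] _ B(1)[OF that(2)] _ r5] B(3) that by simp
  define F1 where "F1 = F \<circ> chart_inv c"
  define F2 where "F2 = G \<circ> chart_inv c"
  define F3 where "F3 = (\<lambda>x. 2 * \<epsilon> * n0 (x - z0))"
  define l' where "l' = 2 * l * \<beta> + 2 * \<epsilon> * \<beta>"
  have l': "0 \<le> l'" using l \<alpha>\<beta> \<epsilon> by (simp add: l'_def)
  have F2n: "\<bar>F2 x - F2 y\<bar> \<le> 2 * l * n0 (x - y)" if "x \<in> cball z0 r" "y \<in> cball z0 r" for x y
  proof -
    have "\<bar>F2 x - F2 y\<bar> \<le> l * finsler_dist A N (chart_inv c x) (chart_inv c y)"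
      unfolding F2_def o_def using B(2)[OF that(1)] B(2)[OF that(2)] by (rule Gl)
    also have "\<dots> \<le> l * (2 * n0 (y - x))" using dist[OF that] l by (rule mult_left_mono)
    finally show ?thesis using n0m[of "y - x"] by simp
  qed
  have F3n: "\<bar>F3 x - F3 y\<bar> \<le> 2 * \<epsilon> * n0 (x - y)" for x y
  proof -
    have "\<bar>F3 x - F3 y\<bar> = 2 * \<epsilon> * \<bar>n0 (x - z0) - n0 (y - z0)\<bar>"
      unfolding F3_def using \<epsilon> by (simp add: abs_mult flip: right_diff_distrib)
    also have "\<dots> \<le> 2 * \<epsilon> * n0 ((x - z0) - (y - z0))" using \<epsilon> by (intro mult_left_mono n0d) auto
    finally show ?thesis by simp
  qed
  have lip2: "\<bar>F2 x - F2 y\<bar> \<le> l' * norm (x - y)" if "x \<in> cball z0 r" "y \<in> cball z0 r" for x y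
  proof -
    have "2 * l * n0 (x - y) \<le> 2 * l * (\<beta> * norm (x - y))" using \<alpha>\<beta>(4) l by (intro mult_left_mono) auto
    also have "\<dots> \<le> l' * norm (x - y)" using \<epsilon> \<alpha>\<beta>(2) by (simp add: l'_def algebra_simps)
    finally show ?thesis using F2n[OF that] by simp
  qed
  have lip3: "\<bar>F3 x - F3 y\<bar> \<le> l' * norm (x - y)" for x y
  proof -
    have "2 * \<epsilon> * n0 (x - y) \<le> 2 * \<epsilon> * (\<beta> * norm (x - y))" using \<alpha>\<beta>(4) \<epsilon> by (intro mult_left_mono) auto
    also have "\<dots> \<le> l' * norm (x - y)" using l \<alpha>\<beta>(2) by (simp add: l'_def algebra_simps)
    finally show ?thesis using F3n[of x y] by simp
  qed
  have lsc: "closed {x \<in> cball z0 r. F1 x \<le> a}" for a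
  proof -
    have "closed (- {q. a < F q})" using F(1) unfolding lower_semicont_def by (intro closed_Compl) blast
    moreover have "continuous_on (cball z0 r) (chart_inv c)" using chart(4)[OF c(1)] sub by (rule continuous_on_subset)
    ultimately have "closed (cball z0 r \<inter> chart_inv c -` (- {q. a < F q}))"
      by (intro continuous_closed_preimage) auto
    moreover have "cball z0 r \<inter> chart_inv c -` (- {q. a < F q}) = {x \<in> cball z0 r. F1 x \<le> a}"
      by (auto simp: F1_def)
    ultimately show ?thesis by simp
  qed
  have min': "F1 z0 + F2 z0 + F3 z0 \<le> F1 x + F2 x + F3 x" if "x \<in> cball z0 r" for x
  proof -
    have "\<epsilon> * finsler_dist A N x0 (chart_inv c x) \<le> \<epsilon> * (2 * n0 (x - z0))"
      using dist[OF z0(1) that] z0(2) \<epsilon> by (intro mult_left_mono) auto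
    moreover have "n0 (z0 - z0) = 0" using n0(2)[of 0 0] by simp
    ultimately show ?thesis using min[of "chart_inv c x"] by (simp add: F1_def F2_def F3_def z0(2))
  qed
  define \<kappa> where "\<kappa> = min 1 (\<eta> / 4)"
  \<comment> \<open>The accuracy demanded of \<open>fuzzy_sum\<close>. The first term turns an error
    \<open>\<eta>0 * norm v\<close> into \<open>\<kappa> * n0 v\<close>; the second keeps the
    distance of the two points, at most \<open>4 * \<beta> * \<eta>0\<close>, small even when
    multiplied by \<open>K\<close>; the third controls the value of the sum.\<close>
  define \<eta>0 where "\<eta>0 = min (\<alpha> * \<kappa>) (min (\<eta> / (4 * \<beta> * (K + 1))) (\<eta> / (1 + 2 * l * \<beta>)))"
  have \<kappa>: "0 < \<kappa>" "\<kappa> \<le> 1" "\<kappa> \<le> \<eta> / 4" using \<eta> by (auto simp: \<kappa>_def)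
  have lb: "0 \<le> 2 * l * \<beta>" using l \<alpha>\<beta>(2) by simp
  have \<eta>0: "0 < \<eta>0" "\<eta>0 \<le> \<alpha> * \<kappa>"
    using \<alpha>\<beta> \<kappa> \<eta> K lb by (auto simp: \<eta>0_def intro!: divide_pos_pos add_pos_nonneg)
  have \<eta>0K: "4 * \<beta> * \<eta>0 * (K + 1) \<le> \<eta>"
  proof -
    have "\<eta>0 \<le> \<eta> / (4 * \<beta> * (K + 1))" by (simp add: \<eta>0_def)
    then have "\<eta>0 * (4 * \<beta> * (K + 1)) \<le> \<eta>" using K \<alpha>\<beta>(2) by (subst (asm) pos_le_divide_eq) auto
    then show ?thesis by (simp add: mult_ac)
  qed
  have \<eta>0l: "\<eta>0 * (1 + 2 * l * \<beta>) \<le> \<eta>"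
  proof -
    have "\<eta>0 \<le> \<eta> / (1 + 2 * l * \<beta>)" by (simp add: \<eta>0_def)
    then show ?thesis using pos_le_divide_eq[of "1 + 2 * l * \<beta>" \<eta>0 \<eta>] lb by linarith
  qed
  have bdd: "k \<le> F1 x" for x using F(2) by (simp add: F1_def)
  obtain x y z h1 h2 h3 D1 D2 D3 where h: "c1_on UNIV h1" "c1_on UNIV h2" "c1_on UNIV h3"
    and D: "(h1 has_derivative D1) (at x)" "(h2 has_derivative D2) (at y)" "(h3 has_derivative D3) (at z)"
    and m: "\<forall>\<^sub>F t in nhds x. F1 x - h1 x \<le> F1 t - h1 t"
      "\<forall>\<^sub>F t in nhds y. F2 y - h2 y \<le> F2 t - h2 t" "\<forall>\<^sub>F t in nhds z. F3 z - h3 z \<le> F3 t - h3 t"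
    and near: "dist x z0 < \<eta>0" "dist y z0 < \<eta>0" "dist z z0 < \<eta>0" "dist x z0 < r" "dist y z0 < r" "dist z z0 < r"
    and D0: "\<And>v. \<bar>D1 v + D2 v + D3 v\<bar> \<le> \<eta>0 * norm v" and val: "F1 x \<le> F1 z0 + \<eta>0"
    by (rule fuzzy_sum[OF b r(1) lsc bdd lip2 lip3 min' l' \<eta>0(1)]) (assumption | (rule that; assumption))+
  have xC: "x \<in> cball z0 r" and yC: "y \<in> cball z0 r" using near by (auto simp: dist_commute)
  have abs_le: "\<bar>D v\<bar> \<le> M * n0 v"
    if "(h has_derivative D) (at a)" "\<forall>\<^sub>F t in nhds a. h t - h a \<le> M * n0 (t - a)" for h D a M v
  proof -
    have D: "D w \<le> M * n0 w" for w
      by (rule derivative_le_of_increment_le[OF that(1) _ that(2)]) (simp add: n0(2))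
    have "D (- v) = - D v" using has_derivative_linear[OF that(1)] by (rule linear_neg)
    then show ?thesis using D[of v] D[of "- v"] n0m[of v] by simp
  qed
  \<comment> \<open>Minimality of \<open>F2 - h2\<close> at \<open>y\<close> bounds increments of
    \<open>h2\<close> from above by those of \<open>F2\<close>, so the derivative inherits the
    Lipschitz constant.\<close>
  have D2: "\<bar>D2 v\<bar> \<le> (2 * l) * n0 v" for v
  proof (rule abs_le[OF D(2)])
    have "\<forall>\<^sub>F t in nhds y. t \<in> ball z0 r" using near(5) by (intro eventually_nhds_in_open) (auto simp: dist_commute)
    then show "\<forall>\<^sub>F t in nhds y. h2 t - h2 y \<le> (2 * l) * n0 (t - y)" using m(2)
    proof eventually_elim
      case (elim t)
      then show ?case using F2n[of t y] yC by simp
    qed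
  qed
  have D3: "\<bar>D3 v\<bar> \<le> (2 * \<epsilon>) * n0 v" for v
  proof (rule abs_le[OF D(3)])
    show "\<forall>\<^sub>F t in nhds z. h3 t - h3 z \<le> (2 * \<epsilon>) * n0 (t - z)" using m(3)
    proof eventually_elim
      case (elim t)
      then show ?case using F3n[of t z] by simp
    qed
  qed
  have D12: "\<bar>D1 v + D2 v\<bar> \<le> (2 * \<epsilon> + \<kappa>) * n0 v" for v
  proof -
    have "\<eta>0 * norm v \<le> (\<alpha> * \<kappa>) * norm v" using \<eta>0(2) by (rule mult_right_mono) simp
    also have "\<dots> = \<kappa> * (\<alpha> * norm v)" by simp
    also have "\<dots> \<le> \<kappa> * n0 v" using \<alpha>\<beta>(3) \<kappa>(1) by (intro mult_left_mono) auto
    finally show ?thesis using D0[of v] D3[of v] by (simp add: distrib_right)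
  qed
  let ?p = "chart_inv c x" and ?q = "chart_inv c y"
  obtain g1 where g1: "c1_scalar A g1" "((g1 \<circ> chart_inv c) has_derivative D1) (at (snd c ?p))"
    "\<forall>\<^sub>F s in nhds ?p. F ?p - g1 ?p \<le> F s - g1 s"
    by (rule lift_test_function[OF c(1) B(4)[OF xC] h(1) D(1) b m(1)[unfolded F1_def o_def]]) (rule that; assumption)
  obtain g2 where g2: "c1_scalar A g2" "((g2 \<circ> chart_inv c) has_derivative D2) (at (snd c ?q))"
    "\<forall>\<^sub>F s in nhds ?q. G ?q - g2 ?q \<le> G s - g2 s"
    by (rule lift_test_function[OF c(1) B(4)[OF yC] h(2) D(2) b m(2)[unfolded F2_def o_def]]) (rule that; assumption)
  define T1 where "T1 = cotangent_norm A N ?p (mdiff A g1 ?p)"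
  define T2 where "T2 = cotangent_norm A N ?q (mdiff A g2 ?q)"
  note pin = B(1)[OF xC] and qin = B(1)[OF yC]
  have T0: "0 \<le> T1" "0 \<le> T2"
    unfolding T1_def T2_def by (rule le_cotangent_norm(2)[OF c(1) pin g1(2)], rule le_cotangent_norm(2)[OF c(1) qin g2(2)])
  have D1T: "\<bar>D1 v\<bar> \<le> (T1 * (1 + e)) * n0 v" for v
    using le_cotangent_norm(1)[OF c(1) pin g1(2), of v, folded T1_def] mult_left_mono[OF r(5)[OF xC, of v] T0(1)]
    by (simp add: mult_ac)
  have D2T: "\<bar>D2 v\<bar> \<le> (T2 * (1 + e)) * n0 v" for v
    using le_cotangent_norm(1)[OF c(1) qin g2(2), of v, folded T2_def] mult_left_mono[OF r(5)[OF yC, of v] T0(2)]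
    by (simp add: mult_ac)
  have T1le: "T1 \<le> M * (1 + e)" if "0 \<le> M" "\<And>v. \<bar>D1 v\<bar> \<le> M * n0 v" for M
    unfolding T1_def
  proof (rule cotangent_norm_le[OF c(1) pin g1(2)])
    show "0 \<le> M * (1 + e)" using that(1) e(1) by simp
    show "\<bar>D1 v\<bar> \<le> M * (1 + e) * nrm c ?p v" for v
      using that(2)[of v] mult_left_mono[OF r(4)[OF xC, of v] that(1)] by (simp add: mult_ac)
  qed
  have T2le: "T2 \<le> M * (1 + e)" if "0 \<le> M" "\<And>v. \<bar>D2 v\<bar> \<le> M * n0 v" for M
    unfolding T2_def
  proof (rule cotangent_norm_le[OF c(1) qin g2(2)])
    show "0 \<le> M * (1 + e)" using that(1) e(1) by simp
    show "\<bar>D2 v\<bar> \<le> M * (1 + e) * nrm c ?q v" for v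
      using that(2)[of v] mult_left_mono[OF r(4)[OF yC, of v] that(1)] by (simp add: mult_ac)
  qed
  \<comment> \<open>Since \<open>e \<le> 1\<close>, the two factors \<open>1 + e\<close> on
    \<open>T\<close> amount to at most \<open>1 + 3 * e\<close>, and the single one on the defect at
    most doubles it.\<close>
  have sq: "(T * (1 + e) + (2 * \<epsilon> + \<kappa>)) * (1 + e) \<le> T + 3 * e * T + 4 * \<epsilon> + 2 * \<kappa>" if "0 \<le> T" for T
  proof -
    have "T * (e * e) \<le> T * e" using e that by (intro mult_left_mono) auto
    moreover have "(2 * \<epsilon> + \<kappa>) * e \<le> 2 * \<epsilon> + \<kappa>" using e \<epsilon> \<kappa> by (intro mult_left_le) auto
    ultimately show ?thesis by (simp add: algebra_simps)
  qed
  have "T2 \<le> (2 * l) * (1 + e)" using l D2 by (intro T2le) auto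
  also have "\<dots> \<le> (2 * l) * 2" using e l by (intro mult_left_mono) auto
  finally have T2l: "T2 \<le> 4 * l" by simp
  have "\<bar>D1 v\<bar> \<le> (T2 * (1 + e) + (2 * \<epsilon> + \<kappa>)) * n0 v" for v
    unfolding distrib_right[of "T2 * (1 + e)"] using D12[of v] D2T[of v] by linarith
  then have "T1 \<le> (T2 * (1 + e) + (2 * \<epsilon> + \<kappa>)) * (1 + e)" using T0 e \<epsilon> \<kappa> by (intro T1le) auto
  then have T12: "T1 \<le> T2 + 3 * e * T2 + 4 * \<epsilon> + 2 * \<kappa>" using sq[OF T0(2)] by linarith
  have "\<bar>D2 v\<bar> \<le> (T1 * (1 + e) + (2 * \<epsilon> + \<kappa>)) * n0 v" for v
    unfolding distrib_right[of "T1 * (1 + e)"] using D12[of v] D1T[of v] by linarith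
  then have "T2 \<le> (T1 * (1 + e) + (2 * \<epsilon> + \<kappa>)) * (1 + e)" using T0 e \<epsilon> \<kappa> by (intro T2le) auto
  then have T21: "T2 \<le> T1 + 3 * e * T1 + 4 * \<epsilon> + 2 * \<kappa>" using sq[OF T0(1)] by linarith
  have "e * T2 \<le> T2" using e T0 by (intro mult_left_le_one_le) auto
  then have TK: "T1 \<le> K" "T2 \<le> K" using T12 T2l \<kappa>(2) l \<epsilon> unfolding K_def by linarith+
  have "3 * e * T1 \<le> \<eta> / 2" "3 * e * T2 \<le> \<eta> / 2"
    using mult_left_mono[OF TK(1), of "3 * e"] mult_left_mono[OF TK(2), of "3 * e"] e eK by linarith+
  then have diff: "\<bar>T1 - T2\<bar> \<le> 4 * \<epsilon> + \<eta>" using T12 T21 \<kappa>(3) by (auto simp: abs_le_iff)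
  have "norm (y - x) \<le> 2 * \<eta>0"
    using near(1,2) dist_triangle2[of y x z0] by (simp add: dist_norm norm_minus_commute)
  then have "2 * (\<beta> * norm (y - x)) \<le> 2 * (\<beta> * (2 * \<eta>0))" using \<alpha>\<beta>(2) by simp
  then have dpq: "finsler_dist A N ?p ?q \<le> 4 * \<beta> * \<eta>0"
    using dist[OF xC yC] \<alpha>\<beta>(4)[of "y - x"] by linarith
  have bp: "0 \<le> 4 * \<beta> * \<eta>0" using \<alpha>\<beta>(2) \<eta>0(1) by simp
  have "(4 * \<beta> * \<eta>0) * K \<le> \<eta>" "4 * \<beta> * \<eta>0 \<le> \<eta>"
    using \<eta>0K bp mult_nonneg_nonneg[OF bp less_imp_le[OF K]] unfolding distrib_left[of _ K] by linarith+
  moreover have "max T1 T2 * finsler_dist A N ?p ?q \<le> K * (4 * \<beta> * \<eta>0)"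
    using TK T0 dpq K by (intro mult_mono) (auto simp: finsler_dist_nonneg)
  ultimately have d1: "finsler_dist A N ?p ?q \<le> \<eta>" and d2: "max T1 T2 * finsler_dist A N ?p ?q \<le> \<eta>"
    using dpq by (auto simp: mult.commute)
  have "F2 y - F2 z0 \<le> 2 * l * (\<beta> * \<eta>0)"
  proof -
    have "2 * l * n0 (y - z0) \<le> 2 * l * (\<beta> * norm (y - z0))" using \<alpha>\<beta>(4) l by (intro mult_left_mono) auto
    also have "\<dots> \<le> 2 * l * (\<beta> * \<eta>0)" using near(2) l \<alpha>\<beta>(2) by (intro mult_left_mono) (auto simp: dist_norm)
    finally show ?thesis using F2n[OF yC z0(1)] by linarith
  qed
  then have "F ?p + G ?q \<le> F x0 + G x0 + \<eta>"
    using val \<eta>0l by (simp add: F1_def F2_def z0(2) algebra_simps)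
  then show ?thesis
    using that[OF g1(1) g2(1) g1(3) g2(3) _ d1] diff d2 unfolding T1_def T2_def by blast
qed

lemma
  assumes "c1_scalar A g"
  shows c1_scalar_minus: "c1_scalar A (\<lambda>q. - g q)"
    and cotangent_norm_mdiff_minus:
      "cotangent_norm A N p (mdiff A (\<lambda>q. - g q) p) = cotangent_norm A N p (mdiff A g p)"
proof -
  have "c1_on S (\<lambda>x. - (g \<circ> chart_inv c) x)" if "c1_on S (g \<circ> chart_inv c)" for S and c :: "('m, 'x) chart"
    using that c1_deriv_cmult[of S "g \<circ> chart_inv c" _ "-1"] unfolding c1_on_c1_deriv by auto
  then show "c1_scalar A (\<lambda>q. - g q)" using assms unfolding c1_scalar_def o_def by blast
  let ?c = "chart_at A p"
  have "c1_on (snd ?c ` fst ?c) (g \<circ> chart_inv ?c)" using assms chart_at(1) unfolding c1_scalar_def by blast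
  then obtain D where D: "((g \<circ> chart_inv ?c) has_derivative D) (at (snd ?c p))"
    using c1_on_differentiable chart_at(2) by blast
  then have D': "(((\<lambda>q. - g q) \<circ> chart_inv ?c) has_derivative (\<lambda>v. - D v)) (at (snd ?c p))"
    unfolding o_def by (rule has_derivative_minus)
  have "\<bar>mdiff A (\<lambda>q. - g q) p \<xi>\<bar> = \<bar>mdiff A g p \<xi>\<bar>" if "\<xi> \<in> tangent_space A p" for \<xi>
    using that mdiff_tangent[OF chart_at D] mdiff_tangent[OF chart_at D'] tangent_space_eq[OF chart_at] by auto
  then show "cotangent_norm A N p (mdiff A (\<lambda>q. - g q) p) = cotangent_norm A N p (mdiff A g p)"
    unfolding cotangent_norm_def by (intro arg_cong[of _ _ Sup] arg_cong[of _ _ "insert 0"]) force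
qed

lemma lipschitz_near_minus: "lipschitz_near A N f x \<Longrightarrow> lipschitz_near A N (\<lambda>q. - f q) x"
  unfolding lipschitz_near_def by (simp add: abs_minus_commute)

text \<open>The two cases differ in which of \<open>- u\<close> and \<open>v\<close> is the Lipschitz summand.\<close>

lemma doubling_of_variables:
  fixes u v :: "'m \<Rightarrow> real" and b :: "'x \<Rightarrow> real"
  assumes b: "c1_lipschitz_bump b" and u: "upper_semicont u" "\<And>y. \<bar>u y\<bar> \<le> k"
    and v: "lower_semicont v" "\<And>y. \<bar>v y\<bar> \<le> k"
    and lip: "lipschitz_near A N u x0 \<or> lipschitz_near A N v x0"
    and max: "\<And>y. u y - v y \<le> u x0 - v x0 + \<epsilon> * finsler_dist A N x0 y"
    and \<epsilon>: "0 < \<epsilon>" and \<eta>: "0 < \<eta>"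
  obtains p q \<Delta> \<Delta>' where "\<Delta> \<in> superdifferential A u p" "\<Delta>' \<in> subdifferential A v q"
    "u x0 - v x0 \<le> u p - v q + \<eta>" "finsler_dist A N p q \<le> \<eta>"
    "\<bar>cotangent_norm A N p \<Delta> - cotangent_norm A N q \<Delta>'\<bar> \<le> 4 * \<epsilon> + \<eta>"
    "max (cotangent_norm A N p \<Delta>) (cotangent_norm A N q \<Delta>') * finsler_dist A N p q \<le> \<eta>"
proof -
  \<comment> \<open>A test function touching \<open>- u\<close> from below becomes, with its sign
    reversed, one touching \<open>u\<close> from above; the dual norm does not notice the
    sign.\<close>
  have super: "\<exists>\<Delta>\<in>superdifferential A u p. cotangent_norm A N p \<Delta> = cotangent_norm A N p (mdiff A g p)"
    if "c1_scalar A g" "\<forall>\<^sub>F y in nhds p. - u p - g p \<le> - u y - g y" for g p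
  proof -
    have "\<forall>\<^sub>F y in nhds p. u y - - g y \<le> u p - - g p" using that(2) by eventually_elim simp
    then have "mdiff A (\<lambda>q. - g q) p \<in> superdifferential A u p"
      using c1_scalar_minus[OF that(1)] unfolding superdifferential_def
      by (intro CollectI exI[of _ "\<lambda>q. - g q"]) simp
    then show ?thesis using cotangent_norm_mdiff_minus[OF that(1)] by blast
  qed
  have sub: "mdiff A g q \<in> subdifferential A v q"
    if "c1_scalar A g" "\<forall>\<^sub>F y in nhds q. v q - g q \<le> v y - g y" for g q
    using that unfolding subdifferential_def by blast
  show ?thesis
  proof (cases "lipschitz_near A N v x0")
    case True
    have "{x. a < - u x} = {x. u x < - a}" for a by auto
    then have F: "lower_semicont (\<lambda>q. - u q)" using u(1) by (simp add: lower_semicont_def upper_semicont_def)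
    have F': "- k \<le> - u y" for y using u(2)[of y] by simp
    have min: "- u x0 + v x0 \<le> - u y + v y + \<epsilon> * finsler_dist A N x0 y" for y using max[of y] by simp
    obtain p q g1 g2 where g: "c1_scalar A g1" "c1_scalar A g2"
      "\<forall>\<^sub>F y in nhds p. - u p - g1 p \<le> - u y - g1 y" "\<forall>\<^sub>F y in nhds q. v q - g2 q \<le> v y - g2 y"
      "- u p + v q \<le> - u x0 + v x0 + \<eta>" "finsler_dist A N p q \<le> \<eta>"
      "\<bar>cotangent_norm A N p (mdiff A g1 p) - cotangent_norm A N q (mdiff A g2 q)\<bar> \<le> 4 * \<epsilon> + \<eta>"
      "max (cotangent_norm A N p (mdiff A g1 p)) (cotangent_norm A N q (mdiff A g2 q)) * finsler_dist A N p q \<le> \<eta>"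
      by (rule fuzzy_sum_of_approximate_minimum[OF b F F' True min \<epsilon> \<eta>]) (rule that; assumption)
    obtain \<Delta> where "\<Delta> \<in> superdifferential A u p" "cotangent_norm A N p \<Delta> = cotangent_norm A N p (mdiff A g1 p)"
      using super[OF g(1,3)] by blast
    then show ?thesis using that[OF _ sub[OF g(2,4)], of \<Delta> p] g(5-8) by simp
  next
    case False
    then have G: "lipschitz_near A N (\<lambda>q. - u q) x0" using lip lipschitz_near_minus by blast
    have F': "- k \<le> v y" for y using v(2)[of y] by (simp add: abs_le_iff)
    have min: "v x0 + - u x0 \<le> v y + - u y + \<epsilon> * finsler_dist A N x0 y" for y using max[of y] by simp
    obtain q p g2 g1 where g: "c1_scalar A g2" "c1_scalar A g1"
      "\<forall>\<^sub>F y in nhds q. v q - g2 q \<le> v y - g2 y" "\<forall>\<^sub>F y in nhds p. - u p - g1 p \<le> - u y - g1 y"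
      "v q + - u p \<le> v x0 + - u x0 + \<eta>" "finsler_dist A N q p \<le> \<eta>"
      "\<bar>cotangent_norm A N q (mdiff A g2 q) - cotangent_norm A N p (mdiff A g1 p)\<bar> \<le> 4 * \<epsilon> + \<eta>"
      "max (cotangent_norm A N q (mdiff A g2 q)) (cotangent_norm A N p (mdiff A g1 p)) * finsler_dist A N q p \<le> \<eta>"
      by (rule fuzzy_sum_of_approximate_minimum[OF b v(1) F' G min \<epsilon> \<eta>]) (rule that; assumption)
    obtain \<Delta> where "\<Delta> \<in> superdifferential A u p" "cotangent_norm A N p \<Delta> = cotangent_norm A N p (mdiff A g1 p)"
      using super[OF g(2,4)] by blast
    then show ?thesis using that[OF _ sub[OF g(1,3)], of \<Delta> p] g(5-8)
      by (simp add: finsler_dist_commute[of q p] abs_minus_commute max.commute)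
  qed
qed

text \<open>The two viscosity inequalities bound \<open>u p - v q\<close> by
  \<open>H2 (q, t) - H1 (p, s)\<close>. Condition (A) for \<open>H1\<close> moves
  \<open>(p, s)\<close> to \<open>(q, t)\<close>, where the difference is at most \<tau>.\<close>

lemma comparison:
  fixes H1 H2 :: "'m \<times> real \<Rightarrow> real" and u v :: "'m \<Rightarrow> real" and b :: "'x \<Rightarrow> real"
  assumes complete: "finsler_complete A N" and b: "c1_lipschitz_bump b"
    and H1: "condition_A A N H1"
    and u: "viscosity_subsolution A N H1 u" and v: "viscosity_supersolution A N H2 v"
    and bd: "bounded (range u)" "bounded (range v)"
    and lip: "\<And>x. lipschitz_near A N u x \<or> lipschitz_near A N v x"
    and \<tau>: "\<And>z. H2 z - H1 z \<le> \<tau>"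
  shows "u x - v x \<le> \<tau>"
proof (rule field_le_epsilon)
  fix e :: real assume e: "0 < e"
  obtain C \<omega> where C: "0 \<le> C" and \<omega>: "continuous_on UNIV \<omega>" "\<omega> (0, 0) = 0"
    and A: "\<And>x1 x2 t1 t2. \<bar>H1 (x1, t1) - H1 (x2, t2)\<bar> \<le>
      \<omega> (finsler_dist A N x1 x2, t1 - t2) + C * max \<bar>t1\<bar> \<bar>t2\<bar> * finsler_dist A N x1 x2"
    using H1 unfolding condition_A_def by blast
  have "isCont \<omega> (0, 0)" using \<omega>(1) by (simp add: continuous_on_eq_continuous_at)
  then obtain \<rho> where \<rho>: "0 < \<rho>" "\<And>z. dist z (0, 0) < \<rho> \<Longrightarrow> dist (\<omega> z) (\<omega> (0, 0)) < e / 4"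
    using e unfolding continuous_at_eps_delta by (meson divide_pos_pos zero_less_numeral)
  obtain k1 k2 where "\<And>y. \<bar>u y\<bar> \<le> k1" "\<And>y. \<bar>v y\<bar> \<le> k2" using bd by (auto simp: bounded_iff)
  then have k: "\<bar>u y\<bar> \<le> max k1 k2" "\<bar>v y\<bar> \<le> max k1 k2" for y by (meson max.coboundedI1 max.coboundedI2)+
  have usc: "upper_semicont u" and lsc: "lower_semicont v"
    using u v by (auto simp: viscosity_subsolution_def viscosity_supersolution_def)
  \<comment> \<open>The argument of \<omega> will have norm at most
    \<open>4 * \<epsilon> + 2 * \<eta>\<close>, which these choices keep below \<rho>. The second
    bound on \<eta> absorbs the term with \<open>C\<close> and the loss in the values.\<close>
  define \<epsilon> where "\<epsilon> = \<rho> / 20"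
  define \<eta> where "\<eta> = min (\<rho> / 4) (e / (4 * (C + 1)))"
  have \<epsilon>: "0 < \<epsilon>" and \<eta>: "0 < \<eta>" using \<rho>(1) e C by (auto simp: \<epsilon>_def \<eta>_def)
  have \<eta>e: "C * \<eta> + \<eta> \<le> e / 4"
  proof -
    have "\<eta> \<le> e / (4 * (C + 1))" by (simp add: \<eta>_def)
    then have "\<eta> * (4 * (C + 1)) \<le> e" using C by (subst (asm) pos_le_divide_eq) auto
    then show ?thesis by (simp add: algebra_simps)
  qed
  have cpl: "finsler.mcomplete" using complete by (simp add: finsler_complete_def)
  have usc_diff: "\<forall>\<^sub>F n in sequentially. u (\<sigma> n) - v (\<sigma> n) < a"
    if lim: "limitin finsler.mtopology \<sigma> l sequentially" and lt: "u l - v l < a" for \<sigma> l a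
  proof -
    \<comment> \<open>A level strictly between lets the semicontinuity of \<open>u\<close> and that
      of \<open>v\<close> be applied separately.\<close>
    obtain s where s: "u l < s" "s < a + v l" using dense[of "u l" "a + v l"] lt by auto
    have "\<forall>\<^sub>F n in sequentially. \<sigma> n \<in> {y. u y < s}" "\<forall>\<^sub>F n in sequentially. \<sigma> n \<in> {y. s - a < v y}"
      using usc lsc s
      by (intro finsler_limitin_eventually[OF lim]; simp add: upper_semicont_def lower_semicont_def)+
    then show ?thesis by eventually_elim auto
  qed
  have bd_diff: "u y - v y \<le> 2 * max k1 k2" for y using k[of y] by (auto simp: abs_le_iff)
  obtain x0 where x0: "u x - v x \<le> u x0 - v x0"
    "\<And>y. u y - v y \<le> u x0 - v x0 + \<epsilon> * finsler_dist A N x0 y"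
    by (rule finsler.ekeland[where x = x, OF cpl UNIV_I bd_diff usc_diff \<epsilon>]) (assumption | (rule that; simp))+
  obtain p q \<Delta> \<Delta>' where pq: "\<Delta> \<in> superdifferential A u p" "\<Delta>' \<in> subdifferential A v q"
    "u x0 - v x0 \<le> u p - v q + \<eta>" "finsler_dist A N p q \<le> \<eta>"
    "\<bar>cotangent_norm A N p \<Delta> - cotangent_norm A N q \<Delta>'\<bar> \<le> 4 * \<epsilon> + \<eta>"
    "max (cotangent_norm A N p \<Delta>) (cotangent_norm A N q \<Delta>') * finsler_dist A N p q \<le> \<eta>"
    by (rule doubling_of_variables[OF b usc k(1) lsc k(2) lip x0(2) \<epsilon> \<eta>]) (rule that; assumption)
  define s where "s = cotangent_norm A N p \<Delta>"
  define t where "t = cotangent_norm A N q \<Delta>'"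
  obtain g g' where g: "\<Delta> = mdiff A g p" "c1_scalar A g" "\<Delta>' = mdiff A g' q" "c1_scalar A g'"
    using pq(1,2) unfolding superdifferential_def subdifferential_def by blast
  have nonneg: "0 \<le> cotangent_norm A N p (mdiff A g p)" if "c1_scalar A g" for g p
  proof -
    have "c1_on (snd (chart_at A p) ` fst (chart_at A p)) (g \<circ> chart_inv (chart_at A p))"
      using that chart_at(1) unfolding c1_scalar_def by blast
    then show ?thesis using le_cotangent_norm(2)[OF chart_at] c1_on_differentiable chart_at(2) by blast
  qed
  have st: "0 \<le> s" "0 \<le> t" using nonneg g by (auto simp: s_def t_def)
  have "u p + H1 (p, s) \<le> 0" using u pq(1) by (auto simp: viscosity_subsolution_def s_def)
  moreover have "0 \<le> v q + H2 (q, t)" using v pq(2) by (auto simp: viscosity_supersolution_def t_def)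
  moreover have "H2 (q, t) - H1 (q, t) \<le> \<tau>" by (rule \<tau>)
  moreover have "\<bar>H1 (q, t) - H1 (p, s)\<bar> \<le> \<omega> (finsler_dist A N q p, t - s) + C * max \<bar>t\<bar> \<bar>s\<bar> * finsler_dist A N q p"
    by (rule A)
  moreover have "C * max \<bar>t\<bar> \<bar>s\<bar> * finsler_dist A N q p \<le> C * \<eta>"
    using mult_left_mono[OF pq(6) C] st unfolding s_def[symmetric] t_def[symmetric]
    by (simp add: mult_ac max.commute finsler_dist_commute[of q p])
  moreover have "\<omega> (finsler_dist A N q p, t - s) < e / 4"
  proof -
    have "\<eta> \<le> \<rho> / 4" unfolding \<eta>_def by (rule min.cobounded1)
    have "dist (finsler_dist A N q p, t - s) (0, 0) \<le> \<bar>finsler_dist A N q p\<bar> + \<bar>t - s\<bar>"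
      unfolding dist_Pair_Pair dist_real_def
      using sqrt_sum_squares_le_sum_abs[of "finsler_dist A N q p" "t - s"] by simp
    also have "\<dots> \<le> \<eta> + (4 * \<epsilon> + \<eta>)"
      using pq(4,5) finsler_dist_nonneg[of q p] unfolding s_def t_def
      by (intro add_mono) (auto simp: finsler_dist_commute[of q p] abs_minus_commute)
    also have "\<dots> < \<rho>" using \<open>\<eta> \<le> \<rho> / 4\<close> \<rho>(1) by (simp add: \<epsilon>_def)
    finally have "dist (\<omega> (finsler_dist A N q p, t - s)) (\<omega> (0, 0)) < e / 4" by (rule \<rho>(2))
    then show ?thesis using \<omega>(2) by (simp add: dist_norm)
  qed
  ultimately show "u x - v x \<le> \<tau> + e" using x0(1) pq(3) \<eta>e e by linarith
qed

end

theorem proposition4p6: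
  fixes A :: "('m::t2_space, 'x::banach) chart set"
    and N :: "('m, 'x) tvec \<Rightarrow> real"
    and H1 H2 :: "'m \<times> real \<Rightarrow> real"
    and u v :: "'m \<Rightarrow> real"
  assumes "c1_finsler_manifold A N"
    and "finsler_complete A N"
    and "\<exists>b :: 'x \<Rightarrow> real. c1_lipschitz_bump b"
    and "continuous_on UNIV H1" and "continuous_on UNIV H2"
    and "condition_A A N H1" and "condition_A A N H2"
    and "viscosity_subsolution A N H1 u"
    and "viscosity_supersolution A N H2 v"
    and "bounded (range u)" and "bounded (range v)"
    and "\<And>x. lipschitz_near A N u x \<or> lipschitz_near A N v x"
  shows "(SUP x. ereal (u x - v x)) \<le> (SUP z. ereal (H2 z - H1 z))"
proof -
  interpret finsler_manifold A N
    using assms(1) by unfold_locales (auto simp: c1_finsler_manifold_def)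
  obtain b :: "'x \<Rightarrow> real" where b: "c1_lipschitz_bump b" using assms(3) by blast
  let ?T = "SUP z. ereal (H2 z - H1 z)"
  have up: "ereal (H2 z - H1 z) \<le> ?T" for z by (rule SUP_upper) simp
  show ?thesis
  \<comment> \<open>The supremum bounds real numbers from above and so is not
    \<open>-\<infinity>\<close>; if it is \<open>\<infinity>\<close> there is nothing to
    prove.\<close>
  proof (cases ?T)
    case (real \<tau>)
    have "u x - v x \<le> \<tau>" for x
      using comparison[OF assms(2) b assms(6,8-12)] up unfolding real by simp
    then show ?thesis unfolding real by (intro SUP_least) simp
  qed (use up in auto)
qed

end
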